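(* Let $c>0$ and $\alpha\ge 0$ be real numbers. Every $f\in B_c^{(\alpha)}$ satisfies $\widehat f(x)=g(x)\,\omega_\alpha(x/c)$ on $(-c,c)$ for some $g\in L^2\big((-c,c),\omega_\alpha(\tfrac{\cdot}{c})\big)$, and the maximum $$\max_{0\neq f\in B_c^{(\alpha)}} \; 2\pi\,\frac{\|f\|^2_{L^2(I,\omega_\alpha)}}{\|\widehat f\|^2_{L^2((-c,c),\,\omega_{-\alpha}(\frac{\cdot}{c}))}}$$ is attained when $g$ is an eigenfunction, associated with the largest eigenvalue, of the compact operator on $L^2\big((-c,c),\omega_\alpha(\tfrac{\cdot}{c})\big)$ $$2\pi\,\mathcal Q^{\alpha}g(x)=\frac{1}{2\pi}\int_{-c}^c\mathcal K_\alpha(y-x)\,g(y)\,\omega_\alpha\Big(\frac yc\Big)\,dy .$$ Moreover, by the change of variables $G(x)=g(cx)$, the eigenproblem for $2\pi\mathcal Q^{\alpha}$ is equivalent to the eigenproblem $$\mathcal Q_c^{(\alpha)}G(x)=\int_{-1}^1\frac{c}{2\pi}\,\mathcal K_\alpha(c(x-y))\,G(y)\,\omega_\alpha(y)\,dy=\lambda\,G(x),\qquad x\in[-1,1],$$ whose eigenfunctions are the GPSWFs $\psi_{n,c}^{(\alpha)}$, $n\ge0$, with respective eigenvalues $\lambda_n^{(\alpha)}(c)=\frac{c}{2\pi}|\mu_n^{(\alpha)}(c)|^2$. In particular $$\max_{0\neq f\in B_c^{(\alpha)}} \; 2\pi\,\frac{\|f\|^2_{L^2(I,\omega_\alpha)}}{\|\widehat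 f\|^2_{L^2((-c,c),\,\omega_{-\alpha}(\frac{\cdot}{c}))}}=\lambda_0^{(\alpha)}(c).$$
   Context: Let $I=[-1,1]$, $\omega_\alpha(y)=(1-y^2)^\alpha$, and $\widehat f(\xi)=\int_{\mathbb R}e^{-ix\xi}f(x)\,dx$ (in the $L^2$ sense). For a weight $w$ on an interval $J$, $\|f\|^2_{L^2(J,w)}=\int_J|f|^2w$. The restricted Paley--Wiener space is $$B_c^{(\alpha)}=\{f\in L^2(\mathbb R):\ \operatorname{Support}\widehat f\subseteq[-c,c],\ \widehat f\in L^2\big((-c,c),\omega_{-\alpha}(\tfrac{\cdot}{c})\big)\}.$$ The kernel is $\mathcal K_\alpha(x)=\int_{-1}^1e^{ixy}\omega_\alpha(y)\,dy=\sqrt\pi\,2^{\alpha+1/2}\,\Gamma(\alpha+1)\,\frac{J_{\alpha+1/2}(x)}{x^{\alpha+1/2}}$, where $J_\nu$ is the Bessel function of the first kind. The weighted finite Fourier transform on $L^2(I,\omega_\alpha)$ is $\mathcal F_c^{(\alpha)}f(x)=\int_{-1}^1e^{icxy}f(y)\omega_\alpha(y)\,dy$. It commutes with $\mathcal L_c^{(\alpha,\alpha)}\varphi(x)=(1-x^2)\varphi''(x)-(2\alpha+2)x\varphi'(x)-c^2x^2\varphi(x)$ on $C^2([-1,1])$. The GPSWFs $\psi_{n,c}^{(\alpha)}$, $n\ge0$, are the real-valued $C^2([-1,1])$ eigenfunctions of $-\mathcal L_c^{(\alpha,\alpha)}$, numbered by increasing eigenvalue and normalized in $L^2(I,\omega_\alpha)$;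 they are also the eigenfunctions of $\mathcal F_c^{(\alpha)}$, with $\mathcal F_c^{(\alpha)}\psi_{n,c}^{(\alpha)}=\mu_n^{(\alpha)}(c)\psi_{n,c}^{(\alpha)}$, and $\lambda_0^{(\alpha)}(c)>\lambda_1^{(\alpha)}(c)>\cdots$. *)

theory Defs
  imports "HOL-Analysis.Analysis"
begin

section \<open>Weighted L2 spaces\<close>

text \<open>Elements of the spaces are Borel representatives; only their values on the set \<open>J\<close> matter,
  and all identities between elements are meant almost everywhere.\<close>

definition L2w :: "real set \<Rightarrow> (real \<Rightarrow> real) \<Rightarrow> (real \<Rightarrow> complex) set" where
  "L2w J w = {f. set_borel_measurable lborel J f \<and>
                 set_integrable lborel J (\<lambda>x. (cmod (f x))\<^sup>2 * w x)}"

definition L2_norm_sq :: "real set \<Rightarrow> (real \<Rightarrow> real) \<Rightarrow> (real \<Rightarrow> complex) \<Rightarrow> real" where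
  "L2_norm_sq J w f = (LINT x:J|lborel. (cmod (f x))\<^sup>2 * w x)"

abbreviation L2_line :: "(real \<Rightarrow> complex) set" where
  "L2_line \<equiv> L2w UNIV (\<lambda>_. 1)"

definition L2_eigenfunction ::
  "real set \<Rightarrow> (real \<Rightarrow> real) \<Rightarrow> ((real \<Rightarrow> complex) \<Rightarrow> real \<Rightarrow> complex) \<Rightarrow> complex \<Rightarrow> (real \<Rightarrow> complex) \<Rightarrow> bool"
  where
  "L2_eigenfunction J w T lam g \<longleftrightarrow>
     g \<in> L2w J w \<and> \<not> (AE x in lborel. x \<in> J \<longrightarrow> g x = 0) \<and>
     (AE x in lborel. x \<in> J \<longrightarrow> T g x = lam * g x)"

definition largest_L2_eigenvalue ::
  "real set \<Rightarrow> (real \<Rightarrow> real) \<Rightarrow> ((real \<Rightarrow> complex) \<Rightarrow> real \<Rightarrow> complex) \<Rightarrow> real \<Rightarrow> bool" where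
  "largest_L2_eigenvalue J w T lam \<longleftrightarrow>
     (\<exists>g. L2_eigenfunction J w T (of_real lam) g) \<and>
     (\<forall>z g. L2_eigenfunction J w T z g \<longrightarrow> z \<in> \<real> \<and> Re z \<le> lam)"

text \<open>Linear endomorphism of the weighted space sending bounded sequences to sequences with a
  norm-convergent subsequence.\<close>

definition compact_L2_operator ::
  "real set \<Rightarrow> (real \<Rightarrow> real) \<Rightarrow> ((real \<Rightarrow> complex) \<Rightarrow> real \<Rightarrow> complex) \<Rightarrow> bool" where
  "compact_L2_operator J w T \<longleftrightarrow>
     (\<forall>f \<in> L2w J w. T f \<in> L2w J w) \<and>
     (\<forall>f \<in> L2w J w. \<forall>g \<in> L2w J w. \<forall>a b. AE x in lborel. x \<in> J \<longrightarrow>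
        T (\<lambda>t. a * f t + b * g t) x = a * T f x + b * T g x) \<and>
     (\<forall>u :: nat \<Rightarrow> real \<Rightarrow> complex.
        (\<forall>n. u n \<in> L2w J w) \<and> (\<exists>C. \<forall>n. L2_norm_sq J w (u n) \<le> C) \<longrightarrow>
        (\<exists>r h. strict_mono (r :: nat \<Rightarrow> nat) \<and> h \<in> L2w J w \<and>
           (\<lambda>n. L2_norm_sq J w (\<lambda>x. T (u (r n)) x - h x)) \<longlonglongrightarrow> 0))"

section \<open>The Fourier transform on the line\<close>

text \<open>The transform of \<open>f\<close> is the limit in the mean of the integrals over \<open>[-R, R]\<close>. The
  nonnegative integral is used so that convergence cannot hold by a junk value.\<close>

definition is_L2_fourier :: "(real \<Rightarrow> complex) \<Rightarrow> (real \<Rightarrow> complex) \<Rightarrow> bool" where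
  "is_L2_fourier f F \<longleftrightarrow> F \<in> L2_line \<and>
     ((\<lambda>R::real. \<integral>\<^sup>+ \<xi>. ennreal ((cmod (F \<xi> -
          (LINT x:{-R..R}|lborel. exp (- (\<i> * of_real (x * \<xi>))) * f x)))\<^sup>2) \<partial>lborel)
        \<longlongrightarrow> 0) at_top"

definition L2_fourier :: "(real \<Rightarrow> complex) \<Rightarrow> real \<Rightarrow> complex" where
  "L2_fourier f = (SOME F. is_L2_fourier f F)"

definition ess_support :: "(real \<Rightarrow> complex) \<Rightarrow> real set" where
  "ess_support F = {x. \<forall>U. open U \<and> x \<in> U \<longrightarrow> \<not> (AE y in lborel. y \<in> U \<longrightarrow> F y = 0)}"

section \<open>Paley--Wiener space, kernel and integral operators\<close>

definition \<omega> :: "real \<Rightarrow> real \<Rightarrow> real" where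
  "\<omega> \<alpha> y = (1 - y\<^sup>2) powr \<alpha>"

abbreviation I :: "real set" where
  "I \<equiv> {-1..1}"

abbreviation band :: "real \<Rightarrow> real set" where
  "band c \<equiv> {-c<..<c}"

abbreviation band_weight :: "real \<Rightarrow> real \<Rightarrow> real \<Rightarrow> real" where
  "band_weight c \<alpha> \<equiv> (\<lambda>x. \<omega> \<alpha> (x / c))"

definition paley_wiener :: "real \<Rightarrow> real \<Rightarrow> (real \<Rightarrow> complex) set" where
  "paley_wiener c \<alpha> = {f \<in> L2_line.
     ess_support (L2_fourier f) \<subseteq> {-c..c} \<and>
     L2_fourier f \<in> L2w (band c) (band_weight c (-\<alpha>))}"

definition energy_ratio :: "real \<Rightarrow> real \<Rightarrow> (real \<Rightarrow> complex) \<Rightarrow> real" where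
  "energy_ratio c \<alpha> f = 2 * pi * (L2_norm_sq I (\<omega> \<alpha>) f /
     L2_norm_sq (band c) (band_weight c (-\<alpha>)) (L2_fourier f))"

definition nonzero_paley_wiener :: "real \<Rightarrow> real \<Rightarrow> (real \<Rightarrow> complex) \<Rightarrow> bool" where
  "nonzero_paley_wiener c \<alpha> f \<longleftrightarrow> f \<in> paley_wiener c \<alpha> \<and> \<not> (AE x in lborel. f x = 0)"

definition kernel :: "real \<Rightarrow> real \<Rightarrow> complex" where
  "kernel \<alpha> x = (LINT y:I|lborel. exp (\<i> * of_real (x * y)) * of_real (\<omega> \<alpha> y))"

text \<open>This is the operator written \<open>2\<pi>Q\<close> (with upper index \<open>\<alpha>\<close>), prefactor included.\<close>

definition two_pi_Q :: "real \<Rightarrow> real \<Rightarrow> (real \<Rightarrow> complex) \<Rightarrow> real \<Rightarrow> complex" where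
  "two_pi_Q c \<alpha> g x = of_real (1 / (2 * pi)) *
     (LINT y:band c|lborel. kernel \<alpha> (y - x) * g y * of_real (\<omega> \<alpha> (y / c)))"

definition Q_c :: "real \<Rightarrow> real \<Rightarrow> (real \<Rightarrow> complex) \<Rightarrow> real \<Rightarrow> complex" where
  "Q_c c \<alpha> G x =
     (LINT y:I|lborel. of_real (c / (2 * pi)) * kernel \<alpha> (c * (x - y)) * G y * of_real (\<omega> \<alpha> y))"

definition F_c :: "real \<Rightarrow> real \<Rightarrow> (real \<Rightarrow> complex) \<Rightarrow> real \<Rightarrow> complex" where
  "F_c c \<alpha> f x =
     (LINT y:I|lborel. exp (\<i> * of_real (c * x * y)) * f y * of_real (\<omega> \<alpha> y))"

section \<open>Generalized prolate spheroidal wave functions\<close>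

text \<open>Derivatives are taken within \<open>[-1, 1]\<close>, hence one-sided at the endpoints.\<close>

definition deriv_I :: "(real \<Rightarrow> real) \<Rightarrow> real \<Rightarrow> real" where
  "deriv_I \<phi> x = vector_derivative \<phi> (at x within I)"

definition C2_on_I :: "(real \<Rightarrow> real) \<Rightarrow> bool" where
  "C2_on_I \<phi> \<longleftrightarrow> \<phi> differentiable_on I \<and> deriv_I \<phi> differentiable_on I \<and>
     continuous_on I (deriv_I (deriv_I \<phi>))"

definition L_op :: "real \<Rightarrow> real \<Rightarrow> (real \<Rightarrow> real) \<Rightarrow> real \<Rightarrow> real" where
  "L_op c \<alpha> \<phi> x = (1 - x\<^sup>2) * deriv_I (deriv_I \<phi>) x - (2 * \<alpha> + 2) * x * deriv_I \<phi> x
     - c\<^sup>2 * x\<^sup>2 * \<phi> x"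

definition minus_L_eigenfunction :: "real \<Rightarrow> real \<Rightarrow> real \<Rightarrow> (real \<Rightarrow> real) \<Rightarrow> bool" where
  "minus_L_eigenfunction c \<alpha> \<kappa> \<phi> \<longleftrightarrow> C2_on_I \<phi> \<and> (\<exists>x\<in>I. \<phi> x \<noteq> 0) \<and>
     (\<forall>x\<in>I. - L_op c \<alpha> \<phi> x = \<kappa> * \<phi> x)"

text \<open>The functions \<open>\<psi> n\<close> are all the eigenfunctions up to scalar multiples (the eigenvalues are
  simple), so normalization determines each of them up to sign.\<close>

definition is_GPSWF :: "real \<Rightarrow> real \<Rightarrow> (nat \<Rightarrow> real \<Rightarrow> real) \<Rightarrow> bool" where
  "is_GPSWF c \<alpha> \<psi> \<longleftrightarrow>
     (\<exists>\<kappa> :: nat \<Rightarrow> real. strict_mono \<kappa> \<and>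
        (\<forall>n. minus_L_eigenfunction c \<alpha> (\<kappa> n) (\<psi> n)) \<and>
        (\<forall>k \<phi>. minus_L_eigenfunction c \<alpha> k \<phi> \<longrightarrow>
           (\<exists>n a. k = \<kappa> n \<and> (\<forall>x\<in>I. \<phi> x = a * \<psi> n x)))) \<and>
     (\<forall>n. (LINT x:I|lborel. (\<psi> n x)\<^sup>2 * \<omega> \<alpha> x) = 1)"

definition mu :: "real \<Rightarrow> real \<Rightarrow> (nat \<Rightarrow> real \<Rightarrow> real) \<Rightarrow> nat \<Rightarrow> complex" where
  "mu c \<alpha> \<psi> n = (THE m. \<forall>x\<in>I. F_c c \<alpha> (\<lambda>y. of_real (\<psi> n y)) x = m * of_real (\<psi> n x))"

definition lambda :: "real \<Rightarrow> real \<Rightarrow> (nat \<Rightarrow> real \<Rightarrow> real) \<Rightarrow> nat \<Rightarrow> real" where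
  "lambda c \<alpha> \<psi> n = c / (2 * pi) * (cmod (mu c \<alpha> \<psi> n))\<^sup>2"

end

theory Submission
  imports Defs "HOL-Probability.Characteristic_Functions" "HOL-Complex_Analysis.Great_Picard"
begin

text \<open>Let the Fourier transform of \<open>f\<close> be \<open>g\<close> times the weight, and let \<open>G(t) = g(ct)\<close>. Fourier inversion turns the
  energy ratio of \<open>f\<close> into the Rayleigh quotient of \<open>Q\<close> at \<open>G\<close>, because \<open>Q\<close> is \<open>c/2\<pi>\<close> times the
  finite Fourier transform followed by its adjoint. So the maximum is the top eigenvalue of a compact
  positive operator. The differential operator commutes with \<open>Q\<close>, since it acts in the same way on
  both variables of the kernel; it therefore preserves the eigenspaces of \<open>Q\<close> and acts on each as a
  bounded symmetric operator. A compactness argument there produces common eigenvectors, which are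
  multiples of the \<open>\<psi>\<close>s, so no completeness theorem for the \<open>\<psi>\<close>s is needed.\<close>

section \<open>The Fourier transform of integrable functions\<close>

text \<open>The differential operator is unbounded, which is the obstacle to using it inside an L2
  argument. On an eigenspace of \<open>Q\<close> with eigenvalue \<open>z \<noteq> 0\<close> it is
  tamed by the identity \<open>v = Qr v / z\<close>: derivatives of \<open>v\<close> fall on the
  smooth kernel, so the operator becomes the bounded integral operator \<open>Lr / z\<close>, and a
  bounded sequence in the eigenspace is, up to the factor \<open>1 / z\<close>, a sequence of images
  under \<open>Q\<close>, hence has uniformly convergent subsequences. Division by \<open>z\<close>
  makes the eigenvalue 0 a separate case: a finite Fourier transform that vanishes on the interval
  has vanishing derivatives there, so all moments vanish, so the full Fourier transform vanishes,
  and Plancherel gives the zero function.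

  Elements of the spaces are representatives, not classes. The Hilbert space arguments are therefore
  run with a form that is only semidefinite, and equations known almost everywhere are made
  pointwise by replacing \<open>v\<close> with the representative \<open>Qr v / z\<close> or by
  continuity.\<close>

lemma Fubini_bounded_kernel:
  fixes a :: "'a \<Rightarrow> complex" and b :: "'b \<Rightarrow> complex" and k :: "'a \<Rightarrow> 'b \<Rightarrow> complex"
  assumes "sigma_finite_measure M1" "sigma_finite_measure M2"
    and a: "integrable M1 a" and b: "integrable M2 b"
    and k: "case_prod k \<in> borel_measurable (M1 \<Otimes>\<^sub>M M2)" and B: "\<And>x y. norm (k x y) \<le> B"
  shows "(\<integral>x. a x * (\<integral>y. k x y * b y \<partial>M2) \<partial>M1) = (\<integral>y. b y * (\<integral>x. k x y * a x \<partial>M1) \<partial>M2)"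
proof -
  interpret pair_sigma_finite M1 M2 using assms by (simp add: pair_sigma_finite_def)
  have [measurable]: "a \<in> borel_measurable M1" "b \<in> borel_measurable M2" using a b by auto
  note k[measurable]
  have kx: "k x \<in> borel_measurable M2" if "x \<in> space M1" for x
    using measurable_Pair2[OF k that] by simp
  have int2: "integrable M2 (\<lambda>y. k x y * b y)" if "x \<in> space M1" for x
  proof (rule Bochner_Integration.integrable_bound[of _ "\<lambda>y. B * norm (b y)"])
    show "integrable M2 (\<lambda>y. B * norm (b y))" using b by simp
    show "(\<lambda>y. k x y * b y) \<in> borel_measurable M2" using kx[OF that] by measurable
    show "AE y in M2. norm (k x y * b y) \<le> norm (B * norm (b y))"
    proof (rule AE_I2)
      fix y 
      have "norm (k x y * b y) \<le> B * norm (b y)" by (simp add: norm_mult mult_right_mono B)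
      also have "\<dots> \<le> norm (B * norm (b y))" by simp
      finally show "norm (k x y * b y) \<le> norm (B * norm (b y))" .
    qed
  qed
  have "integrable (M1 \<Otimes>\<^sub>M M2) (\<lambda>(x, y). a x * (k x y * b y))"
  proof (rule Fubini_integrable)
    show "(\<lambda>(x, y). a x * (k x y * b y)) \<in> borel_measurable (M1 \<Otimes>\<^sub>M M2)" by measurable
    show "AE x in M1. integrable M2 (\<lambda>y. case (x, y) of (x, y) \<Rightarrow> a x * (k x y * b y))"
      by (rule AE_I2) (simp add: int2)
    show "integrable M1 (\<lambda>x. \<integral> y. norm (case (x, y) of (x, y) \<Rightarrow> a x * (k x y * b y)) \<partial>M2)"
    proof (rule Bochner_Integration.integrable_bound[of _ "\<lambda>x. norm (a x) * (B * (\<integral>y. norm (b y) \<partial>M2))"])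
      show "integrable M1 (\<lambda>x. norm (a x) * (B * (\<integral>y. norm (b y) \<partial>M2)))" using a by simp
      show "(\<lambda>x. \<integral> y. norm (case (x, y) of (x, y) \<Rightarrow> a x * (k x y * b y)) \<partial>M2) \<in> borel_measurable M1"
        by measurable
      show "AE x in M1. norm (\<integral> y. norm (case (x, y) of (x, y) \<Rightarrow> a x * (k x y * b y)) \<partial>M2)
             \<le> norm (norm (a x) * (B * (\<integral>y. norm (b y) \<partial>M2)))"
      proof (rule AE_I2)
        fix x assume x: "x \<in> space M1"
        have "norm (\<integral> y. norm (case (x, y) of (x, y) \<Rightarrow> a x * (k x y * b y)) \<partial>M2)
            = norm (a x) * (\<integral>y. norm (k x y * b y) \<partial>M2)"
          by (simp add: norm_mult)
        also have "(\<integral>y. norm (k x y * b y) \<partial>M2) \<le> (\<integral>y. B * norm (b y) \<partial>M2)"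
          using integrable_norm[OF int2[OF x]] b by (intro integral_mono) (auto simp: norm_mult intro!: mult_right_mono B)
        also have "norm (a x) * \<dots> \<le> norm (norm (a x) * (B * (\<integral>y. norm (b y) \<partial>M2)))"
          by (auto simp: abs_mult intro!: mult_left_mono mult_right_mono)
        finally show "norm (\<integral> y. norm (case (x, y) of (x, y) \<Rightarrow> a x * (k x y * b y)) \<partial>M2)
             \<le> norm (norm (a x) * (B * (\<integral>y. norm (b y) \<partial>M2)))"
          by (simp add: mult_left_mono)
      qed
    qed
  qed
  from Fubini_integral[OF this]
  have "(\<integral>x. (\<integral>y. a x * (k x y * b y) \<partial>M2) \<partial>M1) = (\<integral>y. (\<integral>x. b y * (k x y * a x) \<partial>M1) \<partial>M2)"
    by (simp add: mult_ac)
  then show ?thesis by simp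
qed

section \<open>Continuity of translations in L1 and in L2\<close>

lemma integrable_lborel_shift:
  fixes f :: "real \<Rightarrow> 'a::{banach, second_countable_topology}"
  assumes "integrable lborel f"
  shows "integrable lborel (\<lambda>x. f (x + t))"
  using lborel_integrable_real_affine[OF assms, of 1 t] by (simp add: add.commute)

lemma integral_lborel_shift:
  fixes f :: "real \<Rightarrow> 'a::{banach, second_countable_topology}"
  shows "(\<integral>x. f (x + t) \<partial>lborel) = (\<integral>x. f x \<partial>lborel)"
  using lborel_integral_real_affine[of 1 f t] by (simp add: add.commute)

definition L1_shift :: "(real \<Rightarrow> real) \<Rightarrow> real \<Rightarrow> real" where
  "L1_shift f t = (\<integral>x. \<bar>f (x + t) - f x\<bar> \<partial>lborel)"

lemma L1_shift_nonneg: "0 \<le> L1_shift f t"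
  by (simp add: L1_shift_def)

lemma integrable_L1_shift:
  fixes f :: "real \<Rightarrow> real"
  assumes "integrable lborel f"
  shows "integrable lborel (\<lambda>x. \<bar>f (x + t) - f x\<bar>)"
  using integrable_lborel_shift[OF assms, of t] assms by simp

text \<open>By translation invariance the error \<open>f - g\<close> costs the same at
  \<open>x + t\<close> as at \<open>x\<close>, whence the factor 2. The bound is uniform in
  \<open>t\<close>, which is what makes the approximation argument work.\<close>

lemma L1_shift_perturb:
  assumes f: "integrable lborel f" and g: "integrable lborel g"
  shows "L1_shift f t \<le> L1_shift g t + 2 * (\<integral>x. \<bar>f x - g x\<bar> \<partial>lborel)"
proof -
  have d: "integrable lborel (\<lambda>x. \<bar>f x - g x\<bar>)" using f g by simp
  have "L1_shift f t \<le> (\<integral>x. \<bar>g (x + t) - g x\<bar> + (\<bar>f (x + t) - g (x + t)\<bar> + \<bar>f x - g x\<bar>) \<partial>lborel)"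
    unfolding L1_shift_def
    by (rule integral_mono) (use integrable_L1_shift[OF f] integrable_L1_shift[OF g] d integrable_lborel_shift[OF d] in auto)
  also have "\<dots> = L1_shift g t + ((\<integral>x. \<bar>f (x + t) - g (x + t)\<bar> \<partial>lborel) + (\<integral>x. \<bar>f x - g x\<bar> \<partial>lborel))"
    unfolding L1_shift_def
    by (subst Bochner_Integration.integral_add; (subst Bochner_Integration.integral_add)?)
       (use integrable_L1_shift[OF g] d integrable_lborel_shift[OF d] in auto)
  also have "(\<integral>x. \<bar>f (x + t) - g (x + t)\<bar> \<partial>lborel) = (\<integral>x. \<bar>f x - g x\<bar> \<partial>lborel)"
    by (rule integral_lborel_shift)
  finally show ?thesis by simp
qed

lemma L1_shift_approx:
  assumes f: "integrable lborel f"
    and appr: "\<And>e. e > 0 \<Longrightarrow> \<exists>g. integrable lborel g \<and> (\<integral>x. \<bar>f x - g x\<bar> \<partial>lborel) < e \<and> (L1_shift g \<longlongrightarrow> 0) (at 0)"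
  shows "(L1_shift f \<longlongrightarrow> 0) (at 0)"
proof (rule tendstoI)
  fix e :: real assume e: "e > 0"
  \<comment> \<open>The error is counted twice in \<open>L1_shift_perturb\<close>, so
    \<open>e/4\<close> leaves \<open>e/2\<close> for the shift of \<open>g\<close>.\<close>
  obtain g where g: "integrable lborel g" "(\<integral>x. \<bar>f x - g x\<bar> \<partial>lborel) < e/4" "(L1_shift g \<longlongrightarrow> 0) (at 0)"
    using appr[of "e/4"] e by auto
  have "\<forall>\<^sub>F t in at 0. dist (L1_shift g t) 0 < e/2" using g(3) e by (auto dest!: tendstoD[where e="e/2"])
  then show "\<forall>\<^sub>F t in at 0. dist (L1_shift f t) 0 < e"
  proof eventually_elim
    case (elim t)
    then show ?case using L1_shift_perturb[OF f g(1), of t] g(2) L1_shift_nonneg[of f t] by simp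
  qed
qed


text \<open>For indicators the modulus is twice the measure minus twice the autocorrelation, so only
  the latter has to converge. Openness gives pointwise convergence everywhere: a point of
  \<open>U\<close> stays in \<open>U\<close> under small shifts, and outside \<open>U\<close> the
  product is already 0. The boundary of \<open>U\<close> may have positive measure.\<close>

lemma L1_shift_open:
  assumes U: "open U" and fin: "emeasure lborel U < \<infinity>"
  shows "(L1_shift (indicator U) \<longlongrightarrow> 0) (at 0)"
proof -
  have i: "integrable lborel (indicator U :: real \<Rightarrow> real)" using U fin by (simp add: integrable_indicator_iff)
  have [measurable]: "U \<in> sets borel" using U by simp
  have eq: "L1_shift (indicator U) t = 2 * measure lborel U - 2 * (\<integral>x. indicator U (x + t) * indicator U x \<partial>lborel)" for t
  proof -
    have ip: "integrable lborel (\<lambda>x. indicator U (x + t) * indicator U x :: real)"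
      by (rule Bochner_Integration.integrable_bound[OF i]) (auto simp: indicator_def)
    have "L1_shift (indicator U) t = (\<integral>x. indicator U (x + t) + indicator U x - 2 * (indicator U (x + t) * indicator U x) \<partial>lborel)"
      unfolding L1_shift_def by (rule Bochner_Integration.integral_cong) (auto simp: indicator_def)
    also have "\<dots> = (\<integral>x. indicator U (x + t) \<partial>lborel) + (\<integral>x. indicator U x \<partial>lborel) - 2 * (\<integral>x. indicator U (x + t) * indicator U x \<partial>lborel)"
      using i ip integrable_lborel_shift[OF i, of t] by simp
    also have "(\<integral>x. indicator U (x + t) \<partial>lborel) = (\<integral>x. indicator U x \<partial>lborel :: real)"
      by (rule integral_lborel_shift)
    finally show ?thesis by simp
  qed
  have "((\<lambda>t. \<integral>x. indicator U (x + t) * indicator U x \<partial>lborel :: real) \<longlongrightarrow> (\<integral>x. indicator U x \<partial>lborel)) (at 0)"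
    unfolding tendsto_at_iff_sequentially
  proof safe
    fix X :: "nat \<Rightarrow> real" assume X: "X \<longlonglongrightarrow> 0"
    have "(\<lambda>i. \<integral>x. indicator U (x + X i) * indicator U x \<partial>lborel :: real) \<longlonglongrightarrow> (\<integral>x. indicator U x \<partial>lborel)"
    proof (rule integral_dominated_convergence[where w="indicator U"])
      show "AE x in lborel. (\<lambda>i. indicator U (x + X i) * indicator U x :: real) \<longlonglongrightarrow> indicator U x"
      proof (rule AE_I2)
        fix x
        show "(\<lambda>i. indicator U (x + X i) * indicator U x :: real) \<longlonglongrightarrow> indicator U x"
        proof (cases "x \<in> U")
          case True
          have "(\<lambda>i. x + X i) \<longlonglongrightarrow> x" using tendsto_add[OF tendsto_const X, of x] by simp
          then have "\<forall>\<^sub>F i in sequentially. x + X i \<in> U"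
            using topological_tendstoD U True by blast
          then show ?thesis
            by (intro tendsto_eventually) (auto elim!: eventually_mono simp: True)
        qed simp
      qed
    qed (use i in \<open>auto simp: indicator_def\<close>)
    then show "((\<lambda>t. \<integral>x. indicator U (x + t) * indicator U x \<partial>lborel :: real) \<circ> X) \<longlonglongrightarrow> (\<integral>x. indicator U x \<partial>lborel)"
      by (simp add: o_def)
  qed
  from tendsto_diff[OF tendsto_const tendsto_mult[OF tendsto_const this], of "2 * measure lborel U" 2]
  show ?thesis by (simp add: eq[abs_def])
qed

lemma L1_shift_tendsto_0:
  fixes f :: "real \<Rightarrow> real"
  assumes "integrable lborel f"
  shows "(L1_shift f \<longlongrightarrow> 0) (at 0)"
  using assms
proof (induct rule: integrable_induct)
  case (base A c)
  have [measurable]: "A \<in> sets borel" using base by simp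
  have iA: "integrable lborel (indicator A :: real \<Rightarrow> real)" using base by (simp add: integrable_indicator_iff)
  have "(L1_shift (indicator A) \<longlongrightarrow> 0) (at 0)"
  proof (rule L1_shift_approx[OF iA])
    fix e :: real assume e: "e > 0"
    \<comment> \<open>Outer regularity replaces a general measurable set by an open one up to
      \<open>e\<close> in L1; finiteness of the measure of \<open>U\<close> is inherited from
      \<open>A\<close>.\<close>
    obtain U where U: "open U" "A \<subseteq> U" "emeasure lborel (U - A) < ennreal e"
      using outer_regular_lborel[of A e] e base by auto
    have [measurable]: "U \<in> sets borel" using U by simp
    have "emeasure lborel U = emeasure lborel A + emeasure lborel (U - A)"
      using U(2) by (subst plus_emeasure) (auto simp: Un_absorb1)
    also have "\<dots> < \<infinity>" using base(2) U(3) by (simp add: ennreal_add_eq_top less_top[symmetric]) (metis infinity_ennreal_def not_less_iff_gr_or_eq top.not_eq_extremum)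
    finally have finU: "emeasure lborel U < \<infinity>" .
    have "(\<integral>x. \<bar>indicator A x - indicator U x\<bar> \<partial>lborel) = (\<integral>x. indicator (U - A) x \<partial>lborel :: real)"
      by (rule Bochner_Integration.integral_cong) (use U(2) in \<open>auto simp: indicator_def\<close>)
    also have "\<dots> = measure lborel (U - A)" by simp
    also have "\<dots> < e"
    proof -
      have "emeasure lborel (U - A) = ennreal (measure lborel (U - A))"
        using U(3) by (intro emeasure_eq_ennreal_measure) auto
      then show ?thesis using U(3) e by (simp add: ennreal_less_iff)
    qed
    finally show "\<exists>g. integrable lborel g \<and> (\<integral>x. \<bar>indicator A x - g x\<bar> \<partial>lborel) < e \<and> (L1_shift g \<longlongrightarrow> 0) (at 0)"
      using L1_shift_open[OF U(1) finU] finU by (intro exI[of _ "indicator U"]) (simp add: integrable_indicator_iff)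
  qed
  moreover have "L1_shift (\<lambda>x. indicator A x *\<^sub>R c) = (\<lambda>t. L1_shift (indicator A) t * \<bar>c\<bar>)"
    unfolding L1_shift_def by (simp add: left_diff_distrib[symmetric] abs_mult)
  ultimately show ?case by (simp add: tendsto_mult_left_zero)
next
  case (add f g)
  have le: "L1_shift (\<lambda>x. f x + g x) t \<le> L1_shift f t + L1_shift g t" for t
  proof -
    note i = integrable_L1_shift[OF add(1), of t] integrable_L1_shift[OF add(3), of t]
    have "L1_shift (\<lambda>x. f x + g x) t \<le> (\<integral>x. \<bar>f (x + t) - f x\<bar> + \<bar>g (x + t) - g x\<bar> \<partial>lborel)"
      unfolding L1_shift_def
      using integrable_L1_shift[OF Bochner_Integration.integrable_add[OF add(1,3)], of t] i
      by (intro integral_mono) auto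
    also have "\<dots> = L1_shift f t + L1_shift g t"
      unfolding L1_shift_def using i by (rule Bochner_Integration.integral_add)
    finally show ?thesis .
  qed
  show ?case
    by (rule tendsto_sandwich[OF _ _ tendsto_const tendsto_add_zero[OF add(2,4)]])
       (auto simp: L1_shift_nonneg le)
next
  case (lim f s)
  have ms[measurable]: "\<And>i. s i \<in> borel_measurable lborel" "f \<in> borel_measurable lborel" using lim by auto
  show ?case
  proof (rule L1_shift_approx[OF lim(5)])
    fix e :: real assume e: "e > 0"
    \<comment> \<open>The induction rule supplies approximations with
      \<open>\<bar>s i x\<bar> \<le> 2 * \<bar>f x\<bar>\<close>; hence the dominating function
      \<open>3 * \<bar>f x\<bar>\<close>.\<close>
    have "(\<lambda>i. \<integral>x. \<bar>f x - s i x\<bar> \<partial>lborel) \<longlonglongrightarrow> integral\<^sup>L (lborel :: real measure) (\<lambda>_. 0)"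
    proof (rule integral_dominated_convergence[where w="\<lambda>x. 3 * \<bar>f x\<bar>"])
      show "AE x in lborel. (\<lambda>i. \<bar>f x - s i x\<bar>) \<longlonglongrightarrow> 0"
      proof (rule AE_I2)
        fix x
        have "(\<lambda>i. s i x) \<longlonglongrightarrow> f x" using lim(3)[of x] by simp
        from tendsto_rabs[OF tendsto_diff[OF tendsto_const this, of "f x"]]
        show "(\<lambda>i. \<bar>f x - s i x\<bar>) \<longlonglongrightarrow> 0" by simp
      qed
      show "AE x in lborel. norm \<bar>f x - s i x\<bar> \<le> 3 * \<bar>f x\<bar>" for i
      proof (rule AE_I2)
        fix x
        have "\<bar>s i x\<bar> \<le> 2 * \<bar>f x\<bar>" using lim(4)[of x i] by simp
        then show "norm \<bar>f x - s i x\<bar> \<le> 3 * \<bar>f x\<bar>" by simp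
      qed
    qed (use lim(5) in auto)
    then have "\<forall>\<^sub>F i in sequentially. (\<integral>x. \<bar>f x - s i x\<bar> \<partial>lborel) < e"
      using e order_tendstoD(2) by fastforce
    then obtain i where "(\<integral>x. \<bar>f x - s i x\<bar> \<partial>lborel) < e"
      by (meson eventually_happens trivial_limit_sequentially)
    then show "\<exists>g. integrable lborel g \<and> (\<integral>x. \<bar>f x - g x\<bar> \<partial>lborel) < e \<and> (L1_shift g \<longlongrightarrow> 0) (at 0)"
      using lim(1,2) by blast
  qed
qed

text \<open>The signed square \<open>a * \<bar>a\<bar>\<close> sends square integrable functions to
  integrable ones, and this inequality controls L2 differences by L1 differences of the images. L2
  continuity of translations thus follows from the L1 case with no density argument in L2. The
  constant 2 is attained at \<open>b = - a\<close>.\<close>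

lemma diff_squared_le_signed_squares: "(a - b)\<^sup>2 \<le> 2 * \<bar>a * \<bar>a\<bar> - b * \<bar>b\<bar>\<bar>" for a b :: real
proof -
  have *: "(a - b)\<^sup>2 \<le> 2 * (a * \<bar>a\<bar> - b * \<bar>b\<bar>)" if ab: "a \<ge> b" for a b :: real
  proof -
    consider "b \<ge> 0" | "a \<le> 0" | "a \<ge> 0" "b \<le> 0" by linarith
    then show ?thesis
    proof cases
      case 1
      have "0 \<le> (a - b) * (a + 3 * b)" using ab 1 by (intro mult_nonneg_nonneg) auto
      then show ?thesis using 1 ab by (simp add: power2_eq_square algebra_simps)
    next
      case 2
      have "0 \<le> (a - b) * (- 3 * a - b)" using ab 2 by (intro mult_nonneg_nonneg) auto
      then show ?thesis using 2 ab by (simp add: power2_eq_square algebra_simps)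
    next
      case 3
      have "0 \<le> (a + b)\<^sup>2" by simp
      then show ?thesis using 3 by (simp add: power2_eq_square algebra_simps)
    qed
  qed
  show ?thesis
  proof (cases "a \<ge> b")
    case True
    show ?thesis using *[OF True] abs_ge_self[of "a * \<bar>a\<bar> - b * \<bar>b\<bar>"]
      by (meson mult_left_mono order_trans zero_le_numeral)
  next
    case False
    then have "(b - a)\<^sup>2 \<le> 2 * (b * \<bar>b\<bar> - a * \<bar>a\<bar>)" by (intro *) auto
    also have "\<dots> \<le> 2 * \<bar>b * \<bar>b\<bar> - a * \<bar>a\<bar>\<bar>" by (rule mult_left_mono[OF abs_ge_self]) simp
    finally show ?thesis by (simp add: power2_commute abs_minus_commute)
  qed
qed

lemma cmod_Re_Im_square: "(cmod z)\<^sup>2 = (Re z)\<^sup>2 + (Im z)\<^sup>2"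
  by (simp add: cmod_def)

lemma L2_shift_tendsto_0:
  fixes h :: "real \<Rightarrow> complex"
  assumes [measurable]: "h \<in> borel_measurable borel" and h2: "integrable lborel (\<lambda>x. (cmod (h x))\<^sup>2)"
  shows "((\<lambda>t. \<integral>x. (cmod (h (x + t) - h x))\<^sup>2 \<partial>lborel) \<longlongrightarrow> 0) (at 0)"
proof -
  let ?p = "\<lambda>x. Re (h x) * \<bar>Re (h x)\<bar>" and ?q = "\<lambda>x. Im (h x) * \<bar>Im (h x)\<bar>"
  have p: "integrable lborel ?p"
    by (rule Bochner_Integration.integrable_bound[OF h2])
       (auto simp: abs_mult cmod_Re_Im_square simp flip: power2_eq_square)
  have q: "integrable lborel ?q"
    by (rule Bochner_Integration.integrable_bound[OF h2])
       (auto simp: abs_mult cmod_Re_Im_square simp flip: power2_eq_square)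
  have bd: "(cmod (h (x + t) - h x))\<^sup>2 \<le> 2 * \<bar>?p (x + t) - ?p x\<bar> + 2 * \<bar>?q (x + t) - ?q x\<bar>" for x t
    using diff_squared_le_signed_squares[of "Re (h (x + t))" "Re (h x)"]
      diff_squared_le_signed_squares[of "Im (h (x + t))" "Im (h x)"]
    by (simp add: cmod_Re_Im_square)
  have le: "(\<integral>x. (cmod (h (x + t) - h x))\<^sup>2 \<partial>lborel) \<le> 2 * L1_shift ?p t + 2 * L1_shift ?q t" for t
  proof -
    have ii: "integrable lborel (\<lambda>x. 2 * \<bar>?p (x + t) - ?p x\<bar> + 2 * \<bar>?q (x + t) - ?q x\<bar>)"
      using integrable_L1_shift[OF p, of t] integrable_L1_shift[OF q, of t] by simp
    have "(\<integral>x. (cmod (h (x + t) - h x))\<^sup>2 \<partial>lborel) \<le> (\<integral>x. 2 * \<bar>?p (x + t) - ?p x\<bar> + 2 * \<bar>?q (x + t) - ?q x\<bar> \<partial>lborel)"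
      using bd by (intro integral_mono Bochner_Integration.integrable_bound[OF ii] ii) (auto intro!: order_trans[OF _ abs_ge_self])
    also have "\<dots> = 2 * L1_shift ?p t + 2 * L1_shift ?q t"
      unfolding L1_shift_def using integrable_L1_shift[OF p, of t] integrable_L1_shift[OF q, of t] by simp
    finally show ?thesis .
  qed
  have "((\<lambda>t. 2 * L1_shift ?p t + 2 * L1_shift ?q t) \<longlongrightarrow> 0) (at 0)"
    using L1_shift_tendsto_0[OF p] L1_shift_tendsto_0[OF q] by (intro tendsto_add_zero tendsto_mult_right_zero)
  then show ?thesis
    by (rule tendsto_sandwich[where f="\<lambda>_. 0", rotated -1]) (auto simp: le)
qed


section \<open>Plancherel's identity by Gaussian regularisation\<close>

lemma borel_measurable_cnj [measurable]:
  assumes [measurable]: "f \<in> borel_measurable M"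
  shows "(\<lambda>x. cnj (f x)) \<in> borel_measurable M"
  using borel_measurable_continuous_onI[of cnj] continuous_on_cnj[OF continuous_on_id] by measurable

definition FT :: "(real \<Rightarrow> complex) \<Rightarrow> real \<Rightarrow> complex" where
  "FT h \<xi> = (\<integral>x. exp (- (\<i> * of_real (x * \<xi>))) * h x \<partial>lborel)"

lemma borel_measurable_FT [measurable]:
  assumes [measurable]: "h \<in> borel_measurable borel"
  shows "FT h \<in> borel_measurable borel"
  unfolding FT_def by measurable

lemma norm_exp_minus_i [simp]: "cmod (exp (- (\<i> * of_real a))) = 1"
  using norm_exp_i_times[of "- a"] by simp

lemma norm_FT_le:
  assumes "integrable lborel h"
  shows "cmod (FT h \<xi>) \<le> (\<integral>x. cmod (h x) \<partial>lborel)"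
  unfolding FT_def by (rule order_trans[OF integral_norm_bound]) (simp add: norm_mult)

text \<open>Expanding the square of \<open>h (x + s) - h x\<close> expresses the real part of the
  autocorrelation through the L2 modulus of continuity. Its continuity at \<open>s = 0\<close> is
  then exactly \<open>L2_shift_tendsto_0\<close>.\<close>

lemma autocorrelation_eq:
  fixes h :: "real \<Rightarrow> complex"
  assumes [measurable]: "h \<in> borel_measurable borel" and h2: "integrable lborel (\<lambda>x. (cmod (h x))\<^sup>2)"
  shows "integrable lborel (\<lambda>x. h x * cnj (h (x + s)))"
    and "(\<integral>x. norm (h x * cnj (h (x + s))) \<partial>lborel) \<le> (\<integral>x. (cmod (h x))\<^sup>2 \<partial>lborel)"
    and "Re (\<integral>x. h x * cnj (h (x + s)) \<partial>lborel)
      = (\<integral>x. (cmod (h x))\<^sup>2 \<partial>lborel) - (\<integral>x. (cmod (h (x + s) - h x))\<^sup>2 \<partial>lborel) / 2"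
proof -
  have h2s: "integrable lborel (\<lambda>x. (cmod (h (x + s)))\<^sup>2)" using integrable_lborel_shift[OF h2] .
  have sum: "integrable lborel (\<lambda>x. ((cmod (h x))\<^sup>2 + (cmod (h (x + s)))\<^sup>2) / 2)" using h2 h2s by simp
  have bd: "norm (h x * cnj (h (x + s))) \<le> ((cmod (h x))\<^sup>2 + (cmod (h (x + s)))\<^sup>2) / 2" for x
    using sum_squares_bound[of "cmod (h x)" "cmod (h (x + s))"] by (simp add: norm_mult)
  show i: "integrable lborel (\<lambda>x. h x * cnj (h (x + s)))"
    by (rule Bochner_Integration.integrable_bound[OF sum]) (use bd in \<open>auto intro!: AE_I2 simp del: norm_mult\<close>)
  have "(\<integral>x. norm (h x * cnj (h (x + s))) \<partial>lborel) \<le> (\<integral>x. ((cmod (h x))\<^sup>2 + (cmod (h (x + s)))\<^sup>2) / 2 \<partial>lborel)"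
    using integrable_norm[OF i] sum bd by (intro integral_mono) auto
  also have "\<dots> = (\<integral>x. (cmod (h x))\<^sup>2 \<partial>lborel)"
    using h2 h2s integral_lborel_shift[of "\<lambda>x. (cmod (h x))\<^sup>2" s] by simp
  finally show "(\<integral>x. norm (h x * cnj (h (x + s))) \<partial>lborel) \<le> (\<integral>x. (cmod (h x))\<^sup>2 \<partial>lborel)" .
  have ir: "integrable lborel (\<lambda>x. Re (h x * cnj (h (x + s))))" using i by (rule integrable_Re)
  have "(\<integral>x. (cmod (h (x + s) - h x))\<^sup>2 \<partial>lborel)
     = (\<integral>x. (cmod (h x))\<^sup>2 + (cmod (h (x + s)))\<^sup>2 - 2 * Re (h x * cnj (h (x + s))) \<partial>lborel)"
    unfolding cmod_Re_Im_square
    by (rule Bochner_Integration.integral_cong) (auto simp: power2_eq_square algebra_simps)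
  also have "\<dots> = 2 * (\<integral>x. (cmod (h x))\<^sup>2 \<partial>lborel) - 2 * (\<integral>x. Re (h x * cnj (h (x + s))) \<partial>lborel)"
    using h2 h2s ir integral_lborel_shift[of "\<lambda>x. (cmod (h x))\<^sup>2" s]
    by (simp del: complex_mod_mult_cnj complex_cnj_mult complex_mult_cnj times_complex.simps)
  also have "(\<integral>x. Re (h x * cnj (h (x + s))) \<partial>lborel) = Re (\<integral>x. h x * cnj (h (x + s)) \<partial>lborel)"
    using i by (rule integral_Re)
  finally show "Re (\<integral>x. h x * cnj (h (x + s)) \<partial>lborel)
      = (\<integral>x. (cmod (h x))\<^sup>2 \<partial>lborel) - (\<integral>x. (cmod (h (x + s) - h x))\<^sup>2 \<partial>lborel) / 2"
    by linarith
qed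

lemma integrable_std_normal_density: "integrable lborel std_normal_density"
  using prob_space_normal_density[of 1 0] by (auto intro!: integrable_normal_density)

lemma integral_std_normal_density: "(\<integral>x. std_normal_density x \<partial>lborel) = 1"
  by (rule integral_normal_density) simp

text \<open>After the substitution \<open>t = \<epsilon> * \<xi>\<close> this is the characteristic
  function of the standard normal law. The right side is \<open>2 * pi\<close> times an approximate
  identity of width \<open>\<epsilon>\<close>.\<close>

lemma FT_gaussian:
  assumes e: "\<epsilon> > 0"
  shows "(\<integral>\<xi>. exp (- (\<i> * of_real (u * \<xi>))) * of_real (exp (- (\<epsilon> * \<xi>)\<^sup>2 / 2)) \<partial>lborel)
    = of_real (2 * pi / \<epsilon> * std_normal_density (u / \<epsilon>))"
proof -
  have "(\<integral>\<xi>. exp (- (\<i> * of_real (u * \<xi>))) * of_real (exp (- (\<epsilon> * \<xi>)\<^sup>2 / 2)) \<partial>lborel)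
     = \<bar>1/\<epsilon>\<bar> *\<^sub>R (\<integral>t. exp (- (\<i> * of_real (u * (0 + 1/\<epsilon> * t)))) * of_real (exp (- (\<epsilon> * (0 + 1/\<epsilon> * t))\<^sup>2 / 2)) \<partial>lborel)"
    using e by (intro lborel_integral_real_affine) simp
  also have "(\<integral>t. exp (- (\<i> * of_real (u * (0 + 1/\<epsilon> * t)))) * of_real (exp (- (\<epsilon> * (0 + 1/\<epsilon> * t))\<^sup>2 / 2)) \<partial>lborel)
     = (\<integral>t. of_real (sqrt (2 * pi)) * (std_normal_density t *\<^sub>R iexp (- u / \<epsilon> * t)) \<partial>lborel)"
    using e by (intro Bochner_Integration.integral_cong) (auto simp: normal_density_def scaleR_conv_of_real)
  also have "\<dots> = of_real (sqrt (2 * pi)) * char std_normal_distribution (- u / \<epsilon>)"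
    unfolding char_def integral_mult_right_zero by (subst integral_density) auto
  also have "\<dots> = of_real (sqrt (2 * pi)) * exp (- (u/\<epsilon>)\<^sup>2 / 2)"
    by (simp add: char_std_normal_distribution)
  also have "\<bar>1/\<epsilon>\<bar> *\<^sub>R \<dots> = of_real (2 * pi / \<epsilon> * std_normal_density (u / \<epsilon>))"
  proof -
    \<comment> \<open>This moves \<open>sqrt (2 * pi)\<close> into the denominator, where it is the
      normalisation of the normal density.\<close>
    have "sqrt (2 * pi) = 2 * pi / sqrt (2 * pi)" by (simp add: real_div_sqrt)
    then show ?thesis
      using e unfolding normal_density_def scaleR_conv_of_real of_real_mult[symmetric] of_real_eq_iff
      by (simp add: field_simps)
  qed
  finally show ?thesis .
qed

text \<open>The Gaussian factor makes all iterated integrals absolutely convergent. Integrating out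
  \<open>\<xi>\<close> first leaves the autocorrelation of \<open>h\<close> averaged over shifts of
  size about \<open>\<epsilon>\<close>, a quantity whose limit as \<open>\<epsilon>\<close> tends to
  0 is visible.\<close>

lemma gaussian_regularised_energy:
  fixes h :: "real \<Rightarrow> complex"
  assumes [measurable]: "h \<in> borel_measurable borel" and h1: "integrable lborel h"
    and h2: "integrable lborel (\<lambda>x. (cmod (h x))\<^sup>2)" and e: "\<epsilon> > 0"
  shows "integrable lborel (\<lambda>\<xi>. (cmod (FT h \<xi>))\<^sup>2 * exp (- (\<epsilon> * \<xi>)\<^sup>2 / 2))"
    and "(\<integral>\<xi>. (cmod (FT h \<xi>))\<^sup>2 * exp (- (\<epsilon> * \<xi>)\<^sup>2 / 2) \<partial>lborel)
      = 2 * pi * (\<integral>t. std_normal_density t * Re (\<integral>x. h x * cnj (h (x + \<epsilon> * t)) \<partial>lborel) \<partial>lborel)"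
proof -
  let ?g = "\<lambda>\<xi>::real. exp (- (\<epsilon> * \<xi>)\<^sup>2 / 2)"
  define G where "G u = complex_of_real (2 * pi / \<epsilon> * std_normal_density (u / \<epsilon>))" for u
  define B where "B = (\<integral>x. cmod (h x) \<partial>lborel)"
  have B: "cmod (FT h \<xi>) \<le> B" for \<xi> unfolding B_def by (rule norm_FT_le[OF h1])
  have B0: "B \<ge> 0" unfolding B_def by simp
  have "integrable lborel (\<lambda>t. sqrt (2 * pi) * std_normal_density (0 + \<epsilon> * t))"
    using e by (intro integrable_mult_right lborel_integrable_real_affine integrable_std_normal_density) auto
  then have g: "integrable lborel ?g" by (simp add: normal_density_def)
  show int: "integrable lborel (\<lambda>\<xi>. (cmod (FT h \<xi>))\<^sup>2 * ?g \<xi>)"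
  proof (rule Bochner_Integration.integrable_bound[of _ "\<lambda>\<xi>. B\<^sup>2 * ?g \<xi>"])
    show "AE \<xi> in lborel. norm ((cmod (FT h \<xi>))\<^sup>2 * ?g \<xi>) \<le> norm (B\<^sup>2 * ?g \<xi>)"
      using B by (auto simp: abs_mult intro!: AE_I2 mult_right_mono power_mono)
  qed (use g in auto)
  have gF: "integrable lborel (\<lambda>\<xi>. of_real (?g \<xi>) * cnj (FT h \<xi>))"
    by (rule Bochner_Integration.integrable_bound[of _ "\<lambda>\<xi>. B * ?g \<xi>"])
       (use g B B0 in \<open>auto simp: norm_mult abs_mult mult.commute[of B] intro!: AE_I2 mult_left_mono\<close>)
  \<comment> \<open>One of the two factors of the squared modulus is expanded as an integral over
    \<open>x\<close>; the conjugate factor, damped by the Gaussian, is the integrable partner in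
    Fubini.\<close>
  have "of_real (\<integral>\<xi>. (cmod (FT h \<xi>))\<^sup>2 * ?g \<xi> \<partial>lborel)
      = (\<integral>\<xi>. (of_real (?g \<xi>) * cnj (FT h \<xi>)) * (\<integral>x. exp (- (\<i> * of_real (x * \<xi>))) * h x \<partial>lborel) \<partial>lborel)"
    unfolding integral_complex_of_real[symmetric]
    unfolding FT_def[symmetric] by (simp only: of_real_mult complex_norm_square mult_ac)
  also have "\<dots> = (\<integral>x. h x * (\<integral>\<xi>. exp (- (\<i> * of_real (x * \<xi>))) * (of_real (?g \<xi>) * cnj (FT h \<xi>)) \<partial>lborel) \<partial>lborel)"
    by (rule Fubini_bounded_kernel[where B=1])
       (use gF h1 in \<open>auto intro!: lborel.sigma_finite_measure_axioms\<close>)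
  also have "\<dots> = (\<integral>x. h x * (\<integral>t. of_real (2 * pi * std_normal_density t) * cnj (h (x + \<epsilon> * t)) \<partial>lborel) \<partial>lborel)"
  proof (rule Bochner_Integration.integral_cong[OF refl])
    fix x
    have cF: "cnj (FT h \<xi>) = (\<integral>y. exp (\<i> * of_real (y * \<xi>)) * cnj (h y) \<partial>lborel)" for \<xi>
    proof -
      have "cnj (FT h \<xi>) = (\<integral>x. cnj (exp (- (\<i> * of_real (x * \<xi>))) * h x) \<partial>lborel)"
        unfolding FT_def by (rule Bochner_Integration.integral_cnj[symmetric])
      also have "\<dots> = (\<integral>y. exp (\<i> * of_real (y * \<xi>)) * cnj (h y) \<partial>lborel)"
        by (rule Bochner_Integration.integral_cong[OF refl]) (simp add: exp_cnj)
      finally show ?thesis .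
    qed
    have "(\<integral>\<xi>. exp (- (\<i> * of_real (x * \<xi>))) * (of_real (?g \<xi>) * cnj (FT h \<xi>)) \<partial>lborel)
        = (\<integral>\<xi>. of_real (?g \<xi>) * (\<integral>y. exp (- (\<i> * of_real ((x - y) * \<xi>))) * cnj (h y) \<partial>lborel) \<partial>lborel)"
    proof (rule Bochner_Integration.integral_cong[OF refl])
      fix \<xi>
      have "(\<integral>y. exp (- (\<i> * of_real ((x - y) * \<xi>))) * cnj (h y) \<partial>lborel)
         = (\<integral>y. exp (- (\<i> * of_real (x * \<xi>))) * (exp (\<i> * of_real (y * \<xi>)) * cnj (h y)) \<partial>lborel)"
      proof (rule Bochner_Integration.integral_cong[OF refl])
        fix y
        have "exp (- (\<i> * of_real ((x - y) * \<xi>))) = exp (- (\<i> * of_real (x * \<xi>))) * exp (\<i> * of_real (y * \<xi>))"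
          by (simp add: exp_add[symmetric] algebra_simps)
        then show "exp (- (\<i> * of_real ((x - y) * \<xi>))) * cnj (h y)
          = exp (- (\<i> * of_real (x * \<xi>))) * (exp (\<i> * of_real (y * \<xi>)) * cnj (h y))"
          by (simp only: mult.assoc)
      qed
      then show "exp (- (\<i> * of_real (x * \<xi>))) * (of_real (?g \<xi>) * cnj (FT h \<xi>))
        = of_real (?g \<xi>) * (\<integral>y. exp (- (\<i> * of_real ((x - y) * \<xi>))) * cnj (h y) \<partial>lborel)"
        by (simp add: cF)
    qed
    also have "\<dots> = (\<integral>y. cnj (h y) * (\<integral>\<xi>. exp (- (\<i> * of_real ((x - y) * \<xi>))) * of_real (?g \<xi>) \<partial>lborel) \<partial>lborel)"
      by (rule Fubini_bounded_kernel[where B=1])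
         (use g h1 in \<open>auto intro!: lborel.sigma_finite_measure_axioms\<close>)
    also have "\<dots> = (\<integral>y. cnj (h y) * G (x - y) \<partial>lborel)"
      by (simp only: FT_gaussian[OF e] G_def)
    \<comment> \<open>Substitution \<open>y = x + \<epsilon> * t\<close>: the Jacobian cancels the
      \<open>1 / \<epsilon>\<close> in \<open>G\<close>, and evenness of the density absorbs the
      sign of the argument.\<close>
    also have "\<dots> = \<bar>\<epsilon>\<bar> *\<^sub>R (\<integral>t. cnj (h (x + \<epsilon> * t)) * G (x - (x + \<epsilon> * t)) \<partial>lborel)"
      using e by (intro lborel_integral_real_affine) simp
    also have "\<dots> = (\<integral>t. of_real (2 * pi * std_normal_density t) * cnj (h (x + \<epsilon> * t)) \<partial>lborel)"
      unfolding integral_scaleR_right[symmetric]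
      by (rule Bochner_Integration.integral_cong) (use e in \<open>auto simp: G_def scaleR_conv_of_real normal_density_def\<close>)
    finally show "h x * (\<integral>\<xi>. exp (- (\<i> * of_real (x * \<xi>))) * (of_real (?g \<xi>) * cnj (FT h \<xi>)) \<partial>lborel)
      = h x * (\<integral>t. of_real (2 * pi * std_normal_density t) * cnj (h (x + \<epsilon> * t)) \<partial>lborel)" by simp
  qed
  also have "\<dots> = (\<integral>x. (\<integral>t. of_real (2 * pi * std_normal_density t) * (h x * cnj (h (x + \<epsilon> * t))) \<partial>lborel) \<partial>lborel)"
    by (subst integral_mult_right_zero[symmetric]) (simp add: mult_ac)
  \<comment> \<open>The last exchange is dominated by the density times the energy of
    \<open>h\<close>, since every autocorrelation is bounded in absolute integral by that
    energy.\<close>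
  also have "\<dots> = (\<integral>t. (\<integral>x. of_real (2 * pi * std_normal_density t) * (h x * cnj (h (x + \<epsilon> * t))) \<partial>lborel) \<partial>lborel)"
  proof (rule lborel_pair.Fubini_integral)
    show "integrable (lborel \<Otimes>\<^sub>M lborel) (\<lambda>(t, x). of_real (2 * pi * std_normal_density t) * (h x * cnj (h (x + \<epsilon> * t))))"
    proof (rule lborel_pair.Fubini_integrable)
      let ?N = "\<integral>x. (cmod (h x))\<^sup>2 \<partial>lborel"
      show "integrable lborel (\<lambda>t. \<integral>x. norm (case (t, x) of (t, x) \<Rightarrow> of_real (2 * pi * std_normal_density t) * (h x * cnj (h (x + \<epsilon> * t)))) \<partial>lborel)"
      proof (rule Bochner_Integration.integrable_bound[of _ "\<lambda>t. 2 * pi * std_normal_density t * ?N"])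
        show "AE t in lborel. norm (\<integral>x. norm (case (t, x) of (t, x) \<Rightarrow> of_real (2 * pi * std_normal_density t) * (h x * cnj (h (x + \<epsilon> * t)))) \<partial>lborel)
          \<le> norm (2 * pi * std_normal_density t * ?N)"
        proof (rule AE_I2)
          fix t
          have "norm (\<integral>x. norm (case (t, x) of (t, x) \<Rightarrow> of_real (2 * pi * std_normal_density t) * (h x * cnj (h (x + \<epsilon> * t)))) \<partial>lborel)
            = 2 * pi * std_normal_density t * (\<integral>x. norm (h x * cnj (h (x + \<epsilon> * t))) \<partial>lborel)"
            by (simp add: norm_mult abs_mult)
          also have "\<dots> \<le> 2 * pi * std_normal_density t * ?N"
            by (intro mult_left_mono autocorrelation_eq(2) h2) auto
          finally show "norm (\<integral>x. norm (case (t, x) of (t, x) \<Rightarrow> of_real (2 * pi * std_normal_density t) * (h x * cnj (h (x + \<epsilon> * t)))) \<partial>lborel)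
          \<le> norm (2 * pi * std_normal_density t * ?N)" by simp
        qed
      qed (use integrable_std_normal_density in auto)
      show "AE t in lborel. integrable lborel (\<lambda>x. case (t, x) of (t, x) \<Rightarrow> of_real (2 * pi * std_normal_density t) * (h x * cnj (h (x + \<epsilon> * t))))"
        by (rule AE_I2) (use autocorrelation_eq(1)[OF _ h2] in simp)
    qed measurable
  qed
  also have "\<dots> = (\<integral>t. of_real (2 * pi * std_normal_density t) * (\<integral>x. h x * cnj (h (x + \<epsilon> * t)) \<partial>lborel) \<partial>lborel)"
    by simp
  finally have eq: "of_real (\<integral>\<xi>. (cmod (FT h \<xi>))\<^sup>2 * ?g \<xi> \<partial>lborel)
     = (\<integral>t. of_real (2 * pi * std_normal_density t) * (\<integral>x. h x * cnj (h (x + \<epsilon> * t)) \<partial>lborel) \<partial>lborel)" .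
  have "integrable lborel (\<lambda>t. of_real (2 * pi * std_normal_density t) * (\<integral>x. h x * cnj (h (x + \<epsilon> * t)) \<partial>lborel))"
  proof (rule Bochner_Integration.integrable_bound[of _ "\<lambda>t. 2 * pi * std_normal_density t * (\<integral>x. (cmod (h x))\<^sup>2 \<partial>lborel)"])
    show "AE t in lborel. norm (of_real (2 * pi * std_normal_density t) * (\<integral>x. h x * cnj (h (x + \<epsilon> * t)) \<partial>lborel))
      \<le> norm (2 * pi * std_normal_density t * (\<integral>x. (cmod (h x))\<^sup>2 \<partial>lborel))"
      by (auto simp: norm_mult abs_mult intro!: AE_I2 mult_left_mono order_trans[OF integral_norm_bound] autocorrelation_eq(2)[OF _ h2, unfolded norm_mult complex_mod_cnj])
  qed (use integrable_std_normal_density in auto)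
  from integral_Re[OF this] eq
  have "(\<integral>\<xi>. (cmod (FT h \<xi>))\<^sup>2 * ?g \<xi> \<partial>lborel)
     = (\<integral>t. Re (of_real (2 * pi * std_normal_density t) * (\<integral>x. h x * cnj (h (x + \<epsilon> * t)) \<partial>lborel)) \<partial>lborel)"
    by (metis Re_complex_of_real)
  also have "\<dots> = (\<integral>t. 2 * pi * (std_normal_density t * Re (\<integral>x. h x * cnj (h (x + \<epsilon> * t)) \<partial>lborel)) \<partial>lborel)"
    by (rule Bochner_Integration.integral_cong) auto
  finally show "(\<integral>\<xi>. (cmod (FT h \<xi>))\<^sup>2 * ?g \<xi> \<partial>lborel)
      = 2 * pi * (\<integral>t. std_normal_density t * Re (\<integral>x. h x * cnj (h (x + \<epsilon> * t)) \<partial>lborel) \<partial>lborel)"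
    by simp
qed

text \<open>Along \<open>\<epsilon> = 1 / (n + 1)\<close> the Gaussian weights increase to 1, so
  monotone convergence on the frequency side yields integrability together with the value; on the
  other side the averaged autocorrelations converge by domination to the energy of
  \<open>h\<close>.\<close>

theorem Plancherel_L1_L2:
  fixes h :: "real \<Rightarrow> complex"
  assumes h1: "integrable lborel h" and h2: "integrable lborel (\<lambda>x. (cmod (h x))\<^sup>2)"
  shows "integrable lborel (\<lambda>\<xi>. (cmod (FT h \<xi>))\<^sup>2)"
    and "(\<integral>\<xi>. (cmod (FT h \<xi>))\<^sup>2 \<partial>lborel) = 2 * pi * (\<integral>x. (cmod (h x))\<^sup>2 \<partial>lborel)"
proof -
  have [measurable]: "h \<in> borel_measurable borel" using h1 by auto
  let ?N = "\<integral>x. (cmod (h x))\<^sup>2 \<partial>lborel"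
  define e where "e n = inverse (real (Suc n))" for n
  have e: "e n > 0" "e (Suc n) \<le> e n" for n by (auto simp: e_def)
  have e0: "e \<longlonglongrightarrow> 0" unfolding e_def by (rule LIMSEQ_inverse_real_of_nat)
  have dec: "decseq e" using e(2) by (rule decseq_SucI)
  note R = gaussian_regularised_energy[OF _ h1 h2 e(1)]
  define A where "A s = Re (\<integral>x. h x * cnj (h (x + s)) \<partial>lborel)" for s
  have [measurable]: "A \<in> borel_measurable borel" unfolding A_def by measurable
  have A_bd: "\<bar>A s\<bar> \<le> ?N" for s
    unfolding A_def
    by (intro order_trans[OF abs_Re_le_cmod] order_trans[OF integral_norm_bound] autocorrelation_eq(2) h2) simp
  have A0: "A 0 = ?N" unfolding A_def using autocorrelation_eq(3)[OF _ h2, of 0] by simp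
  have "(A \<longlongrightarrow> ?N - 0 / 2) (at 0)"
    unfolding A_def autocorrelation_eq(3)[OF \<open>h \<in> borel_measurable borel\<close> h2]
    by (intro tendsto_intros L2_shift_tendsto_0 h2) auto
  then have contA: "isCont A 0" by (simp add: isCont_def A0)
  have "(\<lambda>n. \<integral>t. std_normal_density t * A (e n * t) \<partial>lborel) \<longlonglongrightarrow> (\<integral>t. std_normal_density t * ?N \<partial>lborel)"
  proof (rule integral_dominated_convergence[where w="\<lambda>t. std_normal_density t * ?N"])
    show "AE t in lborel. (\<lambda>n. std_normal_density t * A (e n * t)) \<longlonglongrightarrow> std_normal_density t * ?N"
    proof (rule AE_I2)
      fix t
      have "(\<lambda>n. A (e n * t)) \<longlonglongrightarrow> A 0"
        by (rule isCont_tendsto_compose[OF contA]) (use tendsto_mult[OF e0 tendsto_const, of t] in simp)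
      then show "(\<lambda>n. std_normal_density t * A (e n * t)) \<longlonglongrightarrow> std_normal_density t * ?N"
        unfolding A0 by (intro tendsto_intros)
    qed
    show "AE t in lborel. norm (std_normal_density t * A (e n * t)) \<le> std_normal_density t * ?N" for n
      using A_bd by (auto simp: abs_mult intro!: AE_I2 mult_left_mono)
  qed (use integrable_std_normal_density in auto)
  then have lim: "(\<lambda>n. \<integral>\<xi>. (cmod (FT h \<xi>))\<^sup>2 * exp (- (e n * \<xi>)\<^sup>2 / 2) \<partial>lborel) \<longlonglongrightarrow> 2 * pi * ?N"
    unfolding R(2)[OF \<open>h \<in> borel_measurable borel\<close>] A_def[symmetric]
    by (intro tendsto_intros) (simp add: integral_std_normal_density)
  have "has_bochner_integral lborel (\<lambda>\<xi>. (cmod (FT h \<xi>))\<^sup>2) (2 * pi * ?N)"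
  proof (rule has_bochner_integral_monotone_convergence[OF _ _ _ lim])
    show "AE \<xi> in lborel. mono (\<lambda>n. (cmod (FT h \<xi>))\<^sup>2 * exp (- (e n * \<xi>)\<^sup>2 / 2))"
    proof (rule AE_I2)
      fix \<xi>
      have "(e n * \<xi>)\<^sup>2 \<le> (e m * \<xi>)\<^sup>2" if "m \<le> n" for m n
        using decseqD[OF dec that] e(1)[of n] by (auto simp: power_mult_distrib intro!: mult_right_mono power_mono)
      then show "mono (\<lambda>n. (cmod (FT h \<xi>))\<^sup>2 * exp (- (e n * \<xi>)\<^sup>2 / 2))"
        by (intro monoI mult_left_mono) auto
    qed
    show "AE \<xi> in lborel. (\<lambda>n. (cmod (FT h \<xi>))\<^sup>2 * exp (- (e n * \<xi>)\<^sup>2 / 2)) \<longlonglongrightarrow> (cmod (FT h \<xi>))\<^sup>2"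
    proof (rule AE_I2)
      fix \<xi>
      have "(\<lambda>n. (cmod (FT h \<xi>))\<^sup>2 * exp (- (e n * \<xi>)\<^sup>2 / 2)) \<longlonglongrightarrow> (cmod (FT h \<xi>))\<^sup>2 * exp (- (0 * \<xi>)\<^sup>2 / 2)"
        by (intro tendsto_intros e0) auto
      then show "(\<lambda>n. (cmod (FT h \<xi>))\<^sup>2 * exp (- (e n * \<xi>)\<^sup>2 / 2)) \<longlonglongrightarrow> (cmod (FT h \<xi>))\<^sup>2" by simp
    qed
  qed (use R(1) in auto)
  then show "integrable lborel (\<lambda>\<xi>. (cmod (FT h \<xi>))\<^sup>2)"
    "(\<integral>\<xi>. (cmod (FT h \<xi>))\<^sup>2 \<partial>lborel) = 2 * pi * ?N"
    by (auto simp: has_bochner_integral_iff)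
qed

section \<open>The Fourier transform in the mean\<close>

lemma L2_line_iff: "f \<in> L2_line \<longleftrightarrow> f \<in> borel_measurable borel \<and> integrable lborel (\<lambda>x. (cmod (f x))\<^sup>2)"
  by (simp add: L2w_def set_borel_measurable_def set_integrable_def)

definition cutoff :: "real \<Rightarrow> (real \<Rightarrow> complex) \<Rightarrow> real \<Rightarrow> complex" where
  "cutoff R f x = indicator {-R..R} x *\<^sub>R f x"

lemma borel_measurable_cutoff [measurable]: "f \<in> borel_measurable borel \<Longrightarrow> cutoff R f \<in> borel_measurable borel"
  unfolding cutoff_def by measurable

lemma set_integral_eq_FT_cutoff:
  "(LINT x:{-R..R}|lborel. exp (- (\<i> * of_real (x * \<xi>))) * f x) = FT (cutoff R f) \<xi>"
  unfolding FT_def cutoff_def set_lebesgue_integral_def by simp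

lemma cutoff_integrable:
  assumes "f \<in> L2_line"
  shows "integrable lborel (cutoff R f)" and "integrable lborel (\<lambda>x. (cmod (cutoff R f x))\<^sup>2)" 
proof -
  have [measurable]: "f \<in> borel_measurable borel" and f2: "integrable lborel (\<lambda>x. (cmod (f x))\<^sup>2)"
    using assms by (auto simp: L2_line_iff)
  \<comment> \<open>On the bounded interval square integrability gives integrability through this
    elementary bound.\<close>
  have bd: "cmod z \<le> 1 + (cmod z)\<^sup>2" for z
    using sum_squares_bound[of 1 "cmod z"] norm_ge_zero[of z] unfolding power2_eq_square by linarith
  have i: "integrable lborel (\<lambda>x. indicator {-R..R} x + (cmod (f x))\<^sup>2)"
    using f2 by (auto intro!: Bochner_Integration.integrable_add simp: emeasure_lborel_Icc_eq)
  show "integrable lborel (cutoff R f)"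
    by (rule Bochner_Integration.integrable_bound[OF i])
       (use bd in \<open>auto simp: cutoff_def indicator_def intro!: AE_I2\<close>)
  show "integrable lborel (\<lambda>x. (cmod (cutoff R f x))\<^sup>2)"
    by (rule Bochner_Integration.integrable_bound[OF f2]) (auto simp: cutoff_def indicator_def)
qed

lemma FT_diff:
  assumes "integrable lborel h" "integrable lborel k"
  shows "FT (\<lambda>x. h x - k x) \<xi> = FT h \<xi> - FT k \<xi>"
proof -
  have "integrable lborel (\<lambda>x. exp (- (\<i> * of_real (x * \<xi>))) * g x)" if "integrable lborel g" for g :: "real \<Rightarrow> complex"
    by (rule Bochner_Integration.integrable_bound[OF that]) (use that in \<open>auto simp: norm_mult\<close>)
  from Bochner_Integration.integral_diff[OF this this, OF assms]
  show ?thesis by (simp add: FT_def right_diff_distrib)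
qed

lemma power2_norm_diff_le: "(norm (a - b :: 'a::real_normed_vector))\<^sup>2 \<le> 2 * (norm (a - c))\<^sup>2 + 2 * (norm (c - b))\<^sup>2"
proof -
  have "norm (a - b) \<le> norm (a - c) + norm (c - b)" by (metis diff_add_cancel add_diff_eq norm_triangle_ineq)
  then have "(norm (a - b))\<^sup>2 \<le> (norm (a - c) + norm (c - b))\<^sup>2" by (intro power_mono) auto
  also have "\<dots> \<le> 2 * (norm (a - c))\<^sup>2 + 2 * (norm (c - b))\<^sup>2"
    using sum_squares_bound[of "norm (a - c)" "norm (c - b)"] by (simp add: power2_sum)
  finally show ?thesis .
qed

lemma nn_integral_norm_diff_le:
  fixes a b c :: "real \<Rightarrow> complex"
  assumes [measurable]: "a \<in> borel_measurable borel" "b \<in> borel_measurable borel" "c \<in> borel_measurable borel"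
  shows "(\<integral>\<^sup>+x. ennreal ((cmod (a x - b x))\<^sup>2) \<partial>lborel)
    \<le> 2 * (\<integral>\<^sup>+x. ennreal ((cmod (a x - c x))\<^sup>2) \<partial>lborel) + 2 * (\<integral>\<^sup>+x. ennreal ((cmod (c x - b x))\<^sup>2) \<partial>lborel)"
proof -
  have "(\<integral>\<^sup>+x. ennreal ((cmod (a x - b x))\<^sup>2) \<partial>lborel)
    \<le> (\<integral>\<^sup>+x. 2 * ennreal ((cmod (a x - c x))\<^sup>2) + 2 * ennreal ((cmod (c x - b x))\<^sup>2) \<partial>lborel)"
  proof (rule nn_integral_mono)
    fix x
    have "ennreal ((cmod (a x - b x))\<^sup>2) \<le> ennreal (2 * (cmod (a x - c x))\<^sup>2 + 2 * (cmod (c x - b x))\<^sup>2)"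
      by (intro ennreal_leI power2_norm_diff_le)
    also have "\<dots> = 2 * ennreal ((cmod (a x - c x))\<^sup>2) + 2 * ennreal ((cmod (c x - b x))\<^sup>2)"
      by (simp add: ennreal_plus ennreal_mult)
    finally show "ennreal ((cmod (a x - b x))\<^sup>2) \<le> 2 * ennreal ((cmod (a x - c x))\<^sup>2) + 2 * ennreal ((cmod (c x - b x))\<^sup>2)" .
  qed
  also have "\<dots> = 2 * (\<integral>\<^sup>+x. ennreal ((cmod (a x - c x))\<^sup>2) \<partial>lborel) + 2 * (\<integral>\<^sup>+x. ennreal ((cmod (c x - b x))\<^sup>2) \<partial>lborel)"
    by (subst nn_integral_add) (auto simp: nn_integral_cmult)
  finally show ?thesis .
qed

text \<open>Stated for nonnegative integrals, in the form in which the errors occur in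
  \<open>is_L2_fourier\<close>, so that estimates can be chained without integrability side
  conditions.\<close>

lemma Plancherel_nn_diff:
  assumes "integrable lborel h" "integrable lborel k"
    and "integrable lborel (\<lambda>x. (cmod (h x))\<^sup>2)" "integrable lborel (\<lambda>x. (cmod (k x))\<^sup>2)"
  shows "(\<integral>\<^sup>+\<xi>. ennreal ((cmod (FT h \<xi> - FT k \<xi>))\<^sup>2) \<partial>lborel) = ennreal (2 * pi) * (\<integral>\<^sup>+x. ennreal ((cmod (h x - k x))\<^sup>2) \<partial>lborel)"
proof -
  have [measurable]: "h \<in> borel_measurable borel" "k \<in> borel_measurable borel" using assms by auto
  have d1: "integrable lborel (\<lambda>x. h x - k x)" using assms by simp
  have "integrable lborel (\<lambda>x. 2 * (cmod (h x))\<^sup>2 + 2 * (cmod (k x))\<^sup>2)" using assms by simp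
  then have d2: "integrable lborel (\<lambda>x. (cmod (h x - k x))\<^sup>2)"
    by (rule Bochner_Integration.integrable_bound) (use power2_norm_diff_le[of _ _ 0] in \<open>auto intro!: AE_I2\<close>)
  show ?thesis
    unfolding FT_diff[OF assms(1,2), symmetric]
    using Plancherel_L1_L2[OF d1 d2] d2
    by (simp add: nn_integral_eq_integral ennreal_mult)
qed

text \<open>The energy outside \<open>[-R, R]\<close>. Up to the factor \<open>2 * pi\<close> it
  bounds the truncation error of the transform, and for inverse transforms it equals that
  error.\<close>

definition tail_energy :: "(real \<Rightarrow> complex) \<Rightarrow> real \<Rightarrow> ennreal" where
  "tail_energy f R = (\<integral>\<^sup>+x. ennreal ((cmod (f x - cutoff R f x))\<^sup>2) \<partial>lborel)"

lemma tail_energy_tendsto: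
  assumes "f \<in> L2_line"
  shows "(tail_energy f \<longlongrightarrow> 0) at_top"
proof -
  have [measurable]: "f \<in> borel_measurable borel" and f2: "integrable lborel (\<lambda>x. (cmod (f x))\<^sup>2)"
    using assms by (auto simp: L2_line_iff)
  have i: "integrable lborel (\<lambda>x. (cmod (f x - cutoff R f x))\<^sup>2)" for R
    by (rule Bochner_Integration.integrable_bound[OF f2]) (auto simp: cutoff_def indicator_def)
  have "((\<lambda>R. \<integral>x. (cmod (f x - cutoff R f x))\<^sup>2 \<partial>lborel) \<longlongrightarrow> integral\<^sup>L (lborel :: real measure) (\<lambda>_. 0)) at_top"
  proof (rule integral_dominated_convergence_at_top[where w="\<lambda>x. (cmod (f x))\<^sup>2"])
    show "\<forall>\<^sub>F R in at_top. AE x in lborel. norm ((cmod (f x - cutoff R f x))\<^sup>2) \<le> (cmod (f x))\<^sup>2"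
      by (rule always_eventually) (auto simp: cutoff_def indicator_def)
    show "AE x in lborel. ((\<lambda>R. (cmod (f x - cutoff R f x))\<^sup>2) \<longlongrightarrow> 0) at_top"
    proof (rule AE_I2)
      fix x
      have "\<forall>\<^sub>F R in at_top. (cmod (f x - cutoff R f x))\<^sup>2 = 0"
        using eventually_ge_at_top[of "\<bar>x\<bar>"] by eventually_elim (auto simp: cutoff_def indicator_def)
      then show "((\<lambda>R. (cmod (f x - cutoff R f x))\<^sup>2) \<longlongrightarrow> 0) at_top" by (rule tendsto_eventually)
    qed
  qed (use f2 in auto)
  then have "((\<lambda>R. ennreal (\<integral>x. (cmod (f x - cutoff R f x))\<^sup>2 \<partial>lborel)) \<longlongrightarrow> ennreal 0) at_top"
    by (intro tendsto_ennrealI) simp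
  moreover have "tail_energy f R = ennreal (\<integral>x. (cmod (f x - cutoff R f x))\<^sup>2 \<partial>lborel)" for R
    unfolding tail_energy_def by (rule nn_integral_eq_integral[OF i]) auto
  ultimately show ?thesis by (simp add: fun_eq_iff[symmetric]) (simp add: tail_energy_def[abs_def])
qed

lemma cutoff_diff_energy_le:
  assumes "R \<ge> T" "S \<ge> T"
  shows "(\<integral>\<^sup>+x. ennreal ((cmod (cutoff R f x - cutoff S f x))\<^sup>2) \<partial>lborel) \<le> tail_energy f T"
  unfolding tail_energy_def
  by (rule nn_integral_mono) (use assms in \<open>auto simp: cutoff_def indicator_def\<close>)

section \<open>Uniqueness, injectivity and existence of the transform in the mean\<close>

lemma is_L2_fourier_iff:
  "is_L2_fourier f F \<longleftrightarrow> F \<in> L2_line \<and>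
     ((\<lambda>R. \<integral>\<^sup>+ \<xi>. ennreal ((cmod (F \<xi> - FT (cutoff R f) \<xi>))\<^sup>2) \<partial>lborel) \<longlongrightarrow> 0) at_top"
  unfolding is_L2_fourier_def set_integral_eq_FT_cutoff ..

lemma tendsto_twice_ennreal_zero:
  fixes f :: "'a \<Rightarrow> ennreal"
  assumes "(f \<longlongrightarrow> 0) F"
  shows "((\<lambda>x. 2 * f x) \<longlongrightarrow> 0) F"
  using ennreal_tendsto_cmult[OF _ assms, of 2] by simp

lemma is_L2_fourier_unique:
  assumes f: "f \<in> borel_measurable borel" and F: "is_L2_fourier f F" and G: "is_L2_fourier f G"
  shows "AE \<xi> in lborel. F \<xi> = G \<xi>"
proof -
  note [measurable] = f
  have [measurable]: "F \<in> borel_measurable borel" "G \<in> borel_measurable borel"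
    using F G by (auto simp: is_L2_fourier_def L2_line_iff)
  have le: "(\<integral>\<^sup>+x. ennreal ((cmod (F x - G x))\<^sup>2) \<partial>lborel)
    \<le> 2 * (\<integral>\<^sup>+x. ennreal ((cmod (F x - FT (cutoff R f) x))\<^sup>2) \<partial>lborel) + 2 * (\<integral>\<^sup>+x. ennreal ((cmod (G x - FT (cutoff R f) x))\<^sup>2) \<partial>lborel)" for R
    using nn_integral_norm_diff_le[of F G "FT (cutoff R f)"] by (simp add: norm_minus_commute)
  have "((\<lambda>R. 2 * (\<integral>\<^sup>+x. ennreal ((cmod (F x - FT (cutoff R f) x))\<^sup>2) \<partial>lborel) + 2 * (\<integral>\<^sup>+x. ennreal ((cmod (G x - FT (cutoff R f) x))\<^sup>2) \<partial>lborel)) \<longlongrightarrow> 2 * 0 + 2 * 0) at_top"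
    using F G by (intro tendsto_add) (auto simp: is_L2_fourier_iff intro!: tendsto_twice_ennreal_zero)
  then have "(\<integral>\<^sup>+x. ennreal ((cmod (F x - G x))\<^sup>2) \<partial>lborel) \<le> 0"
    by (intro tendsto_lowerbound[where F=at_top]) (use le in auto)
  then show ?thesis by (simp add: nn_integral_0_iff_AE)
qed

text \<open>Plancherel is applied to truncations only. The truncated distance between
  \<open>f\<close> and \<open>g\<close> increases with \<open>R\<close>, while its image under the
  transform tends to 0, so it is 0 for every \<open>R\<close>.\<close>

lemma is_L2_fourier_inj:
  assumes f: "f \<in> L2_line" and g: "g \<in> L2_line" and F: "is_L2_fourier f F" and G: "is_L2_fourier g F"
  shows "AE x in lborel. f x = g x"
proof -
  have [measurable]: "F \<in> borel_measurable borel" "f \<in> borel_measurable borel" "g \<in> borel_measurable borel"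
    using f g F by (auto simp: is_L2_fourier_def L2_line_iff)
  let ?D = "\<lambda>R. \<integral>\<^sup>+x. ennreal ((cmod (cutoff R f x - cutoff R g x))\<^sup>2) \<partial>lborel"
  have le: "ennreal (2 * pi) * ?D R
    \<le> 2 * (\<integral>\<^sup>+x. ennreal ((cmod (F x - FT (cutoff R f) x))\<^sup>2) \<partial>lborel) + 2 * (\<integral>\<^sup>+x. ennreal ((cmod (F x - FT (cutoff R g) x))\<^sup>2) \<partial>lborel)" for R
    using nn_integral_norm_diff_le[of "FT (cutoff R f)" "FT (cutoff R g)" F]
      Plancherel_nn_diff[OF cutoff_integrable(1)[OF f] cutoff_integrable(1)[OF g] cutoff_integrable(2)[OF f] cutoff_integrable(2)[OF g], of R R]
    by (simp add: norm_minus_commute)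
  have lim: "((\<lambda>R. 2 * (\<integral>\<^sup>+x. ennreal ((cmod (F x - FT (cutoff R f) x))\<^sup>2) \<partial>lborel) + 2 * (\<integral>\<^sup>+x. ennreal ((cmod (F x - FT (cutoff R g) x))\<^sup>2) \<partial>lborel)) \<longlongrightarrow> 2 * 0 + 2 * 0) at_top"
    using F G by (intro tendsto_add) (auto simp: is_L2_fourier_iff intro!: tendsto_twice_ennreal_zero)
  have mono: "?D R \<le> ?D S" if "R \<le> S" for R S
    by (rule nn_integral_mono) (use that in \<open>auto simp: cutoff_def indicator_def\<close>)
  have D0: "?D R = 0" for R
  proof -
    have "ennreal (2 * pi) * ?D R \<le> 2 * 0 + 2 * 0"
    proof (rule tendsto_lowerbound[OF lim])
      show "\<forall>\<^sub>F S in at_top. ennreal (2 * pi) * ?D R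
        \<le> 2 * (\<integral>\<^sup>+x. ennreal ((cmod (F x - FT (cutoff S f) x))\<^sup>2) \<partial>lborel) + 2 * (\<integral>\<^sup>+x. ennreal ((cmod (F x - FT (cutoff S g) x))\<^sup>2) \<partial>lborel)"
        using eventually_ge_at_top[of R]
        by eventually_elim (rule order_trans[OF mult_left_mono[OF mono] le], auto)
    qed simp
    then show ?thesis by (simp add: ennreal_mult_eq_top_iff)
  qed
  have "AE x in lborel. \<forall>n::nat. cutoff (real n) f x = cutoff (real n) g x"
    unfolding AE_all_countable
  proof
    fix n
    show "AE x in lborel. cutoff (real n) f x = cutoff (real n) g x"
      using D0[of "real n"] by (simp add: nn_integral_0_iff_AE)
  qed
  then show ?thesis
  proof eventually_elim
    case (elim x)
    obtain n :: nat where "\<bar>x\<bar> \<le> real n" using real_arch_simple by blast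
    then show ?case using elim[rule_format, of n] by (simp add: cutoff_def indicator_def abs_le_iff split: if_splits)
  qed
qed

lemma is_L2_fourier_zero:
  assumes "AE x in lborel. f x = 0" 
  shows "is_L2_fourier f (\<lambda>_. 0)"
proof -
  have "FT (cutoff R f) \<xi> = 0" for R \<xi>
    unfolding FT_def by (rule integral_eq_zero_AE) (use assms in \<open>auto simp: cutoff_def\<close>)
  then show ?thesis by (simp add: is_L2_fourier_iff L2_line_iff)
qed

text \<open>The Riesz-Fischer argument: the transforms of truncations form a Cauchy family by
  Plancherel, a rapidly converging sequence of them converges almost everywhere, and Fatou's lemma
  shows that the pointwise limit is also the limit in the mean along all \<open>R\<close>.\<close>

theorem is_L2_fourier_exists:
  assumes f: "f \<in> L2_line"
  shows "\<exists>F. is_L2_fourier f F"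
proof -
  have [measurable]: "f \<in> borel_measurable borel" and f2: "integrable lborel (\<lambda>x. (cmod (f x))\<^sup>2)"
    using f by (auto simp: L2_line_iff)
  let ?E = "\<lambda>R \<xi>. FT (cutoff R f) \<xi>"
  have diff: "(\<integral>\<^sup>+\<xi>. ennreal ((cmod (?E R \<xi> - ?E S \<xi>))\<^sup>2) \<partial>lborel) \<le> ennreal (2 * pi) * tail_energy f T"
    if "R \<ge> T" "S \<ge> T" for R S T
    unfolding Plancherel_nn_diff[OF cutoff_integrable(1)[OF f] cutoff_integrable(1)[OF f] cutoff_integrable(2)[OF f] cutoff_integrable(2)[OF f]]
    by (intro mult_left_mono cutoff_diff_energy_le that) auto
  have tail: "((\<lambda>R. ennreal (2 * pi) * tail_energy f R) \<longlongrightarrow> 0) at_top"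
    using ennreal_tendsto_cmult[OF _ tail_energy_tendsto[OF f], of "ennreal (2 * pi)"] by simp
  \<comment> \<open>The rate \<open>4^-k\<close> is chosen so that the increments remain summable
    after multiplication by \<open>2^k\<close>.\<close>
  have "\<exists>R\<ge>real k. ennreal (2 * pi) * tail_energy f R < ennreal ((1/4)^k)" for k
  proof -
    have "\<forall>\<^sub>F R in at_top. ennreal (2 * pi) * tail_energy f R < ennreal ((1/4)^k)"
      by (rule order_tendstoD[OF tail]) simp
    with eventually_ge_at_top[of "real k"]
    have "\<forall>\<^sub>F R in at_top. R \<ge> real k \<and> ennreal (2 * pi) * tail_energy f R < ennreal ((1/4)^k)"
      by eventually_elim simp
    then show ?thesis by (auto dest: eventually_happens'[rotated])
  qed
  then obtain r where r: "\<And>k. r k \<ge> real k" "\<And>k. ennreal (2 * pi) * tail_energy f (r k) < ennreal ((1/4)^k)"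
    by metis
  define a where "a k \<xi> = ?E (r (Suc k)) \<xi> - ?E (r k) \<xi>" for k \<xi>
  have [measurable]: "a k \<in> borel_measurable borel" for k unfolding a_def by measurable
  have a_le: "(\<integral>\<^sup>+\<xi>. ennreal ((cmod (a k \<xi>))\<^sup>2) \<partial>lborel) \<le> ennreal ((1/4)^k)" for k
  \<comment> \<open>The radii tend to infinity but need not increase, so the smaller of the two
    neighbours has to be selected.\<close>
  proof (cases "r k \<le> r (Suc k)")
    case True
    then show ?thesis using diff[of "r k" "r (Suc k)" "r k"] r(2)[of k] by (auto simp: a_def)
  next
    case False
    have "(\<integral>\<^sup>+\<xi>. ennreal ((cmod (a k \<xi>))\<^sup>2) \<partial>lborel) \<le> ennreal (2 * pi) * tail_energy f (r (Suc k))"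
      unfolding a_def using False by (intro diff) auto
    also have "\<dots> \<le> ennreal ((1/4)^Suc k)" using r(2)[of "Suc k"] by (rule less_imp_le)
    also have "\<dots> \<le> ennreal ((1/4)^k)" by (intro ennreal_leI) simp
    finally show ?thesis .
  qed
  have "(\<integral>\<^sup>+\<xi>. (\<Sum>k. ennreal (2^k * (cmod (a k \<xi>))\<^sup>2)) \<partial>lborel) = (\<Sum>k. \<integral>\<^sup>+\<xi>. ennreal (2^k * (cmod (a k \<xi>))\<^sup>2) \<partial>lborel)"
    by (rule nn_integral_suminf) measurable
  also have "\<dots> \<le> (\<Sum>k. ennreal ((1/2)^k))"
  proof (rule suminf_le)
    fix k
    have "(\<integral>\<^sup>+\<xi>. ennreal (2^k * (cmod (a k \<xi>))\<^sup>2) \<partial>lborel) = ennreal (2^k) * (\<integral>\<^sup>+\<xi>. ennreal ((cmod (a k \<xi>))\<^sup>2) \<partial>lborel)"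
      by (simp add: ennreal_mult nn_integral_cmult)
    also have "\<dots> \<le> ennreal (2^k) * ennreal ((1/4)^k)" by (intro mult_left_mono a_le) auto
    also have "\<dots> = ennreal ((1/2)^k)" by (simp add: ennreal_mult[symmetric] power_mult_distrib[symmetric])
    finally show "(\<integral>\<^sup>+\<xi>. ennreal (2^k * (cmod (a k \<xi>))\<^sup>2) \<partial>lborel) \<le> ennreal ((1/2)^k)" .
  qed auto
  also have "\<dots> = ennreal (\<Sum>k. (1/2)^k)" by (intro suminf_ennreal2) auto
  finally have "(\<integral>\<^sup>+\<xi>. (\<Sum>k. ennreal (2^k * (cmod (a k \<xi>))\<^sup>2)) \<partial>lborel) \<noteq> \<infinity>"
    by (auto simp: top_unique)
  then have "AE \<xi> in lborel. (\<Sum>k. ennreal (2^k * (cmod (a k \<xi>))\<^sup>2)) \<noteq> \<infinity>"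
    by (intro nn_integral_noteq_infinite) auto
  then have conv: "AE \<xi> in lborel. convergent (\<lambda>k. ?E (r k) \<xi>)"
  proof eventually_elim
    case (elim \<xi>)
    have s: "summable (\<lambda>k. 2^k * (cmod (a k \<xi>))\<^sup>2)" using elim by (intro summable_suminf_not_top) auto
    have s': "summable (\<lambda>k. (1/2::real)^k + 2^k * (cmod (a k \<xi>))\<^sup>2)" by (intro summable_add s) auto
    have "summable (\<lambda>k. a k \<xi>)"
    proof (rule summable_comparison_test'[OF s'])
      fix k
      \<comment> \<open>The arithmetic-geometric inequality with weights \<open>2^k\<close> and
        \<open>2^-k\<close> turns the weighted square sum into absolute summability of the
        increments.\<close>
      have "0 \<le> (cmod (a k \<xi>) * sqrt (2^k) - sqrt ((1/2)^k))\<^sup>2" by simp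
      also have "\<dots> = (1/2)^k + 2^k * (cmod (a k \<xi>))\<^sup>2 - 2 * cmod (a k \<xi>) * sqrt (2^k * (1/2)^k)"
        by (simp add: power2_diff power_mult_distrib real_sqrt_mult del: power_one_over)
      also have "sqrt (2^k * (1/2)^k) = (1::real)" by (simp add: power_mult_distrib[symmetric])
      finally show "norm (a k \<xi>) \<le> (1/2)^k + 2^k * (cmod (a k \<xi>))\<^sup>2"
        using norm_ge_zero[of "a k \<xi>"] by linarith
    qed
    then have "convergent (\<lambda>n. ?E (r 0) \<xi> + (\<Sum>k<n. a k \<xi>))"
      by (intro convergent_add convergent_const) (simp add: summable_iff_convergent)
    moreover have "?E (r 0) \<xi> + (\<Sum>k<n. a k \<xi>) = ?E (r n) \<xi>" for n
      unfolding a_def using sum_lessThan_telescope[of "\<lambda>k. ?E (r k) \<xi>" n] by simp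
    ultimately show ?case by simp
  qed
  define F where "F \<xi> = lim (\<lambda>k. ?E (r k) \<xi>)" for \<xi>
  have [measurable]: "F \<in> borel_measurable borel"
    unfolding F_def by (rule borel_measurable_lim_metric) measurable
  have F_lim: "AE \<xi> in lborel. (\<lambda>k. ?E (r k) \<xi>) \<longlonglongrightarrow> F \<xi>"
    using conv by eventually_elim (simp add: F_def convergent_LIMSEQ_iff)
  \<comment> \<open>Fatou along the subsequence; eventually \<open>r k \<ge> R\<close>, and then
    both truncation radii are at least \<open>R\<close>.\<close>
  have F_le: "(\<integral>\<^sup>+\<xi>. ennreal ((cmod (F \<xi> - ?E R \<xi>))\<^sup>2) \<partial>lborel) \<le> ennreal (2 * pi) * tail_energy f R" for R
  proof -
    have "(\<integral>\<^sup>+\<xi>. ennreal ((cmod (F \<xi> - ?E R \<xi>))\<^sup>2) \<partial>lborel)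
      = (\<integral>\<^sup>+\<xi>. liminf (\<lambda>k. ennreal ((cmod (?E (r k) \<xi> - ?E R \<xi>))\<^sup>2)) \<partial>lborel)"
    proof (rule nn_integral_cong_AE)
      show "AE \<xi> in lborel. ennreal ((cmod (F \<xi> - ?E R \<xi>))\<^sup>2) = liminf (\<lambda>k. ennreal ((cmod (?E (r k) \<xi> - ?E R \<xi>))\<^sup>2))"
        using F_lim
      proof eventually_elim
        case (elim \<xi>)
        then have "(\<lambda>k. ennreal ((cmod (?E (r k) \<xi> - ?E R \<xi>))\<^sup>2)) \<longlonglongrightarrow> ennreal ((cmod (F \<xi> - ?E R \<xi>))\<^sup>2)"
          by (intro tendsto_intros)
        from lim_imp_Liminf[OF _ this] show ?case by simp
      qed
    qed
    also have "\<dots> \<le> liminf (\<lambda>k. \<integral>\<^sup>+\<xi>. ennreal ((cmod (?E (r k) \<xi> - ?E R \<xi>))\<^sup>2) \<partial>lborel)"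
      by (rule nn_integral_liminf) measurable
    also have "\<dots> \<le> ennreal (2 * pi) * tail_energy f R"
    proof -
      have "\<forall>\<^sub>F k in sequentially. (\<integral>\<^sup>+\<xi>. ennreal ((cmod (?E (r k) \<xi> - ?E R \<xi>))\<^sup>2) \<partial>lborel) \<le> ennreal (2 * pi) * tail_energy f R"
        using eventually_ge_at_top[of "nat \<lceil>\<bar>R\<bar>\<rceil>"]
      proof eventually_elim
        case (elim k)
        then have "R \<le> real k" by linarith
        then show ?case using r(1)[of k] by (intro diff) auto
      qed
      then have "liminf (\<lambda>k. \<integral>\<^sup>+\<xi>. ennreal ((cmod (?E (r k) \<xi> - ?E R \<xi>))\<^sup>2) \<partial>lborel) \<le> liminf (\<lambda>k::nat. ennreal (2 * pi) * tail_energy f R)"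
        by (rule Liminf_mono)
      then show ?thesis by (simp add: Liminf_const)
    qed
    finally show ?thesis .
  qed
  have lim: "((\<lambda>R. \<integral>\<^sup>+\<xi>. ennreal ((cmod (F \<xi> - ?E R \<xi>))\<^sup>2) \<partial>lborel) \<longlongrightarrow> 0) at_top"
    by (rule tendsto_sandwich[OF _ _ tendsto_const tail]) (auto simp: F_le)
  have "F \<in> L2_line"
  proof -
    have "\<forall>\<^sub>F R in at_top. (\<integral>\<^sup>+\<xi>. ennreal ((cmod (F \<xi> - ?E R \<xi>))\<^sup>2) \<partial>lborel) < 1"
      by (rule order_tendstoD[OF lim]) simp
    then obtain R where R: "(\<integral>\<^sup>+\<xi>. ennreal ((cmod (F \<xi> - ?E R \<xi>))\<^sup>2) \<partial>lborel) < 1"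
      by (auto dest: eventually_happens'[rotated])
    have i: "integrable lborel (\<lambda>\<xi>. (cmod (?E R \<xi>))\<^sup>2)"
      by (rule Plancherel_L1_L2(1)[OF cutoff_integrable[OF f]])
    have "(\<integral>\<^sup>+\<xi>. ennreal ((cmod (F \<xi> - 0))\<^sup>2) \<partial>lborel)
      \<le> 2 * (\<integral>\<^sup>+\<xi>. ennreal ((cmod (F \<xi> - ?E R \<xi>))\<^sup>2) \<partial>lborel) + 2 * (\<integral>\<^sup>+\<xi>. ennreal ((cmod (?E R \<xi> - 0))\<^sup>2) \<partial>lborel)"
      by (rule nn_integral_norm_diff_le) measurable
    also have "\<dots> < \<infinity>"
      using R nn_integral_eq_integral[OF i] 
      by (auto simp: ennreal_mult_eq_top_iff less_top[symmetric])
    finally show ?thesis by (auto simp: L2_line_iff integrable_iff_bounded)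
  qed
  with lim show ?thesis by (auto simp: is_L2_fourier_iff)
qed

lemma L2_fourier_is_fourier: "f \<in> L2_line \<Longrightarrow> is_L2_fourier f (L2_fourier f)"
  unfolding L2_fourier_def by (rule someI_ex[OF is_L2_fourier_exists])

section \<open>Fourier inversion\<close>

definition inverse_FT :: "(real \<Rightarrow> complex) \<Rightarrow> real \<Rightarrow> complex" where
  "inverse_FT F x = of_real (1 / (2 * pi)) * (\<integral>\<xi>. exp (\<i> * of_real (x * \<xi>)) * F \<xi> \<partial>lborel)"

lemma inverse_FT_eq_FT: "inverse_FT F x = of_real (1 / (2 * pi)) * FT F (- x)"
  unfolding inverse_FT_def FT_def by (simp add: mult_ac)

text \<open>The error of the truncated transform is computed exactly instead of being estimated. In
  the expanded square, Plancherel for \<open>F\<close> and for the truncation gives the two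
  energies, and Fubini gives the cross term; what remains is \<open>2 * pi\<close> times the tail of
  \<open>f\<close>, even though \<open>f\<close> itself need not be integrable.\<close>

theorem is_L2_fourier_inverse_FT:
  assumes F1: "integrable lborel F" and F2: "integrable lborel (\<lambda>\<xi>. (cmod (F \<xi>))\<^sup>2)"
  shows "inverse_FT F \<in> L2_line" and "is_L2_fourier (inverse_FT F) F"
proof -
  have [measurable]: "F \<in> borel_measurable borel" using F1 by auto
  define f where "f = inverse_FT F"
  have [measurable]: "f \<in> borel_measurable borel" unfolding f_def inverse_FT_eq_FT by measurable
  have fsq: "(cmod (f x))\<^sup>2 = (1 / (2 * pi))\<^sup>2 * (cmod (FT F (0 + (-1) * x)))\<^sup>2" for x
    by (simp add: f_def inverse_FT_eq_FT norm_mult norm_divide power_mult_distrib power_divide)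
  note P = Plancherel_L1_L2[OF F1 F2]
  have f2: "integrable lborel (\<lambda>x. (cmod (f x))\<^sup>2)"
    unfolding fsq by (intro integrable_mult_right lborel_integrable_real_affine P(1)) auto
  have fint: "2 * pi * (\<integral>x. (cmod (f x))\<^sup>2 \<partial>lborel) = (\<integral>\<xi>. (cmod (F \<xi>))\<^sup>2 \<partial>lborel)"
  proof -
    have "(\<integral>x. (cmod (f x))\<^sup>2 \<partial>lborel) = (1 / (2 * pi))\<^sup>2 * (\<integral>x. (cmod (FT F (0 + (-1) * x)))\<^sup>2 \<partial>lborel)"
      unfolding fsq by simp
    also have "(\<integral>x. (cmod (FT F (0 + (-1) * x)))\<^sup>2 \<partial>lborel) = (\<integral>x. (cmod (FT F x))\<^sup>2 \<partial>lborel)"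
      using lborel_integral_real_affine[of "-1" "\<lambda>x. (cmod (FT F x))\<^sup>2" 0] by simp
    finally have "(\<integral>x. (cmod (f x))\<^sup>2 \<partial>lborel) = (1 / (2 * pi))\<^sup>2 * (2 * pi * (\<integral>\<xi>. (cmod (F \<xi>))\<^sup>2 \<partial>lborel))"
      by (simp only: P(2))
    moreover have "2 * pi * ((1 / (2 * pi))\<^sup>2 * (2 * pi * K)) = K" for K
      by (simp add: power2_eq_square)
    ultimately show ?thesis by simp
  qed
  show fL: "inverse_FT F \<in> L2_line" using f2 by (simp add: L2_line_iff f_def[symmetric])
  then have fL: "f \<in> L2_line" by (simp add: f_def)
  have err: "(\<integral>\<^sup>+ \<xi>. ennreal ((cmod (F \<xi> - FT (cutoff R f) \<xi>))\<^sup>2) \<partial>lborel) = ennreal (2 * pi) * tail_energy f R" for R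
  proof -
    let ?E = "FT (cutoff R f)"
    note c = cutoff_integrable[OF fL, of R]
    note PE = Plancherel_L1_L2[OF c]
    have bF: "integrable lborel (\<lambda>\<xi>. 2 * (cmod (F \<xi>))\<^sup>2 + 2 * (cmod (?E \<xi>))\<^sup>2)" using F2 PE(1) by simp
    have iD: "integrable lborel (\<lambda>\<xi>. (cmod (F \<xi> - ?E \<xi>))\<^sup>2)"
      by (rule Bochner_Integration.integrable_bound[OF bF]) (use power2_norm_diff_le[of _ _ 0] in \<open>auto intro!: AE_I2\<close>)
    have iX: "integrable lborel (\<lambda>\<xi>. cnj (F \<xi>) * ?E \<xi>)"
    proof (rule Bochner_Integration.integrable_bound[OF bF])
      show "AE \<xi> in lborel. norm (cnj (F \<xi>) * ?E \<xi>) \<le> norm (2 * (cmod (F \<xi>))\<^sup>2 + 2 * (cmod (?E \<xi>))\<^sup>2)"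
      proof (rule AE_I2)
        fix \<xi>
        have "2 * cmod (F \<xi>) * cmod (?E \<xi>) \<le> (cmod (F \<xi>))\<^sup>2 + (cmod (?E \<xi>))\<^sup>2" by (rule sum_squares_bound)
        moreover have "0 \<le> cmod (F \<xi>) * cmod (?E \<xi>)" by simp
        ultimately have "cmod (F \<xi>) * cmod (?E \<xi>) \<le> 2 * (cmod (F \<xi>))\<^sup>2 + 2 * (cmod (?E \<xi>))\<^sup>2" by linarith
        then show "norm (cnj (F \<xi>) * ?E \<xi>) \<le> norm (2 * (cmod (F \<xi>))\<^sup>2 + 2 * (cmod (?E \<xi>))\<^sup>2)" by (simp add: norm_mult)
      qed
    qed measurable
    \<comment> \<open>Cross term: exchanging the integrals lets \<open>cnj (F \<xi>)\<close>
      reproduce \<open>2 * pi * cnj (f x)\<close>, so the integral is \<open>2 * pi\<close> times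
      the energy of the truncation.\<close>
    have "(\<integral>\<xi>. cnj (F \<xi>) * ?E \<xi> \<partial>lborel) = (\<integral>\<xi>. cnj (F \<xi>) * (\<integral>x. exp (- (\<i> * of_real (x * \<xi>))) * cutoff R f x \<partial>lborel) \<partial>lborel)"
      by (simp only: FT_def)
    also have "\<dots> = (\<integral>x. cutoff R f x * (\<integral>\<xi>. exp (- (\<i> * of_real (x * \<xi>))) * cnj (F \<xi>) \<partial>lborel) \<partial>lborel)"
      by (rule Fubini_bounded_kernel[where B=1])
         (use c F1 in \<open>auto intro!: lborel.sigma_finite_measure_axioms\<close>)
    also have "\<dots> = (\<integral>x. of_real (2 * pi * (cmod (cutoff R f x))\<^sup>2) \<partial>lborel)"
    proof (rule Bochner_Integration.integral_cong[OF refl])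
      fix x
      have "cnj (f x) = of_real (1 / (2 * pi)) * cnj (\<integral>\<xi>. exp (\<i> * of_real (x * \<xi>)) * F \<xi> \<partial>lborel)"
        unfolding f_def inverse_FT_def complex_cnj_mult complex_cnj_complex_of_real ..
      also have "cnj (\<integral>\<xi>. exp (\<i> * of_real (x * \<xi>)) * F \<xi> \<partial>lborel) = (\<integral>\<xi>. cnj (exp (\<i> * of_real (x * \<xi>)) * F \<xi>) \<partial>lborel)"
        by (rule Bochner_Integration.integral_cnj[symmetric])
      also have "(\<integral>\<xi>. cnj (exp (\<i> * of_real (x * \<xi>)) * F \<xi>) \<partial>lborel) = (\<integral>\<xi>. exp (- (\<i> * of_real (x * \<xi>))) * cnj (F \<xi>) \<partial>lborel)"
        by (rule Bochner_Integration.integral_cong[OF refl]) (simp add: exp_cnj)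
      finally have "(\<integral>\<xi>. exp (- (\<i> * of_real (x * \<xi>))) * cnj (F \<xi>) \<partial>lborel) = of_real (2 * pi) * cnj (f x)" by simp
      moreover have "cutoff R f x * cnj (f x) = of_real ((cmod (cutoff R f x))\<^sup>2)"
        by (auto simp: cutoff_def indicator_def complex_norm_square simp del: of_real_power)
      then have "cutoff R f x * (of_real (2 * pi) * cnj (f x)) = of_real (2 * pi * (cmod (cutoff R f x))\<^sup>2)"
        by (simp only: of_real_mult mult.left_commute[of "cutoff R f x"])
      ultimately show "cutoff R f x * (\<integral>\<xi>. exp (- (\<i> * of_real (x * \<xi>))) * cnj (F \<xi>) \<partial>lborel) = of_real (2 * pi * (cmod (cutoff R f x))\<^sup>2)"
        by simp
    qed
    also have "\<dots> = of_real (2 * pi * (\<integral>x. (cmod (cutoff R f x))\<^sup>2 \<partial>lborel))"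
      unfolding integral_complex_of_real by simp
    finally have X: "Re (\<integral>\<xi>. cnj (F \<xi>) * ?E \<xi> \<partial>lborel) = 2 * pi * (\<integral>x. (cmod (cutoff R f x))\<^sup>2 \<partial>lborel)"
      by (metis Re_complex_of_real)
    have iXr: "integrable lborel (\<lambda>\<xi>. Re (cnj (F \<xi>) * ?E \<xi>))" using iX by (rule integrable_Re)
    have "(\<integral>\<xi>. (cmod (F \<xi> - ?E \<xi>))\<^sup>2 \<partial>lborel) = (\<integral>\<xi>. ((cmod (F \<xi>))\<^sup>2 + (cmod (?E \<xi>))\<^sup>2) - 2 * Re (cnj (F \<xi>) * ?E \<xi>) \<partial>lborel)"
      unfolding cmod_Re_Im_square
      by (rule Bochner_Integration.integral_cong) (auto simp: power2_eq_square algebra_simps)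
    also have "\<dots> = ((\<integral>\<xi>. (cmod (F \<xi>))\<^sup>2 \<partial>lborel) + (\<integral>\<xi>. (cmod (?E \<xi>))\<^sup>2 \<partial>lborel)) - 2 * (\<integral>\<xi>. Re (cnj (F \<xi>) * ?E \<xi>) \<partial>lborel)"
      unfolding Bochner_Integration.integral_diff[OF Bochner_Integration.integrable_add[OF F2 PE(1)] integrable_mult_right[OF iXr]]
        Bochner_Integration.integral_add[OF F2 PE(1)] integral_mult_right_zero ..
    also have "(\<integral>\<xi>. Re (cnj (F \<xi>) * ?E \<xi>) \<partial>lborel) = 2 * pi * (\<integral>x. (cmod (cutoff R f x))\<^sup>2 \<partial>lborel)"
      unfolding X[symmetric] by (rule integral_Re[OF iX])
    also have "(\<integral>\<xi>. (cmod (F \<xi>))\<^sup>2 \<partial>lborel) + (\<integral>\<xi>. (cmod (?E \<xi>))\<^sup>2 \<partial>lborel) - 2 * (2 * pi * (\<integral>x. (cmod (cutoff R f x))\<^sup>2 \<partial>lborel))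
       = 2 * pi * ((\<integral>x. (cmod (f x))\<^sup>2 \<partial>lborel) - (\<integral>x. (cmod (cutoff R f x))\<^sup>2 \<partial>lborel))"
      by (simp add: PE(2) fint[symmetric] algebra_simps)
    also have "(\<integral>x. (cmod (f x))\<^sup>2 \<partial>lborel) - (\<integral>x. (cmod (cutoff R f x))\<^sup>2 \<partial>lborel) = (\<integral>x. (cmod (f x))\<^sup>2 - (cmod (cutoff R f x))\<^sup>2 \<partial>lborel)"
      using f2 c(2) by simp
    also have "\<dots> = (\<integral>x. (cmod (f x - cutoff R f x))\<^sup>2 \<partial>lborel)"
      by (rule Bochner_Integration.integral_cong) (auto simp: cutoff_def indicator_def)
    finally have eq: "(\<integral>\<xi>. (cmod (F \<xi> - ?E \<xi>))\<^sup>2 \<partial>lborel) = 2 * pi * (\<integral>x. (cmod (f x - cutoff R f x))\<^sup>2 \<partial>lborel)" .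
    have iT: "integrable lborel (\<lambda>x. (cmod (f x - cutoff R f x))\<^sup>2)"
      by (rule Bochner_Integration.integrable_bound[OF f2]) (auto simp: cutoff_def indicator_def)
    show ?thesis
      unfolding tail_energy_def using nn_integral_eq_integral[OF iD] nn_integral_eq_integral[OF iT]
      by (simp add: eq ennreal_mult)
  qed
  have "((\<lambda>R. ennreal (2 * pi) * tail_energy f R) \<longlongrightarrow> 0) at_top"
    using ennreal_tendsto_cmult[OF _ tail_energy_tendsto[OF fL], of "ennreal (2 * pi)"] by simp
  then show "is_L2_fourier (inverse_FT F) F"
    using F2 unfolding f_def[symmetric] is_L2_fourier_iff err by (simp add: L2_line_iff)
qed

section \<open>Compact symmetric operators on semi-inner product spaces\<close>

text \<open>A single operation with two coefficients covers differences
  (\<open>lincomb 1 f (-1) g\<close>) and scalar multiples (\<open>lincomb a f 0 f\<close>), so the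
  subspaces below need one closure property only.\<close>

abbreviation lincomb :: "real \<Rightarrow> ('a \<Rightarrow> real) \<Rightarrow> real \<Rightarrow> ('a \<Rightarrow> real) \<Rightarrow> 'a \<Rightarrow> real" where
  "lincomb a f b g \<equiv> (\<lambda>x. a * f x + b * g x)"

text \<open>The form may vanish on nonzero functions, because functions differing on a null set are
  kept apart. Completeness is not assumed; limits come from compactness of the operator.\<close>

locale semi_inner_space =
  fixes V :: "('a \<Rightarrow> real) set" and ip :: "('a \<Rightarrow> real) \<Rightarrow> ('a \<Rightarrow> real) \<Rightarrow> real"
  assumes lincomb_mem: "f \<in> V \<Longrightarrow> g \<in> V \<Longrightarrow> lincomb a f b g \<in> V"
    and ip_lincomb: "f \<in> V \<Longrightarrow> g \<in> V \<Longrightarrow> h \<in> V \<Longrightarrow> ip (lincomb a f b g) h = a * ip f h + b * ip g h"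
    and ip_commute: "f \<in> V \<Longrightarrow> g \<in> V \<Longrightarrow> ip f g = ip g f"
    and ip_nonneg: "f \<in> V \<Longrightarrow> 0 \<le> ip f f"
begin

lemma ip_lincomb_self:
  assumes "f \<in> V" "g \<in> V"
  shows "ip (lincomb a f b g) (lincomb a f b g) = a\<^sup>2 * ip f f + 2 * a * b * ip f g + b\<^sup>2 * ip g g"
  using assms ip_commute[OF assms] ip_commute[of f "lincomb a f b g"] ip_commute[of g "lincomb a f b g"]
  by (simp add: ip_lincomb lincomb_mem power2_eq_square algebra_simps)

text \<open>A triangle inequality for squared lengths, from the nonnegativity of the squared length
  of the difference of the two increments. It keeps square roots out of the limit arguments.\<close>

lemma ip_lincomb_triangle:
  assumes "f \<in> V" "g \<in> V" "h \<in> V"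
  shows "ip (lincomb 1 f (-1) h) (lincomb 1 f (-1) h)
    \<le> 2 * ip (lincomb 1 f (-1) g) (lincomb 1 f (-1) g) + 2 * ip (lincomb 1 g (-1) h) (lincomb 1 g (-1) h)"
proof -
  let ?a = "lincomb 1 f (-1) g" and ?b = "lincomb 1 g (-1) h"
  have m: "?a \<in> V" "?b \<in> V"
    by (rule lincomb_mem[OF assms(1,2)], rule lincomb_mem[OF assms(2,3)])
  have "lincomb 1 ?a 1 ?b = lincomb 1 f (-1) h" by auto
  then have e: "ip (lincomb 1 f (-1) h) (lincomb 1 f (-1) h) = ip ?a ?a + 2 * ip ?a ?b + ip ?b ?b"
    using ip_lincomb_self[OF m, of 1 1] by simp
  have "0 \<le> ip ?a ?a - 2 * ip ?a ?b + ip ?b ?b"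
    using ip_lincomb_self[OF m, of 1 "-1"] ip_nonneg[OF lincomb_mem[OF m, of 1 "-1"]] by simp
  with e show ?thesis by linarith
qed

text \<open>\<open>\<Lambda>\<close> is the supremum of the Rayleigh quotient, and a maximising
  sequence becomes an eigenvector through compactness. Positivity of the form at \<open>w\<close>
  makes \<open>\<Lambda>\<close> positive, which prevents the limit from being null. With a
  semidefinite form the eigenvalue equation can only hold up to a null vector.\<close>

lemma compact_symmetric_eigenvector:
  assumes T_mem: "\<And>f. f \<in> V \<Longrightarrow> T f \<in> V"
    and T_lin: "\<And>f g a b. f \<in> V \<Longrightarrow> g \<in> V \<Longrightarrow> T (lincomb a f b g) = lincomb a (T f) b (T g)"
    and T_sym: "\<And>f g. f \<in> V \<Longrightarrow> g \<in> V \<Longrightarrow> ip (T f) g = ip f (T g)"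
    and T_bdd: "\<And>f. f \<in> V \<Longrightarrow> ip (T f) (T f) \<le> C * ip f f"
    and T_compact: "\<And>u. (\<And>n. u n \<in> V) \<Longrightarrow> (\<And>n. ip (u n) (u n) = 1) \<Longrightarrow>
       \<exists>r h. strict_mono (r :: nat \<Rightarrow> nat) \<and> h \<in> V \<and>
         (\<lambda>n. ip (lincomb 1 (T (u (r n))) (-1) h) (lincomb 1 (T (u (r n))) (-1) h)) \<longlonglongrightarrow> 0"
    and w: "w \<in> V" "ip (T w) w > 0"
  obtains \<Lambda> h where "\<Lambda> > 0" "h \<in> V" "ip h h > 0"
    "ip (lincomb 1 (T h) (- \<Lambda>) h) (lincomb 1 (T h) (- \<Lambda>) h) = 0"
    "\<And>v. v \<in> V \<Longrightarrow> ip (T v) v \<le> \<Lambda> * ip v v"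
proof -
  \<comment> \<open>Squared lengths of \<open>T v + v\<close> and \<open>T v - v\<close> are
    nonnegative, so twice the form is at most \<open>(C + 1) * ip v v\<close> in absolute
    value.\<close>
  define D where "D = (C + 1) / 2"
  have abs_le: "\<bar>ip (T v) v\<bar> \<le> D * ip v v" if v: "v \<in> V" for v
  proof -
    have "0 \<le> ip (T v) (T v) + 2 * ip (T v) v + ip v v"
      using ip_lincomb_self[OF T_mem[OF v] v, of 1 1] ip_nonneg[OF lincomb_mem[OF T_mem[OF v] v, of 1 1]] by simp
    moreover have "0 \<le> ip (T v) (T v) - 2 * ip (T v) v + ip v v"
      using ip_lincomb_self[OF T_mem[OF v] v, of 1 "-1"] ip_nonneg[OF lincomb_mem[OF T_mem[OF v] v, of 1 "-1"]] by simp
    moreover have "D * ip v v = (C * ip v v + ip v v) / 2" by (simp add: D_def field_simps)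
    ultimately show ?thesis using T_bdd[OF v] by (simp add: abs_le_iff)
  qed
  define S where "S = {ip (T v) v | v. v \<in> V \<and> ip v v = 1}"
  define \<Lambda> where "\<Lambda> = Sup S"
  have bdd: "bdd_above S" unfolding S_def proof (rule bdd_aboveI[of _ D])
    fix s assume "s \<in> {ip (T v) v |v. v \<in> V \<and> ip v v = 1}"
    then obtain v where "v \<in> V" "ip v v = 1" "s = ip (T v) v" by blast
    then show "s \<le> D" using abs_le[of v] by simp
  qed
  have scale: "ip (T (lincomb a v 0 v)) (lincomb a v 0 v) = a\<^sup>2 * ip (T v) v" "ip (lincomb a v 0 v) (lincomb a v 0 v) = a\<^sup>2 * ip v v"
    if v: "v \<in> V" for a v
  proof -
    show "ip (lincomb a v 0 v) (lincomb a v 0 v) = a\<^sup>2 * ip v v" using ip_lincomb_self[OF v v, of a 0] by simp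
    have m: "lincomb a v 0 v \<in> V" using v by (intro lincomb_mem)
    have "ip (T (lincomb a v 0 v)) (lincomb a v 0 v) = a * ip (T v) (lincomb a v 0 v)"
      unfolding T_lin[OF v v] using ip_lincomb[OF T_mem[OF v] T_mem[OF v] m, of a 0] by simp
    also have "ip (T v) (lincomb a v 0 v) = a * ip (T v) v"
      using ip_commute[OF T_mem[OF v] m] ip_lincomb[OF v v T_mem[OF v], of a 0] ip_commute[OF v T_mem[OF v]] by simp
    finally show "ip (T (lincomb a v 0 v)) (lincomb a v 0 v) = a\<^sup>2 * ip (T v) v" by (simp add: power2_eq_square)
  qed
  have le: "ip (T v) v \<le> \<Lambda> * ip v v" if v: "v \<in> V" for v
  proof (cases "ip v v = 0")
    case True
    then show ?thesis using abs_le[OF v] by simp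
  next
    case False
    then have pos: "ip v v > 0" using ip_nonneg[OF v] by simp
    let ?a = "1 / sqrt (ip v v)"
    have a2: "?a\<^sup>2 = 1 / ip v v" using pos by (simp add: power_divide)
    have "ip (T v) v / ip v v \<in> S"
      unfolding S_def using scale[OF v, of ?a] lincomb_mem[OF v v, of ?a 0] pos a2
      by (intro CollectI exI[of _ "lincomb ?a v 0 v"]) auto
    from cSup_upper[OF this bdd] show ?thesis using pos by (simp add: \<Lambda>_def divide_le_eq)
  qed
  have wpos: "ip w w > 0" using abs_le[OF w(1)] w ip_nonneg[OF w(1)] by (cases "ip w w = 0") auto
  have "0 < \<Lambda> * ip w w" using le[OF w(1)] w(2) by linarith
  then have \<Lambda>: "\<Lambda> > 0" using wpos by (simp add: zero_less_mult_iff)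
  have "S \<noteq> {}"
    using scale(2)[OF w(1), of "1 / sqrt (ip w w)"] lincomb_mem[OF w(1) w(1), of "1 / sqrt (ip w w)" 0] wpos
    unfolding S_def by (auto simp: power_divide)
  have "\<exists>v. v \<in> V \<and> ip v v = 1 \<and> ip (T v) v > \<Lambda> - inverse (real (Suc n))" for n
  proof -
    have "\<Lambda> - inverse (real (Suc n)) < Sup S" by (simp add: \<Lambda>_def)
    then obtain s where "s \<in> S" "\<Lambda> - inverse (real (Suc n)) < s" using less_cSup_iff[OF \<open>S \<noteq> {}\<close> bdd] by blast
    then show ?thesis by (auto simp: S_def)
  qed
  then have "\<exists>u. \<forall>n. u n \<in> V \<and> ip (u n) (u n) = 1 \<and> ip (T (u n)) (u n) > \<Lambda> - inverse (real (Suc n))"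
    by (intro choice allI)
  then obtain u where u: "\<And>n. u n \<in> V" "\<And>n. ip (u n) (u n) = 1" "\<And>n. ip (T (u n)) (u n) > \<Lambda> - inverse (real (Suc n))"
    by blast
  obtain r h where r: "strict_mono (r :: nat \<Rightarrow> nat)" and h: "h \<in> V"
    and conv: "(\<lambda>n. ip (lincomb 1 (T (u (r n))) (-1) h) (lincomb 1 (T (u (r n))) (-1) h)) \<longlonglongrightarrow> 0"
    using T_compact[of u, OF u(1) u(2)] by (elim exE conjE) (rule that)
  define K where "K = \<Lambda> + D"
  have "0 \<le> D * ip w w" using abs_le[OF w(1)] by linarith
  then have "D \<ge> 0" using wpos by (simp add: zero_le_mult_iff)
  then have K: "K > 0" using \<Lambda> by (simp add: K_def)
  let ?n = "\<lambda>f. ip f f"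
  let ?B = "\<lambda>v. lincomb \<Lambda> v (-1) (T v)"
  \<comment> \<open>\<open>\<Lambda> - T\<close> is a nonnegative form bounded by \<open>K\<close>.
    Testing it at \<open>v - s * b\<close>, with \<open>b\<close> the image of \<open>v\<close> and
    \<open>s = 1 / K\<close>, bounds the squared length of \<open>b\<close> by \<open>K\<close>
    times the form at \<open>v\<close>. Hence almost maximisers are almost eigenvectors.\<close>
  have B_le: "?n (?B v) \<le> K * (\<Lambda> * ip v v - ip (T v) v)" if v: "v \<in> V" for v
  proof -
    define b where "b = ?B v"
    have b: "b \<in> V" unfolding b_def using v T_mem by (intro lincomb_mem) auto
    define s where "s = 1 / K"
    define z where "z = lincomb 1 v (- s) b"
    have z: "z \<in> V" unfolding z_def using v b by (intro lincomb_mem) auto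
    have bv: "\<Lambda> * ip v b - ip (T v) b = ip b b"
      using ip_lincomb[OF v T_mem[OF v] b, of \<Lambda> "-1"] by (simp add: b_def)
    have Tz: "T z = lincomb 1 (T v) (- s) (T b)" unfolding z_def by (rule T_lin[OF v b])
    have "ip (T z) z = ip (T v) z - s * ip (T b) z"
      unfolding Tz using ip_lincomb[OF T_mem[OF v] T_mem[OF b] z, of 1 "- s"] by simp
    also have "ip (T v) z = ip (T v) v - s * ip (T v) b"
      using ip_commute[OF T_mem[OF v] z] ip_lincomb[OF v b T_mem[OF v], of 1 "- s"]
        ip_commute[OF v T_mem[OF v]] ip_commute[OF b T_mem[OF v]] by (simp add: z_def)
    also have "ip (T b) z = ip (T b) v - s * ip (T b) b"
      using ip_commute[OF T_mem[OF b] z] ip_lincomb[OF v b T_mem[OF b], of 1 "- s"]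
        ip_commute[OF v T_mem[OF b]] ip_commute[OF b T_mem[OF b]] by (simp add: z_def)
    also have "ip (T b) v = ip (T v) b" using T_sym[OF b v] ip_commute[OF b T_mem[OF v]] by simp
    finally have 1: "ip (T z) z = ip (T v) v - 2 * s * ip (T v) b + s\<^sup>2 * ip (T b) b"
      by (simp add: power2_eq_square algebra_simps)
    have 2: "ip z z = ip v v - 2 * s * ip v b + s\<^sup>2 * ip b b"
      unfolding z_def using ip_lincomb_self[OF v b, of 1 "- s"] by simp
    have "0 \<le> \<Lambda> * ip z z - ip (T z) z" using le[OF z] by simp
    also have "\<dots> = (\<Lambda> * ip v v - ip (T v) v) - 2 * s * (\<Lambda> * ip v b - ip (T v) b) + s\<^sup>2 * (\<Lambda> * ip b b - ip (T b) b)"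
      unfolding 1 2 by (simp add: algebra_simps)
    also have "\<dots> \<le> (\<Lambda> * ip v v - ip (T v) v) - 2 * s * ip b b + s\<^sup>2 * (K * ip b b)"
      unfolding bv using abs_le[OF b] by (intro add_mono mult_left_mono) (auto simp: K_def algebra_simps)
    also have "s\<^sup>2 * (K * ip b b) = s * ip b b" using K by (simp add: s_def power2_eq_square)
    finally have "s * ip b b \<le> \<Lambda> * ip v v - ip (T v) v" by simp
    then show ?thesis using K by (simp add: s_def b_def field_simps)
  qed
  let ?u = "\<lambda>n. u (r n)"
  have um: "?u n \<in> V" "T (?u n) \<in> V" "lincomb \<Lambda> (?u n) 0 (?u n) \<in> V" "lincomb \<Lambda> (T (?u n)) 0 (T (?u n)) \<in> V" for n
    by (fact u(1) T_mem[OF u(1)] lincomb_mem[OF u(1) u(1)] lincomb_mem[OF T_mem[OF u(1)] T_mem[OF u(1)]])+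
  have hm: "T h \<in> V" "lincomb \<Lambda> h 0 h \<in> V" 
    by (fact T_mem[OF h] lincomb_mem[OF h h])+
  have lim1: "(\<lambda>n. ?n (?B (?u n))) \<longlonglongrightarrow> 0"
  proof (rule tendsto_sandwich[OF _ _ tendsto_const])
    show "\<forall>\<^sub>F n in sequentially. 0 \<le> ?n (?B (?u n))" by (intro always_eventually allI ip_nonneg lincomb_mem[OF um(1,2)])
    show "\<forall>\<^sub>F n in sequentially. ?n (?B (?u n)) \<le> K * inverse (real (Suc n))"
    proof (rule always_eventually, rule allI)
      fix n
      have "?n (?B (?u n)) \<le> K * (\<Lambda> - ip (T (?u n)) (?u n))" using B_le[OF um(1)[of n]] u(2) by simp
      also have "\<dots> \<le> K * inverse (real (Suc (r n)))" using u(3)[of "r n"] K by (intro mult_left_mono) auto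
      also have "\<dots> \<le> K * inverse (real (Suc n))"
        using seq_suble[OF r, of n] K by (intro mult_left_mono) (auto intro!: le_imp_inverse_le)
      finally show "?n (?B (?u n)) \<le> K * inverse (real (Suc n))" .
    qed
    show "(\<lambda>n. K * inverse (real (Suc n))) \<longlonglongrightarrow> 0"
      using tendsto_mult[OF tendsto_const LIMSEQ_inverse_real_of_nat, of K] by simp
  qed
  \<comment> \<open>Both \<open>\<Lambda> * u - T u\<close> and \<open>T u - h\<close> become small,
    so \<open>\<Lambda> * u\<close> itself converges to \<open>h\<close>.\<close>
  define d where "d n = ?n (lincomb 1 (lincomb \<Lambda> (?u n) 0 (?u n)) (-1) h)" for n
  have lim2: "d \<longlonglongrightarrow> 0"
  proof (rule tendsto_sandwich[OF _ _ tendsto_const])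
    show "\<forall>\<^sub>F n in sequentially. 0 \<le> d n" unfolding d_def by (intro always_eventually allI ip_nonneg lincomb_mem[OF um(3) h])
    show "\<forall>\<^sub>F n in sequentially. d n \<le> 2 * ?n (?B (?u n)) + 2 * ?n (lincomb 1 (T (?u n)) (-1) h)"
    proof (rule always_eventually, rule allI)
      fix n
      have e: "lincomb 1 (lincomb \<Lambda> (?u n) 0 (?u n)) (-1) (T (?u n)) = ?B (?u n)" by auto
      show "d n \<le> 2 * ?n (?B (?u n)) + 2 * ?n (lincomb 1 (T (?u n)) (-1) h)"
        using ip_lincomb_triangle[OF um(3)[of n] um(2)[of n] h] unfolding d_def e .
    qed
    show "(\<lambda>n. 2 * ?n (?B (?u n)) + 2 * ?n (lincomb 1 (T (?u n)) (-1) h)) \<longlonglongrightarrow> 0"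
      using tendsto_add[OF tendsto_mult[OF tendsto_const lim1, of 2] tendsto_mult[OF tendsto_const conv, of 2]] by simp
  qed
  \<comment> \<open>\<open>T h - \<Lambda> * h\<close> is compared with
    \<open>\<Lambda> * T u\<close>: the first error is the image under \<open>T\<close> of
    \<open>h - \<Lambda> * u\<close>, the second is \<open>\<Lambda>\<close> times
    \<open>T u - h\<close>.\<close>
  have Th: "?n (lincomb 1 (T h) (-1) (lincomb \<Lambda> h 0 h)) \<le> 2 * (C * d n) + 2 * (\<Lambda>\<^sup>2 * ?n (lincomb 1 (T (?u n)) (-1) h))" for n
  proof -
    have "?n (lincomb 1 (T h) (-1) (lincomb \<Lambda> h 0 h))
      \<le> 2 * ?n (lincomb 1 (T h) (-1) (lincomb \<Lambda> (T (?u n)) 0 (T (?u n)))) + 2 * ?n (lincomb 1 (lincomb \<Lambda> (T (?u n)) 0 (T (?u n))) (-1) (lincomb \<Lambda> h 0 h))"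
      by (rule ip_lincomb_triangle[OF hm(1) um(4) hm(2)])
    also have "?n (lincomb 1 (T h) (-1) (lincomb \<Lambda> (T (?u n)) 0 (T (?u n)))) \<le> C * d n"
    proof -
      let ?z = "lincomb 1 (lincomb \<Lambda> (?u n) 0 (?u n)) (-1) h"
      have z: "?z \<in> V" by (rule lincomb_mem[OF um(3) h])
      have "T ?z = lincomb 1 (T (lincomb \<Lambda> (?u n) 0 (?u n))) (-1) (T h)" by (rule T_lin[OF um(3) h])
      also have "T (lincomb \<Lambda> (?u n) 0 (?u n)) = lincomb \<Lambda> (T (?u n)) 0 (T (?u n))" by (rule T_lin[OF um(1,1)])
      finally have Tz: "T ?z = lincomb 1 (lincomb \<Lambda> (T (?u n)) 0 (T (?u n))) (-1) (T h)" .
      have eq: "lincomb 1 (T h) (-1) (lincomb \<Lambda> (T (?u n)) 0 (T (?u n))) = lincomb (-1) (T ?z) 0 (T ?z)"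
        unfolding Tz by auto
      have "?n (lincomb 1 (T h) (-1) (lincomb \<Lambda> (T (?u n)) 0 (T (?u n)))) = ?n (T ?z)"
        unfolding eq scale(2)[OF T_mem[OF z]] by simp
      also have "\<dots> \<le> C * d n" unfolding d_def by (rule T_bdd[OF z])
      finally show ?thesis .
    qed
    also have "?n (lincomb 1 (lincomb \<Lambda> (T (?u n)) 0 (T (?u n))) (-1) (lincomb \<Lambda> h 0 h)) = \<Lambda>\<^sup>2 * ?n (lincomb 1 (T (?u n)) (-1) h)"
    proof -
      let ?z = "lincomb 1 (T (?u n)) (-1) h"
      have z: "?z \<in> V" by (rule lincomb_mem[OF um(2) h])
      have eq: "lincomb 1 (lincomb \<Lambda> (T (?u n)) 0 (T (?u n))) (-1) (lincomb \<Lambda> h 0 h) = lincomb \<Lambda> ?z 0 ?z"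
        by (auto simp: algebra_simps)
      show ?thesis unfolding eq by (rule scale(2)[OF z])
    qed
    finally show ?thesis by simp
  qed
  have "?n (lincomb 1 (T h) (-1) (lincomb \<Lambda> h 0 h)) \<le> 0"
  proof (rule LIMSEQ_le_const)
    show "(\<lambda>n. 2 * (C * d n) + 2 * (\<Lambda>\<^sup>2 * ?n (lincomb 1 (T (?u n)) (-1) h))) \<longlonglongrightarrow> 0"
      using tendsto_add[OF tendsto_mult[OF tendsto_const tendsto_mult[OF tendsto_const lim2]] 
        tendsto_mult[OF tendsto_const tendsto_mult[OF tendsto_const conv]], of 2 C 2 "\<Lambda>\<^sup>2"] by simp
  qed (use Th in auto)
  moreover have "lincomb 1 (T h) (-1) (lincomb \<Lambda> h 0 h) = lincomb 1 (T h) (- \<Lambda>) h" by auto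
  moreover have "0 \<le> ?n (lincomb 1 (T h) (- \<Lambda>) h)" by (intro ip_nonneg lincomb_mem[OF hm(1) h])
  ultimately have eig: "?n (lincomb 1 (T h) (- \<Lambda>) h) = 0" by (metis order_antisym)
  \<comment> \<open>The limit cannot be null: \<open>\<Lambda> * u\<close> has squared length
    \<open>\<Lambda>\<^sup>2\<close> and converges to \<open>h\<close>. The factor 2 comes from
    \<open>ip_lincomb_triangle\<close> with zero as third vector.\<close>
  have "\<Lambda>\<^sup>2 \<le> 2 * ip h h"
  proof (rule LIMSEQ_le_const)
    show "(\<lambda>n. 2 * d n + 2 * ip h h) \<longlonglongrightarrow> 2 * ip h h"
      using tendsto_add[OF tendsto_mult[OF tendsto_const lim2] tendsto_const, of 2 "2 * ip h h"] by simp
    have "\<Lambda>\<^sup>2 \<le> 2 * d n + 2 * ip h h" for n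
    proof -
      let ?o = "lincomb 0 h 0 h"
      have o: "?o \<in> V" using h by (intro lincomb_mem)
      have "lincomb 1 (lincomb \<Lambda> (?u n) 0 (?u n)) (-1) ?o = lincomb \<Lambda> (?u n) 0 (?u n)" "lincomb 1 h (-1) ?o = h" by auto
      then show ?thesis
        using ip_lincomb_triangle[OF um(3) h o, of n] scale(2)[OF um(1), of \<Lambda> n] u(2)[of "r n"]
        by (simp add: d_def)
    qed
    then show "\<exists>N. \<forall>n\<ge>N. \<Lambda>\<^sup>2 \<le> 2 * d n + 2 * ip h h" by blast
  qed
  moreover have "\<Lambda>\<^sup>2 > 0" using \<Lambda> by simp
  ultimately have "ip h h > 0" by linarith
  from that[OF \<Lambda> h this eig le] show ?thesis .
qed

end

text \<open>Arzela-Ascoli for a common Lipschitz constant, in the form in which integral operators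
  with smooth kernels deliver it.\<close>

lemma Lipschitz_sequence_subconvergent:
  fixes u :: "nat \<Rightarrow> real \<Rightarrow> complex"
  assumes S: "compact S"
    and bd: "\<And>n x. x \<in> S \<Longrightarrow> norm (u n x) \<le> B"
    and lip: "\<And>n x y. x \<in> S \<Longrightarrow> y \<in> S \<Longrightarrow> norm (u n x - u n y) \<le> B * \<bar>x - y\<bar>"
  obtains r h where "strict_mono (r :: nat \<Rightarrow> nat)" "continuous_on S h"
    "\<And>e. e > 0 \<Longrightarrow> \<exists>N. \<forall>n x. n \<ge> N \<and> x \<in> S \<longrightarrow> norm (u (r n) x - h x) < e"
proof -
  have eq: "\<exists>d. 0 < d \<and> (\<forall>n y. y \<in> S \<and> norm (x - y) < d \<longrightarrow> norm (u n x - u n y) < e)"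
    if x: "x \<in> S" and e: "0 < e" for x e
  proof (intro exI[of _ "e / (\<bar>B\<bar> + 1)"] conjI allI impI)
    show "0 < e / (\<bar>B\<bar> + 1)" using e by simp
    fix n y assume y: "y \<in> S \<and> norm (x - y) < e / (\<bar>B\<bar> + 1)"
    have "norm (u n x - u n y) \<le> B * \<bar>x - y\<bar>" using lip x y by blast
    also have "\<dots> \<le> (\<bar>B\<bar> + 1) * \<bar>x - y\<bar>" by (intro mult_right_mono) auto
    also have "\<dots> < e" using y by (simp add: field_simps)
    finally show "norm (u n x - u n y) < e" .
  qed
  show ?thesis
    by (rule Arzela_Ascoli[OF S bd eq]) (use that in blast)+
qed

section \<open>The weighted measure and Green's identity\<close>

text \<open>Restricting the space to \<open>I\<close> means that functions need to be measurable on
  \<open>I\<close> only, in agreement with \<open>L2w\<close>; putting the weight into the measure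
  turns weighted integrals into plain ones.\<close>

definition weighted_measure :: "real \<Rightarrow> real measure" where
  "weighted_measure \<alpha> = density (restrict_space lborel I) (\<lambda>x. ennreal (\<omega> \<alpha> x))"

lemma omega_measurable [measurable]: "\<omega> \<alpha> \<in> borel_measurable borel"
  unfolding \<omega>_def by measurable

lemma omega_nonneg [simp]: "0 \<le> \<omega> \<alpha> x"
  by (simp add: \<omega>_def)

lemma omega_pos: "x \<in> {-1<..<1} \<Longrightarrow> 0 < \<omega> \<alpha> x"
proof -
  assume "x \<in> {-1<..<1}"
  then have "x\<^sup>2 < 1" by (simp add: abs_square_less_1 abs_less_iff)
  then show ?thesis by (simp add: \<omega>_def)
qed

lemma omega_mult_neg: "x \<in> {-1<..<1} \<Longrightarrow> \<omega> \<alpha> x * \<omega> (- \<alpha>) x = 1"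
  using omega_pos[of x \<alpha>] by (simp add: \<omega>_def powr_minus)

locale prolate =
  fixes c \<alpha> :: real
  assumes c_pos: "c > 0" and alpha_nonneg: "\<alpha> \<ge> 0"
begin

abbreviation M :: "real measure" where "M \<equiv> weighted_measure \<alpha>"

lemma omega_le_1: "x \<in> I \<Longrightarrow> \<omega> \<alpha> x \<le> 1"
  unfolding \<omega>_def using alpha_nonneg by (intro powr_le1) (auto simp: abs_square_le_1 abs_le_iff)

lemma sets_M: "sets M = sets (restrict_space borel I)"
  by (simp add: weighted_measure_def cong: sets_restrict_space_cong)

lemma space_M [simp]: "space M = I"
  by (simp add: weighted_measure_def space_restrict_space)

lemma measurable_M_iff: "f \<in> borel_measurable M \<longleftrightarrow> f \<in> borel_measurable (restrict_space lborel I)"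
  by (simp add: weighted_measure_def)

lemma omega_measurable_M: "\<omega> \<alpha> \<in> borel_measurable (restrict_space lborel I)"
  by (rule measurable_restrict_space1) simp

lemma measurable_M_borel: "f \<in> borel_measurable borel \<Longrightarrow> f \<in> borel_measurable M"
  unfolding measurable_M_iff by (rule measurable_restrict_space1) simp

lemma measurable_M_continuous:
  fixes f :: "real \<Rightarrow> 'a::topological_space"
  assumes "continuous_on I f" shows "f \<in> borel_measurable M"
  using borel_measurable_continuous_on_restrict[OF assms] by (simp cong: measurable_cong_sets add: sets_M)

lemma set_borel_measurable_iff_M:
  fixes f :: "real \<Rightarrow> 'a::real_normed_vector"
  shows "set_borel_measurable lborel I f \<longleftrightarrow> f \<in> borel_measurable M"
  unfolding set_borel_measurable_def measurable_M_iff by (subst borel_measurable_restrict_space_iff) auto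

lemma integral_M:
  fixes f :: "real \<Rightarrow> 'a::{banach, second_countable_topology}"
  assumes "f \<in> borel_measurable M"
  shows "integral\<^sup>L M f = (LINT x:I|lborel. \<omega> \<alpha> x *\<^sub>R f x)"
  using assms unfolding set_lebesgue_integral_def measurable_M_iff weighted_measure_def
  by (subst integral_density) (auto simp: integral_restrict_space omega_measurable_M)

lemma integrable_M:
  fixes f :: "real \<Rightarrow> 'a::{banach, second_countable_topology}"
  assumes "f \<in> borel_measurable M"
  shows "integrable M f \<longleftrightarrow> set_integrable lborel I (\<lambda>x. \<omega> \<alpha> x *\<^sub>R f x)"
  using assms unfolding set_integrable_def measurable_M_iff weighted_measure_def
  by (subst integrable_density) (auto simp: integrable_restrict_space omega_measurable_M)

text \<open>The weight is positive in the open interval and the endpoints are null, so both measures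
  have the same null sets in \<open>I\<close>. At the endpoints the weight is 0 even for
  \<open>\<alpha> = 0\<close>, since \<open>0 powr 0 = 0\<close>.\<close>

lemma AE_M: "(AE x in M. P x) \<longleftrightarrow> (AE x in lborel. x \<in> I \<longrightarrow> P x)"
proof -
  have "AE x in lborel. x \<noteq> (-1::real)" "AE x in lborel. x \<noteq> (1::real)"
    by (rule AE_lborel_singleton)+
  then have n: "AE x::real in lborel. x \<in> I \<longrightarrow> 0 < \<omega> \<alpha> x"
    by eventually_elim (auto intro!: omega_pos)
  have "(AE x in M. P x) \<longleftrightarrow> (AE x in lborel. x \<in> I \<longrightarrow> (0 < ennreal (\<omega> \<alpha> x) \<longrightarrow> P x))"
    unfolding weighted_measure_def
    by (subst AE_density) (auto simp: omega_measurable_M AE_restrict_space_iff)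
  also have "\<dots> \<longleftrightarrow> (AE x in lborel. x \<in> I \<longrightarrow> P x)"
  proof
    assume "AE x in lborel. x \<in> I \<longrightarrow> 0 < ennreal (\<omega> \<alpha> x) \<longrightarrow> P x"
    with n show "AE x in lborel. x \<in> I \<longrightarrow> P x" by eventually_elim simp
  next
    assume "AE x in lborel. x \<in> I \<longrightarrow> P x"
    then show "AE x in lborel. x \<in> I \<longrightarrow> 0 < ennreal (\<omega> \<alpha> x) \<longrightarrow> P x" by eventually_elim simp
  qed
  finally show ?thesis .
qed

lemma finite_M: "finite_measure M"
proof (rule finite_measureI)
  have "emeasure M (space M) = (\<integral>\<^sup>+x. ennreal (\<omega> \<alpha> x) * indicator I x \<partial>restrict_space lborel I)"
    unfolding weighted_measure_def
    by (subst emeasure_density) (auto simp: omega_measurable_M space_restrict_space sets_restrict_space)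
  also have "\<dots> \<le> (\<integral>\<^sup>+x. 1 \<partial>restrict_space lborel I)"
    by (rule nn_integral_mono) (auto simp: space_restrict_space indicator_def omega_le_1)
  also have "\<dots> = emeasure lborel I"
    by (simp add: emeasure_restrict_space space_restrict_space)
  also have "\<dots> < \<infinity>" by (simp add: emeasure_lborel_Icc_eq)
  finally show "emeasure M (space M) \<noteq> \<infinity>" by simp
qed

sublocale M: finite_measure M by (rule finite_M)

lemma integrable_M_bounded:
  fixes f :: "real \<Rightarrow> 'a::{banach, second_countable_topology}"
  assumes "f \<in> borel_measurable M" "\<And>x. x \<in> I \<Longrightarrow> norm (f x) \<le> B"
  shows "integrable M f"
  using assms by (intro M.integrable_const_bound[of _ B]) auto

lemma integrable_M_continuous:
  fixes f :: "real \<Rightarrow> 'a::{banach, second_countable_topology}"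
  assumes "continuous_on I f"
  shows "integrable M f"
proof -
  have "compact (f ` I)" using assms by (intro compact_continuous_image) auto
  then have "bounded (f ` I)" by (rule compact_imp_bounded)
  then obtain B where "\<forall>y\<in>f ` I. norm y \<le> B" unfolding bounded_iff ..
  then have "norm (f x) \<le> B" if "x \<in> I" for x using that by (rule bspec[OF _ imageI])
  then show ?thesis using measurable_M_continuous[OF assms] by (intro integrable_M_bounded) auto
qed

lemma measure_M_pos: "0 < measure M I"
proof -
  have "measure M I \<noteq> 0"
  proof
    assume "measure M I = 0"
    then have "emeasure M (space M) = 0" by (simp add: M.emeasure_eq_measure)
    then have "AE x in M. False" by (intro AE_I[of _ _ "space M"] sets.top) auto
    then have "AE x in lborel. (x::real) \<notin> I" unfolding AE_M by simp
    then have "emeasure lborel (I::real set) = 0" by (subst (asm) AE_iff_measurable[where N=I]) auto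
    then show False by (simp add: emeasure_lborel_Icc_eq)
  qed
  then show ?thesis using measure_nonneg[of M I] by linarith
qed

lemma integral_M_reflect:
  fixes f :: "real \<Rightarrow> 'a::{banach, second_countable_topology}"
  assumes "continuous_on I f" "continuous_on I (\<lambda>x. f (- x))"
  shows "(\<integral>x. f (- x) \<partial>M) = (\<integral>x. f x \<partial>M)"
proof -
  have "(\<integral>x. f x \<partial>M) = (\<integral>x. indicator I x *\<^sub>R (\<omega> \<alpha> x *\<^sub>R f x) \<partial>lborel)"
    using integral_M[OF measurable_M_continuous[OF assms(1)]] by (simp add: set_lebesgue_integral_def)
  also have "\<dots> = (\<integral>x. indicator I (- x) *\<^sub>R (\<omega> \<alpha> (- x) *\<^sub>R f (- x)) \<partial>lborel)"
    using lborel_integral_real_affine[of "-1" "\<lambda>x. indicator I x *\<^sub>R (\<omega> \<alpha> x *\<^sub>R f x)" 0] by simp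
  also have "\<dots> = (\<integral>x. indicator I x *\<^sub>R (\<omega> \<alpha> x *\<^sub>R f (- x)) \<partial>lborel)"
    by (rule Bochner_Integration.integral_cong) (auto simp: indicator_def \<omega>_def)
  also have "\<dots> = (\<integral>x. f (- x) \<partial>M)"
    using integral_M[OF measurable_M_continuous[OF assms(2)]] by (simp add: set_lebesgue_integral_def)
  finally show ?thesis ..
qed

text \<open>Real functions are enough for the spectral theory, because the kernel of
  \<open>Q\<close> is real and acts separately on real and imaginary parts.\<close>

definition HS :: "(real \<Rightarrow> real) set" where
  "HS = {v. v \<in> borel_measurable M \<and> integrable M (\<lambda>x. (v x)\<^sup>2)}"

definition ip :: "(real \<Rightarrow> real) \<Rightarrow> (real \<Rightarrow> real) \<Rightarrow> real" where
  "ip u v = (\<integral>x. u x * v x \<partial>M)"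

lemma HS_integrable_mult: "u \<in> HS \<Longrightarrow> v \<in> HS \<Longrightarrow> integrable M (\<lambda>x. u x * v x)"
proof -
  assume u: "u \<in> HS" and v: "v \<in> HS"
  then have [measurable]: "u \<in> borel_measurable M" "v \<in> borel_measurable M" by (auto simp: HS_def)
  show ?thesis
  proof (rule Bochner_Integration.integrable_bound[of _ "\<lambda>x. (u x)\<^sup>2 + (v x)\<^sup>2"])
    show "AE x in M. norm (u x * v x) \<le> norm ((u x)\<^sup>2 + (v x)\<^sup>2)"
    proof (rule AE_I2)
      fix x
      have "2 * \<bar>u x\<bar> * \<bar>v x\<bar> \<le> \<bar>u x\<bar>\<^sup>2 + \<bar>v x\<bar>\<^sup>2" by (rule sum_squares_bound)
      moreover have "0 \<le> \<bar>u x\<bar> * \<bar>v x\<bar>" by simp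
      ultimately have "\<bar>u x\<bar> * \<bar>v x\<bar> \<le> (u x)\<^sup>2 + (v x)\<^sup>2" unfolding power2_abs by linarith
      then show "norm (u x * v x) \<le> norm ((u x)\<^sup>2 + (v x)\<^sup>2)" by (simp add: abs_mult)
    qed
  qed (use u v in \<open>auto simp: HS_def\<close>)
qed

lemma HS_lincomb: "u \<in> HS \<Longrightarrow> v \<in> HS \<Longrightarrow> lincomb a u b v \<in> HS"
proof -
  assume u: "u \<in> HS" and v: "v \<in> HS"
  have e: "(\<lambda>x. (a * u x + b * v x)\<^sup>2) = (\<lambda>x. a\<^sup>2 * (u x)\<^sup>2 + 2 * a * b * (u x * v x) + b\<^sup>2 * (v x)\<^sup>2)"
    by (auto simp: power2_eq_square algebra_simps)
  show ?thesis
    using u v HS_integrable_mult[OF u v] unfolding HS_def mem_Collect_eq e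
    by (auto intro!: Bochner_Integration.integrable_add integrable_mult_right)
qed

lemma HS_continuous: "continuous_on I v \<Longrightarrow> v \<in> HS"
  unfolding HS_def by (auto intro!: measurable_M_continuous integrable_M_continuous continuous_intros)

lemma HS_integrable: "v \<in> HS \<Longrightarrow> integrable M v"
  using HS_integrable_mult[of v "\<lambda>_. 1"] HS_continuous[of "\<lambda>_. 1"] by simp

sublocale HS: semi_inner_space HS ip
proof
  fix f g h a b assume "f \<in> HS" "g \<in> HS" "h \<in> HS"
  then show "ip (lincomb a f b g) h = a * ip f h + b * ip g h"
    unfolding ip_def by (simp add: distrib_right mult.assoc HS_integrable_mult)
qed (auto simp: HS_lincomb ip_def mult.commute)

text \<open>Cauchy-Schwarz against the constant 1, from the integral of the square of
  \<open>m * \<bar>v\<bar> - s\<close>, where \<open>m\<close> is the total mass and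
  \<open>s\<close> the L1 norm.\<close>

lemma HS_L1_le:
  assumes v: "v \<in> HS"
  shows "(\<integral>x. \<bar>v x\<bar> \<partial>M)\<^sup>2 \<le> measure M I * ip v v"
proof -
  let ?m = "measure M I" and ?s = "\<integral>x. \<bar>v x\<bar> \<partial>M"
  have i1: "integrable M (\<lambda>x. \<bar>v x\<bar>)" using HS_integrable[OF v] by simp
  have i2: "integrable M (\<lambda>x. (v x)\<^sup>2)" using v by (simp add: HS_def)
  have "0 \<le> (\<integral>x. (?m * \<bar>v x\<bar> - ?s)\<^sup>2 \<partial>M)" by simp
  also have "\<dots> = (\<integral>x. ?m\<^sup>2 * (v x)\<^sup>2 - 2 * ?m * ?s * \<bar>v x\<bar> + ?s\<^sup>2 \<partial>M)"
    by (rule Bochner_Integration.integral_cong) (auto simp: power2_diff power_mult_distrib algebra_simps)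
  also have "\<dots> = ?m\<^sup>2 * ip v v - 2 * ?m * ?s * ?s + ?s\<^sup>2 * ?m"
    using i1 i2 unfolding ip_def power2_eq_square[symmetric]
    by (subst Bochner_Integration.integral_add; (subst Bochner_Integration.integral_diff)?) (auto simp: mult.commute)
  also have "\<dots> = ?m * (?m * ip v v - ?s\<^sup>2)" by (simp add: power2_eq_square algebra_simps)
  finally show ?thesis using measure_M_pos by (simp add: zero_le_mult_iff)
qed

text \<open>Since \<open>B\<close> bounds \<open>p1\<close> for every real \<open>x\<close>, the
  mean value inequality dominates all difference quotients by \<open>B * \<bar>v y\<bar>\<close>.
  Every derivative of an integral against \<open>M\<close> below is an instance.\<close>

lemma deriv_integral_M:
  fixes p p1 :: "real \<Rightarrow> real \<Rightarrow> real"
  assumes d: "\<And>x y. ((\<lambda>x. p x y) has_real_derivative p1 x y) (at x)"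
    and B: "\<And>x y. y \<in> I \<Longrightarrow> \<bar>p x y\<bar> \<le> B" "\<And>x y. y \<in> I \<Longrightarrow> \<bar>p1 x y\<bar> \<le> B"
    and m: "\<And>x. continuous_on I (p x)" "\<And>x. continuous_on I (p1 x)"
    and v: "integrable M v"
  shows "((\<lambda>x. \<integral>y. p x y * v y \<partial>M) has_real_derivative (\<integral>y. p1 x y * v y \<partial>M)) (at x)"
proof -
  have mp[measurable]: "p x \<in> borel_measurable M" "p1 x \<in> borel_measurable M" "v \<in> borel_measurable M" for x
    using m v by (auto intro: measurable_M_continuous)
  have ip: "integrable M (\<lambda>y. p x y * v y)" for x
    by (rule Bochner_Integration.integrable_bound[of _ "\<lambda>y. B * \<bar>v y\<bar>"])
       (use v B in \<open>auto simp: abs_mult intro!: AE_I2 mult_right_mono order_trans[OF B(1)]\<close>)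
  show ?thesis
    unfolding has_field_derivative_iff tendsto_at_iff_sequentially
  proof safe
    fix X :: "nat \<Rightarrow> real" assume X: "\<forall>i. X i \<in> UNIV - {x}" "X \<longlonglongrightarrow> x"
    have lim: "(\<lambda>i. \<integral>y. (p (X i) y - p x y) / (X i - x) * v y \<partial>M) \<longlonglongrightarrow> (\<integral>y. p1 x y * v y \<partial>M)"
    proof (rule integral_dominated_convergence[where w="\<lambda>y. B * \<bar>v y\<bar>"])
      show "AE y in M. (\<lambda>i. (p (X i) y - p x y) / (X i - x) * v y) \<longlonglongrightarrow> p1 x y * v y"
      proof (rule AE_I2)
        fix y
        have "((\<lambda>z. (p z y - p x y) / (z - x)) \<longlongrightarrow> p1 x y) (at x)"
          using d[of y x] by (simp add: has_field_derivative_iff)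
        then have "(\<lambda>i. (p (X i) y - p x y) / (X i - x)) \<longlonglongrightarrow> p1 x y"
          using X unfolding tendsto_at_iff_sequentially by (auto simp: o_def)
        then show "(\<lambda>i. (p (X i) y - p x y) / (X i - x) * v y) \<longlonglongrightarrow> p1 x y * v y" by (intro tendsto_intros)
      qed
      show "AE y in M. norm ((p (X i) y - p x y) / (X i - x) * v y) \<le> B * \<bar>v y\<bar>" for i
      proof (rule AE_I2)
        fix y assume "y \<in> space M"
        then have y: "y \<in> I" by simp
        have "norm (p (X i) y - p x y) \<le> B * norm (X i - x)"
          by (rule field_differentiable_bound[of UNIV _ "\<lambda>x. p1 x y"]) (use d B(2)[OF y] in auto)
        then have "\<bar>(p (X i) y - p x y) / (X i - x)\<bar> \<le> B"
          using X(1) by (simp add: divide_le_eq)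
        then show "norm ((p (X i) y - p x y) / (X i - x) * v y) \<le> B * \<bar>v y\<bar>"
          unfolding real_norm_def abs_mult[of _ "v y"] by (rule mult_right_mono) simp
      qed
    qed (use v in auto)
    have eq: "((\<integral>y. p (X i) y * v y \<partial>M) - (\<integral>y. p x y * v y \<partial>M)) / (X i - x)
      = (\<integral>y. (p (X i) y - p x y) / (X i - x) * v y \<partial>M)" for i
    proof -
      have "(\<integral>y. (p (X i) y - p x y) / (X i - x) * v y \<partial>M) = (\<integral>y. (p (X i) y * v y - p x y * v y) / (X i - x) \<partial>M)"
        by (rule Bochner_Integration.integral_cong) (auto simp: algebra_simps)
      also have "\<dots> = (\<integral>y. p (X i) y * v y - p x y * v y \<partial>M) / (X i - x)" by simp
      also have "\<dots> = ((\<integral>y. p (X i) y * v y \<partial>M) - (\<integral>y. p x y * v y \<partial>M)) / (X i - x)"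
        unfolding Bochner_Integration.integral_diff[OF ip ip] ..
      finally show ?thesis ..
    qed
    show "((\<lambda>z. ((\<integral>y. p z y * v y \<partial>M) - (\<integral>y. p x y * v y \<partial>M)) / (z - x)) \<circ> X) \<longlonglongrightarrow> (\<integral>y. p1 x y * v y \<partial>M)"
      unfolding o_def eq by (rule lim)
  qed
qed

text \<open>The integrand is the derivative of \<open>(1 - x\<^sup>2)\<^bsup>\<alpha>+1\<^esup> w\<close> divided by the weight.\<close>

lemma integral_weighted_derivative_zero:
  fixes w w1 :: "real \<Rightarrow> real"
  assumes d: "\<And>x. x \<in> I \<Longrightarrow> (w has_real_derivative w1 x) (at x within I)" and c1: "continuous_on I w1"
  shows "(\<integral>x. (1 - x\<^sup>2) * w1 x - (2 * \<alpha> + 2) * x * w x \<partial>M) = 0"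
proof -
  have cw: "continuous_on I w"
    using d by (meson DERIV_continuous continuous_on_eq_continuous_within)
  let ?g = "\<lambda>x. (1 - x\<^sup>2) * w1 x - (2 * \<alpha> + 2) * x * w x"
  have cg: "continuous_on I ?g" using cw c1 by (intro continuous_intros)
  let ?P = "\<lambda>x. (1 - x\<^sup>2) powr (\<alpha> + 1) * w x"
  have "((\<lambda>x. \<omega> \<alpha> x *\<^sub>R ?g x) has_integral (?P 1 - ?P (-1))) I"
  \<comment> \<open>The power is differentiated where its base is positive, that is, in the
    interior; at the endpoints continuity suffices, and the boundary values vanish because
    \<open>\<alpha> + 1 > 0\<close>.\<close>
  proof (rule fundamental_theorem_of_calculus_interior)
    show "continuous_on I ?P"
      using cw alpha_nonneg by (intro continuous_intros continuous_on_powr') (auto simp: abs_square_le_1 abs_le_iff)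
    fix x :: real assume x: "x \<in> {-1<..<1}"
    then have p: "1 - x\<^sup>2 > 0" by (simp add: abs_square_less_1 abs_less_iff)
    have "(w has_real_derivative w1 x) (at x)"
      using d[of x] x by (simp add: at_within_Icc_at)
    moreover have "((\<lambda>x. (1 - x\<^sup>2) powr (\<alpha> + 1)) has_real_derivative ((\<alpha> + 1) * (1 - x\<^sup>2) powr \<alpha> * (- 2 * x))) (at x)"
      using p by (auto intro!: derivative_eq_intros simp: powr_diff field_simps)
    ultimately have "(?P has_real_derivative ((\<alpha> + 1) * (1 - x\<^sup>2) powr \<alpha> * (- 2 * x) * w x + w1 x * (1 - x\<^sup>2) powr (\<alpha> + 1))) (at x)"
      by (intro DERIV_mult)
    also have "((\<alpha> + 1) * (1 - x\<^sup>2) powr \<alpha> * (- 2 * x) * w x + w1 x * (1 - x\<^sup>2) powr (\<alpha> + 1)) = \<omega> \<alpha> x *\<^sub>R ?g x"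
      using p by (simp add: \<omega>_def powr_add algebra_simps)
    finally show "(?P has_vector_derivative \<omega> \<alpha> x *\<^sub>R ?g x) (at x)"
      by (simp add: has_real_derivative_iff_has_vector_derivative)
  qed simp
  moreover have "?P 1 - ?P (-1) = 0" using alpha_nonneg by simp
  ultimately have hi: "((\<lambda>x. \<omega> \<alpha> x *\<^sub>R ?g x) has_integral 0) I" by simp
  have "set_integrable lborel I (\<lambda>x. \<omega> \<alpha> x *\<^sub>R ?g x)"
    using integrable_M_continuous[OF cg] integrable_M[OF measurable_M_continuous[OF cg]] by simp
  from set_borel_integral_eq_integral(2)[OF this] hi
  show ?thesis unfolding integral_M[OF measurable_M_continuous[OF cg]] by (simp add: integral_unique)
qed

text \<open>Derivatives are carried as explicit functions, which keeps \<open>deriv_I\<close> out of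
  the computations. The next lemmas on \<open>C2_on_I\<close> translate in both directions.\<close>

definition C2_data :: "(real \<Rightarrow> real) \<Rightarrow> (real \<Rightarrow> real) \<Rightarrow> (real \<Rightarrow> real) \<Rightarrow> bool" where
  "C2_data u u1 u2 \<longleftrightarrow> (\<forall>x\<in>I. (u has_real_derivative u1 x) (at x within I)) \<and>
     (\<forall>x\<in>I. (u1 has_real_derivative u2 x) (at x within I)) \<and> continuous_on I u2"

definition L_data :: "(real \<Rightarrow> real) \<Rightarrow> (real \<Rightarrow> real) \<Rightarrow> (real \<Rightarrow> real) \<Rightarrow> real \<Rightarrow> real" where
  "L_data u u1 u2 x = (1 - x\<^sup>2) * u2 x - (2 * \<alpha> + 2) * x * u1 x - c\<^sup>2 * x\<^sup>2 * u x"

lemma C2_data_continuous: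
  assumes "C2_data u u1 u2"
  shows "continuous_on I u" "continuous_on I u1" "continuous_on I u2" "continuous_on I (L_data u u1 u2)"
proof -
  show c: "continuous_on I u" "continuous_on I u1" "continuous_on I u2"
    using assms unfolding C2_data_def by (auto simp: continuous_on_eq_continuous_within intro: DERIV_continuous)
  show "continuous_on I (L_data u u1 u2)" unfolding L_data_def by (intro continuous_intros c)
qed

text \<open>The preceding integral identity is applied to the Wronskian
  \<open>u1 * v - u * v1\<close>; the potential terms cancel. The factor vanishing at the endpoints
  makes the operator symmetric with no boundary conditions.\<close>

lemma Green_identity:
  assumes u: "C2_data u u1 u2" and v: "C2_data v v1 v2"
  shows "(\<integral>x. L_data u u1 u2 x * v x \<partial>M) = (\<integral>x. u x * L_data v v1 v2 x \<partial>M)"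
proof -
  note cu = C2_data_continuous[OF u] and cv = C2_data_continuous[OF v]
  have "(\<integral>x. (1 - x\<^sup>2) * (u2 x * v x - u x * v2 x) - (2 * \<alpha> + 2) * x * (u1 x * v x - u x * v1 x) \<partial>M) = 0"
  proof (rule integral_weighted_derivative_zero)
    fix x assume x: "x \<in> I"
    have "(u has_real_derivative u1 x) (at x within I)" "(u1 has_real_derivative u2 x) (at x within I)"
      "(v has_real_derivative v1 x) (at x within I)" "(v1 has_real_derivative v2 x) (at x within I)"
      using u v x by (auto simp: C2_data_def)
    then show "((\<lambda>x. u1 x * v x - u x * v1 x) has_real_derivative u2 x * v x - u x * v2 x) (at x within I)"
      by (auto intro!: derivative_eq_intros)
  qed (intro continuous_intros cu cv)
  moreover have "(1 - x\<^sup>2) * (u2 x * v x - u x * v2 x) - (2 * \<alpha> + 2) * x * (u1 x * v x - u x * v1 x)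
    = L_data u u1 u2 x * v x - u x * L_data v v1 v2 x" for x
    by (simp add: L_data_def algebra_simps)
  ultimately have "(\<integral>x. L_data u u1 u2 x * v x - u x * L_data v v1 v2 x \<partial>M) = 0" by simp
  moreover have "integrable M (\<lambda>x. L_data u u1 u2 x * v x)" "integrable M (\<lambda>x. u x * L_data v v1 v2 x)"
    by (intro integrable_M_continuous continuous_intros cu cv)+
  ultimately show ?thesis by simp
qed

lemma deriv_I_eq: "x \<in> I \<Longrightarrow> (u has_real_derivative u1) (at x within I) \<Longrightarrow> deriv_I u x = u1"
  unfolding deriv_I_def
  by (rule vector_derivative_within_closed_interval) (auto simp: has_real_derivative_iff_has_vector_derivative)

lemma C2_data_imp_C2_on_I:
  assumes "C2_data u u1 u2"
  shows "C2_on_I u" and "x \<in> I \<Longrightarrow> L_op c \<alpha> u x = L_data u u1 u2 x"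
proof -
  have d: "\<And>x. x \<in> I \<Longrightarrow> (u has_real_derivative u1 x) (at x within I)"
    "\<And>x. x \<in> I \<Longrightarrow> (u1 has_real_derivative u2 x) (at x within I)" using assms by (auto simp: C2_data_def)
  have e1: "deriv_I u x = u1 x" if "x \<in> I" for x using deriv_I_eq[OF that d(1)[OF that]] .
  have d2: "(deriv_I u has_real_derivative u2 x) (at x within I)" if x: "x \<in> I" for x
    by (rule has_field_derivative_transform_within[OF d(2)[OF x] zero_less_one x]) (simp add: e1)
  have e2: "deriv_I (deriv_I u) x = u2 x" if "x \<in> I" for x using deriv_I_eq[OF that d2[OF that]] .
  have "continuous_on I (deriv_I (deriv_I u))"
    using C2_data_continuous(3)[OF assms] by (rule continuous_on_eq) (simp add: e2)
  then show "C2_on_I u"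
    unfolding C2_on_I_def differentiable_on_def real_differentiable_def using d(1) d2 by blast
  show "x \<in> I \<Longrightarrow> L_op c \<alpha> u x = L_data u u1 u2 x"
    by (simp add: L_op_def L_data_def e1 e2)
qed

lemma C2_on_I_imp_C2_data:
  assumes "C2_on_I u"
  shows "C2_data u (deriv_I u) (deriv_I (deriv_I u))"
proof -
  have "(f has_real_derivative deriv_I f x) (at x within I)" if "f differentiable_on I" "x \<in> I" for f x
    using that deriv_I_eq[OF that(2)] unfolding differentiable_on_def real_differentiable_def by metis
  then show ?thesis using assms by (auto simp: C2_on_I_def C2_data_def)
qed

end

section \<open>The kernel and the differential operator\<close>

context prolate
begin

lemma deriv_imp_continuous_on:
  "(\<And>x. (f has_real_derivative f' x) (at x)) \<Longrightarrow> continuous_on A f"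
  by (meson DERIV_isCont continuous_at_imp_continuous_on)

text \<open>The cosine transform of the weight, which is the real form of \<open>kernel\<close>; the
  primed functions are its derivatives. The factor \<open>* 1\<close> gives the integrands the shape
  \<open>p x y * v y\<close> of \<open>deriv_integral_M\<close>.\<close>

definition kc :: "real \<Rightarrow> real" where "kc s = (\<integral>t. cos (s * t) * 1 \<partial>M)"
definition kc' :: "real \<Rightarrow> real" where "kc' s = (\<integral>t. - (t * sin (s * t)) * 1 \<partial>M)"
definition kc'' :: "real \<Rightarrow> real" where "kc'' s = (\<integral>t. - (t\<^sup>2 * cos (s * t)) * 1 \<partial>M)"
definition kc''' :: "real \<Rightarrow> real" where "kc''' s = (\<integral>t. t ^ 3 * sin (s * t) * 1 \<partial>M)"

lemma trig_moment_bounds: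
  assumes "t \<in> I"
  shows "\<bar>cos a\<bar> \<le> 1" "\<bar>t * sin a\<bar> \<le> 1" "\<bar>t * cos a\<bar> \<le> 1" "\<bar>t\<^sup>2 * cos a\<bar> \<le> 1" "\<bar>t\<^sup>2 * sin a\<bar> \<le> 1" 
    "\<bar>t ^ 3 * sin a\<bar> \<le> 1" "\<bar>t ^ 3 * cos a\<bar> \<le> 1" "\<bar>sin a\<bar> \<le> 1"
proof -
  have t: "\<bar>t\<bar> \<le> 1" using assms by (simp add: abs_le_iff)
  have "\<bar>t\<bar> ^ n * \<bar>b\<bar> \<le> 1 * 1" if "\<bar>b\<bar> \<le> 1" for n and b :: real
    using t that by (intro mult_mono power_le_one) auto
  from this[of "cos a" 1] this[of "cos a" 2] this[of "cos a" 3] this[of "sin a" 1] this[of "sin a" 2] this[of "sin a" 3]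
  show "\<bar>cos a\<bar> \<le> 1" "\<bar>t * sin a\<bar> \<le> 1" "\<bar>t * cos a\<bar> \<le> 1" "\<bar>t\<^sup>2 * cos a\<bar> \<le> 1" "\<bar>t\<^sup>2 * sin a\<bar> \<le> 1" 
    "\<bar>t ^ 3 * sin a\<bar> \<le> 1" "\<bar>t ^ 3 * cos a\<bar> \<le> 1" "\<bar>sin a\<bar> \<le> 1"
    by (auto simp: abs_mult power_abs)
qed

lemma kc_deriv: "(kc has_real_derivative kc' s) (at s)"
  unfolding kc_def kc'_def
  by (rule deriv_integral_M[where B=1])
     (auto intro!: derivative_eq_intros continuous_intros trig_moment_bounds simp del: abs_minus_cancel simp: abs_minus_cancel[of "_ * _"] trig_moment_bounds)

lemma kc'_deriv: "(kc' has_real_derivative kc'' s) (at s)"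
  unfolding kc''_def kc'_def
  by (rule deriv_integral_M[where B=1])
     (auto intro!: derivative_eq_intros continuous_intros trig_moment_bounds simp: trig_moment_bounds power2_eq_square[symmetric] mult.assoc[symmetric])

lemma kc''_deriv: "(kc'' has_real_derivative kc''' s) (at s)"
  unfolding kc''_def kc'''_def
proof (rule deriv_integral_M[where B=1])
  fix x y :: real
  show "((\<lambda>x. - (y\<^sup>2 * cos (x * y))) has_real_derivative y ^ 3 * sin (x * y)) (at x)"
    by (auto intro!: derivative_eq_intros simp: power2_eq_square power3_eq_cube)
qed (auto intro!: continuous_intros trig_moment_bounds simp: trig_moment_bounds)

lemma kc_bounds:
  shows "\<bar>kc s\<bar> \<le> measure M I" "\<bar>kc' s\<bar> \<le> measure M I" "\<bar>kc'' s\<bar> \<le> measure M I" "\<bar>kc''' s\<bar> \<le> measure M I"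
proof -
  have *: "\<bar>\<integral>t. f t * 1 \<partial>M\<bar> \<le> measure M I" if "continuous_on I f" "\<And>t. t \<in> I \<Longrightarrow> \<bar>f t\<bar> \<le> 1" for f :: "real \<Rightarrow> real"
  proof -
    have "\<bar>\<integral>t. f t * 1 \<partial>M\<bar> \<le> (\<integral>t. \<bar>f t\<bar> \<partial>M)" using integral_abs_bound[of M f] by simp
    also have "\<dots> \<le> (\<integral>t. 1 \<partial>M)"
      using that integrable_M_continuous[OF that(1)] by (intro integral_mono) auto
    finally show ?thesis by simp
  qed
  show "\<bar>kc s\<bar> \<le> measure M I" "\<bar>kc' s\<bar> \<le> measure M I" "\<bar>kc'' s\<bar> \<le> measure M I" "\<bar>kc''' s\<bar> \<le> measure M I"
    unfolding kc_def kc'_def kc''_def kc'''_def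
    by (rule *; auto intro!: continuous_intros trig_moment_bounds simp: trig_moment_bounds)+
qed

lemma kc_parity: "kc (- s) = kc s" "kc' (- s) = - kc' s" "kc'' (- s) = kc'' s"
  by (simp_all add: kc_def kc'_def kc''_def)

text \<open>Integration by parts with \<open>sin (s * t)\<close> as the function differentiated.
  This is the equation behind the Bessel form of the kernel, obtained without Bessel
  functions.\<close>

lemma kc_ode: "s * kc'' s + (2 * \<alpha> + 2) * kc' s + s * kc s = 0"
proof -
  have i: "integrable M (\<lambda>t. - (t\<^sup>2 * cos (s * t)) * 1)" "integrable M (\<lambda>t. - (t * sin (s * t)) * 1)" "integrable M (\<lambda>t. cos (s * t) * 1)"
    by (intro integrable_M_continuous continuous_intros)+
  have "0 = (\<integral>t. (1 - t\<^sup>2) * (s * cos (s * t)) - (2 * \<alpha> + 2) * t * sin (s * t) \<partial>M)"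
    by (rule integral_weighted_derivative_zero[symmetric]) (auto intro!: derivative_eq_intros continuous_intros)
  also have "\<dots> = (\<integral>t. s * (- (t\<^sup>2 * cos (s * t)) * 1) + (2 * \<alpha> + 2) * (- (t * sin (s * t)) * 1) + s * (cos (s * t) * 1) \<partial>M)"
    by (rule Bochner_Integration.integral_cong) (auto simp: algebra_simps)
  also have "\<dots> = s * kc'' s + (2 * \<alpha> + 2) * kc' s + s * kc s"
    unfolding kc_def kc'_def kc''_def
    by (subst Bochner_Integration.integral_add; (subst Bochner_Integration.integral_add)?; (intro integrable_mult_right Bochner_Integration.integrable_add i)?; simp only: integral_mult_right_zero)
  finally show ?thesis ..
qed

text \<open>The kernel of \<open>Q\<close> including its prefactor, followed by its derivatives in
  \<open>x\<close>. Since it depends on \<open>x - y\<close>, derivatives in \<open>y\<close> are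
  the same up to alternating signs.\<close>

definition Kf :: "real \<Rightarrow> real \<Rightarrow> real" where "Kf x y = c / (2 * pi) * kc (c * (x - y))"
definition Kf1 :: "real \<Rightarrow> real \<Rightarrow> real" where "Kf1 x y = c / (2 * pi) * (c * kc' (c * (x - y)))"
definition Kf2 :: "real \<Rightarrow> real \<Rightarrow> real" where "Kf2 x y = c / (2 * pi) * (c\<^sup>2 * kc'' (c * (x - y)))"
definition Kf3 :: "real \<Rightarrow> real \<Rightarrow> real" where "Kf3 x y = c / (2 * pi) * (c ^ 3 * kc''' (c * (x - y)))"

text \<open>One bound for the kernel and its first three derivatives: the derivative of order
  \<open>j\<close> contributes \<open>c ^ j\<close>, and each derivative of \<open>kc\<close> is
  bounded by the total mass.\<close>

definition BK :: real where "BK = c / (2 * pi) * ((1 + c + c\<^sup>2 + c ^ 3) * measure M I)"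

lemma Kf_derivs:
  "((\<lambda>x. Kf x y) has_real_derivative Kf1 x y) (at x)"
  "((\<lambda>x. Kf1 x y) has_real_derivative Kf2 x y) (at x)"
  "((\<lambda>x. Kf2 x y) has_real_derivative Kf3 x y) (at x)"
  "((\<lambda>y. Kf x y) has_real_derivative - Kf1 x y) (at y)"
  "((\<lambda>y. - Kf1 x y) has_real_derivative Kf2 x y) (at y)"
  "((\<lambda>y. Kf2 x y) has_real_derivative - Kf3 x y) (at y)"
  unfolding Kf_def Kf1_def Kf2_def Kf3_def
  by (auto intro!: derivative_eq_intros DERIV_chain2[OF kc_deriv] DERIV_chain2[OF kc'_deriv] DERIV_chain2[OF kc''_deriv]
      simp: power2_eq_square power3_eq_cube)

lemma BK_nonneg: "0 \<le> BK"
  unfolding BK_def using c_pos by (intro mult_nonneg_nonneg add_nonneg_nonneg) auto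

lemma Kf_bounds: "\<bar>Kf x y\<bar> \<le> BK" "\<bar>Kf1 x y\<bar> \<le> BK" "\<bar>Kf2 x y\<bar> \<le> BK" "\<bar>Kf3 x y\<bar> \<le> BK"
proof -
  have c: "0 \<le> c" "0 \<le> c\<^sup>2" "0 \<le> c ^ 3" using c_pos by auto
  have *: "\<bar>c / (2 * pi) * (b * k)\<bar> \<le> BK" if "\<bar>k\<bar> \<le> measure M I" "0 \<le> b" "b \<le> 1 + c + c\<^sup>2 + c ^ 3" for b k
  proof -
    have "\<bar>c / (2 * pi) * (b * k)\<bar> = c / (2 * pi) * (b * \<bar>k\<bar>)" using c_pos that by (simp add: abs_mult)
    also have "\<dots> \<le> BK" unfolding BK_def using c_pos that c by (intro mult_left_mono mult_mono) auto
    finally show ?thesis .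
  qed
  show "\<bar>Kf x y\<bar> \<le> BK" using *[OF kc_bounds(1), of 1] c by (simp add: Kf_def)
  show "\<bar>Kf1 x y\<bar> \<le> BK" "\<bar>Kf2 x y\<bar> \<le> BK" "\<bar>Kf3 x y\<bar> \<le> BK"
    unfolding Kf1_def Kf2_def Kf3_def using c by (intro * kc_bounds; simp)+
qed

lemma Kf_continuous: "continuous_on A (Kf x)" "continuous_on A (Kf1 x)" "continuous_on A (Kf2 x)" "continuous_on A (Kf3 x)" 
proof -
  have "continuous_on UNIV kc" "continuous_on UNIV kc'" "continuous_on UNIV kc''"
    using kc_deriv kc'_deriv kc''_deriv by (auto intro: deriv_imp_continuous_on)
  \<comment> \<open>Continuity of the third derivative is read off from a fourth differentiation
    under the integral.\<close>
  moreover have "continuous_on UNIV kc'''"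
  proof -
    have "isCont kc''' s" for s
    proof (rule DERIV_isCont)
      show "(kc''' has_real_derivative (\<integral>t. t ^ 4 * cos (s * t) * 1 \<partial>M)) (at s)"
        unfolding kc'''_def
      proof (rule deriv_integral_M[where B=1])
        fix x y :: real assume y: "y \<in> I"
        have "\<bar>y\<bar> * \<bar>y ^ 3 * cos (x * y)\<bar> \<le> 1 * 1" using y trig_moment_bounds(7)[OF y] by (intro mult_mono) (auto simp: abs_le_iff)
        then show "\<bar>y ^ 4 * cos (x * y)\<bar> \<le> 1" by (simp add: abs_mult power4_eq_xxxx power3_eq_cube mult_ac)
        show "\<bar>y ^ 3 * sin (x * y)\<bar> \<le> 1" by (rule trig_moment_bounds[OF y])
      next
        fix x y :: real
        show "((\<lambda>x. y ^ 3 * sin (x * y)) has_real_derivative y ^ 4 * cos (x * y)) (at x)"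
          by (auto intro!: derivative_eq_intros simp: power4_eq_xxxx power3_eq_cube)
      qed (auto intro!: continuous_intros)
    qed
    then show ?thesis by (simp add: continuous_on_eq_continuous_at)
  qed
  ultimately show "continuous_on A (Kf x)" "continuous_on A (Kf1 x)" "continuous_on A (Kf2 x)" "continuous_on A (Kf3 x)" 
    unfolding Kf_def Kf1_def Kf2_def Kf3_def
    by (auto intro!: continuous_intros elim: continuous_on_compose2)
qed

lemma Kf_commute: "Kf x y = Kf y x"
  using kc_parity(1)[of "c * (x - y)"] by (simp add: Kf_def algebra_simps)

text \<open>The differential operator applied to \<open>Kf\<close> in its first variable; it becomes
  the kernel of \<open>Lr\<close>.\<close>

definition ellf :: "real \<Rightarrow> real \<Rightarrow> real" where
  "ellf x y = (1 - x\<^sup>2) * Kf2 x y - (2 * \<alpha> + 2) * x * Kf1 x y - c\<^sup>2 * x\<^sup>2 * Kf x y"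

lemma C2_data_Kf: "C2_data (Kf x) (\<lambda>y. - Kf1 x y) (Kf2 x)"
  unfolding C2_data_def using Kf_derivs Kf_continuous by (auto intro: has_field_derivative_at_within)

text \<open>The differential operator acts identically on the two variables of the kernel; this is the
  Bessel-type equation \<open>kc_ode\<close> in disguise.\<close>

lemma L_data_Kf: "L_data (Kf x) (\<lambda>y. - Kf1 x y) (Kf2 x) y = ellf x y"
proof -
  let ?s = "c * (x - y)"
  \<comment> \<open>Between the variables, the leading and potential coefficients differ by
    multiples of \<open>x\<^sup>2 - y\<^sup>2\<close>, and the first order terms combine to a
    multiple of \<open>x + y\<close>. Everything shares the factor \<open>x + y\<close>, and the
    cofactor is the equation \<open>kc_ode\<close>.\<close>
  have "ellf x y - L_data (Kf x) (\<lambda>y. - Kf1 x y) (Kf2 x) y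
    = - (c\<^sup>2 / (2 * pi) * (x + y) * (?s * kc'' ?s + (2 * \<alpha> + 2) * kc' ?s + ?s * kc ?s))"
    unfolding ellf_def L_data_def Kf_def Kf1_def Kf2_def by (simp add: field_simps power2_eq_square)
  then show ?thesis by (simp add: kc_ode)
qed

definition Qr :: "(real \<Rightarrow> real) \<Rightarrow> real \<Rightarrow> real" where "Qr v x = (\<integral>y. Kf x y * v y \<partial>M)"
definition Qr1 :: "(real \<Rightarrow> real) \<Rightarrow> real \<Rightarrow> real" where "Qr1 v x = (\<integral>y. Kf1 x y * v y \<partial>M)"
definition Qr2 :: "(real \<Rightarrow> real) \<Rightarrow> real \<Rightarrow> real" where "Qr2 v x = (\<integral>y. Kf2 x y * v y \<partial>M)"
text \<open>The differential operator composed with \<open>Qr\<close>, written as an integral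
  operator. In this form it makes sense, with bounds, for every integrable \<open>v\<close>.\<close>

definition Lr :: "(real \<Rightarrow> real) \<Rightarrow> real \<Rightarrow> real" where "Lr v x = (\<integral>y. ellf x y * v y \<partial>M)"

lemma integrable_bounded_mult:
  fixes p v :: "real \<Rightarrow> real"
  assumes p: "continuous_on I p" and v: "integrable M v"
  shows "integrable M (\<lambda>y. p y * v y)"
proof -
  have "bounded (p ` I)" using p by (intro compact_imp_bounded compact_continuous_image) auto
  then obtain B where B: "\<forall>y\<in>p ` I. norm y \<le> B" unfolding bounded_iff ..
  have [measurable]: "p \<in> borel_measurable M" using p by (rule measurable_M_continuous)
  show ?thesis
  proof (rule Bochner_Integration.integrable_bound[of _ "\<lambda>y. B * \<bar>v y\<bar>"])
    show "AE y in M. norm (p y * v y) \<le> norm (B * \<bar>v y\<bar>)"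
    proof (rule AE_I2)
      fix y assume "y \<in> space M"
      then have "\<bar>p y\<bar> \<le> B" using B by auto
      then show "norm (p y * v y) \<le> norm (B * \<bar>v y\<bar>)" by (simp add: abs_mult mult_right_mono)
    qed
  qed (use v in auto)
qed

lemma Qr_derivs:
  assumes v: "integrable M v"
  shows "(Qr v has_real_derivative Qr1 v x) (at x)" "(Qr1 v has_real_derivative Qr2 v x) (at x)"
    "(Qr2 v has_real_derivative (\<integral>y. Kf3 x y * v y \<partial>M)) (at x)"
  unfolding Qr_def Qr1_def Qr2_def
  by (rule deriv_integral_M[where B=BK], (rule Kf_derivs Kf_bounds Kf_continuous v)+)+

lemma C2_data_Qr: "integrable M v \<Longrightarrow> C2_data (Qr v) (Qr1 v) (Qr2 v)"
  unfolding C2_data_def using Qr_derivs[of v]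
  by (auto intro: has_field_derivative_at_within intro!: deriv_imp_continuous_on)

lemma L_data_Qr:
  assumes "integrable M v"
  shows "L_data (Qr v) (Qr1 v) (Qr2 v) x = Lr v x"
proof -
  note i = integrable_bounded_mult[OF Kf_continuous(1)[of I x] assms] integrable_bounded_mult[OF Kf_continuous(2)[of I x] assms]
    integrable_bounded_mult[OF Kf_continuous(3)[of I x] assms]
  have "Lr v x = (\<integral>y. (1 - x\<^sup>2) * (Kf2 x y * v y) - (2 * \<alpha> + 2) * x * (Kf1 x y * v y) - c\<^sup>2 * x\<^sup>2 * (Kf x y * v y) \<partial>M)"
    unfolding Lr_def ellf_def by (rule Bochner_Integration.integral_cong) (auto simp: algebra_simps)
  also have "\<dots> = L_data (Qr v) (Qr1 v) (Qr2 v) x"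
    unfolding L_data_def Qr_def Qr1_def Qr2_def
    by (subst Bochner_Integration.integral_diff; (subst Bochner_Integration.integral_diff)?; (intro integrable_mult_right Bochner_Integration.integrable_diff i)?; simp only: integral_mult_right_zero)
  finally show ?thesis ..
qed

text \<open>Together with \<open>L_data_Qr\<close> this is the commutation of \<open>Q\<close> with
  the differential operator: Green's identity moves the operator onto the second variable of the
  kernel, and \<open>L_data_Kf\<close> exchanges the variables.\<close>

lemma Qr_L_data:
  assumes "C2_data v v1 v2"
  shows "Qr (L_data v v1 v2) x = Lr v x"
  unfolding Qr_def Lr_def Green_identity[OF C2_data_Kf assms, symmetric] L_data_Kf ..

text \<open>The L1 norm of \<open>v\<close> controls a uniform bound and a Lipschitz constant of the
  image, the two inputs of Arzela-Ascoli, and also the size of \<open>Lr v\<close>.\<close>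

lemma Qr_bounds:
  assumes v: "integrable M v"
  shows "\<bar>Qr v x\<bar> \<le> BK * (\<integral>y. \<bar>v y\<bar> \<partial>M)" and "\<bar>Qr v x - Qr v x'\<bar> \<le> BK * (\<integral>y. \<bar>v y\<bar> \<partial>M) * \<bar>x - x'\<bar>"
    and "x \<in> I \<Longrightarrow> \<bar>Lr v x\<bar> \<le> (1 + (2 * \<alpha> + 2) + c\<^sup>2) * (BK * (\<integral>y. \<bar>v y\<bar> \<partial>M))"
proof -
  have *: "\<bar>\<integral>y. p y * v y \<partial>M\<bar> \<le> BK * (\<integral>y. \<bar>v y\<bar> \<partial>M)" if "continuous_on I p" "\<And>y. \<bar>p y\<bar> \<le> BK" for p
  proof -
    note i = integrable_bounded_mult[OF that(1) v]
    have "\<bar>\<integral>y. p y * v y \<partial>M\<bar> \<le> (\<integral>y. \<bar>p y * v y\<bar> \<partial>M)" by (rule integral_abs_bound)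
    also have "\<dots> \<le> (\<integral>y. BK * \<bar>v y\<bar> \<partial>M)"
    proof (rule integral_mono)
      show "\<bar>p y * v y\<bar> \<le> BK * \<bar>v y\<bar>" for y unfolding abs_mult by (rule mult_right_mono[OF that(2)]) simp
    qed (use i v in auto)
    finally show ?thesis by simp
  qed
  show 0: "\<bar>Qr v x\<bar> \<le> BK * (\<integral>y. \<bar>v y\<bar> \<partial>M)" for x unfolding Qr_def by (rule * Kf_continuous Kf_bounds)+
  have 1: "\<bar>Qr1 v x\<bar> \<le> BK * (\<integral>y. \<bar>v y\<bar> \<partial>M)" for x unfolding Qr1_def by (rule * Kf_continuous Kf_bounds)+
  have 2: "\<bar>Qr2 v x\<bar> \<le> BK * (\<integral>y. \<bar>v y\<bar> \<partial>M)" for x unfolding Qr2_def by (rule * Kf_continuous Kf_bounds)+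
  show "\<bar>Qr v x - Qr v x'\<bar> \<le> BK * (\<integral>y. \<bar>v y\<bar> \<partial>M) * \<bar>x - x'\<bar>"
    using field_differentiable_bound[of UNIV "Qr v" "Qr1 v" "BK * (\<integral>y. \<bar>v y\<bar> \<partial>M)" x x'] 1 Qr_derivs(1)[OF v]
    by auto
  show "\<bar>Lr v x\<bar> \<le> (1 + (2 * \<alpha> + 2) + c\<^sup>2) * (BK * (\<integral>y. \<bar>v y\<bar> \<partial>M))" if x: "x \<in> I"
  proof -
    let ?b = "BK * (\<integral>y. \<bar>v y\<bar> \<partial>M)"
    have x1: "\<bar>x\<bar> \<le> 1" using x by (simp add: abs_le_iff)
    then have x2: "x\<^sup>2 \<le> 1" by (simp add: abs_square_le_1)
    have b: "0 \<le> ?b" using BK_nonneg by simp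
    have "\<bar>(1 - x\<^sup>2) * Qr2 v x\<bar> \<le> 1 * ?b" unfolding abs_mult using x2 2 by (intro mult_mono) auto
    moreover have "\<bar>(2 * \<alpha> + 2) * x * Qr1 v x\<bar> \<le> (2 * \<alpha> + 2) * 1 * ?b"
      unfolding abs_mult using x1 1 alpha_nonneg by (intro mult_mono) auto
    moreover have "\<bar>c\<^sup>2 * x\<^sup>2 * Qr v x\<bar> \<le> c\<^sup>2 * 1 * ?b"
      unfolding abs_mult using x2 0 by (intro mult_mono) auto
    ultimately have "\<bar>L_data (Qr v) (Qr1 v) (Qr2 v) x\<bar> \<le> 1 * ?b + (2 * \<alpha> + 2) * 1 * ?b + c\<^sup>2 * 1 * ?b"
      unfolding L_data_def by linarith
    then show ?thesis unfolding L_data_Qr[OF v] by (simp add: algebra_simps)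
  qed
qed

section \<open>Commutation of the finite Fourier transform with the differential operator\<close>

definition FC :: "(real \<Rightarrow> real) \<Rightarrow> real \<Rightarrow> real" where "FC v x = (\<integral>y. cos (c * x * y) * v y \<partial>M)"
definition FS :: "(real \<Rightarrow> real) \<Rightarrow> real \<Rightarrow> real" where "FS v x = (\<integral>y. sin (c * x * y) * v y \<partial>M)"

text \<open>Applied to \<open>e (c * x * y)\<close> in either variable, the operator gives the same
  symmetric expression; Green's identity then carries it to \<open>v\<close>. The pair
  \<open>e\<close>, \<open>e'\<close> treats cosine and sine at once.\<close>

lemma trig_transform_L:
  fixes e e' :: "real \<Rightarrow> real"
  assumes e: "\<And>s. (e has_real_derivative e' s) (at s)" and e': "\<And>s. (e' has_real_derivative - e s) (at s)"
    and B: "\<And>s. \<bar>e s\<bar> \<le> 1" "\<And>s. \<bar>e' s\<bar> \<le> 1"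
    and v: "C2_data v v1 v2"
  shows "\<exists>u1 u2. C2_data (\<lambda>x. \<integral>y. e (c * x * y) * v y \<partial>M) u1 u2 \<and>
    (\<forall>x. L_data (\<lambda>x. \<integral>y. e (c * x * y) * v y \<partial>M) u1 u2 x = (\<integral>y. e (c * x * y) * L_data v v1 v2 y \<partial>M))"
proof -
  have ce: "continuous_on A e" "continuous_on A e'" for A
    by (rule deriv_imp_continuous_on[OF e], rule deriv_imp_continuous_on[OF e'])
  have de: "((\<lambda>x. e (a * x)) has_real_derivative a * e' (a * x)) (at x)"
    and de': "((\<lambda>x. e' (a * x)) has_real_derivative - (a * e (a * x))) (at x)" for a x
  proof -
    have l: "((\<lambda>x. a * x) has_real_derivative a) (at x)" by (auto intro!: derivative_eq_intros)
    show "((\<lambda>x. e (a * x)) has_real_derivative a * e' (a * x)) (at x)"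
      by (rule DERIV_cong[OF DERIV_chain2[OF e l]]) simp
    show "((\<lambda>x. e' (a * x)) has_real_derivative - (a * e (a * x))) (at x)"
      by (rule DERIV_cong[OF DERIV_chain2[OF e' l]]) simp
  qed
  have cx: "((\<lambda>x. e (c * x * y)) has_real_derivative c * y * e' (c * x * y)) (at x)"
    and cx': "((\<lambda>x. e' (c * x * y)) has_real_derivative - (c * y * e (c * x * y))) (at x)" for x y
    using de[of "c * y" x] de'[of "c * y" x] by (simp_all add: mult_ac)
  have cc: "continuous_on A (\<lambda>y. e (c * x * y))" "continuous_on A (\<lambda>y. e' (c * x * y))" for A x
    by (auto intro!: continuous_on_compose2[OF ce(1)] continuous_on_compose2[OF ce(2)] continuous_intros)
  note iv = integrable_M_continuous[OF C2_data_continuous(1)[OF v]]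
  define u where "u x = (\<integral>y. e (c * x * y) * v y \<partial>M)" for x
  define u1 where "u1 x = (\<integral>y. (c * y * e' (c * x * y)) * v y \<partial>M)" for x
  define u2 where "u2 x = (\<integral>y. (- (c\<^sup>2 * y\<^sup>2) * e (c * x * y)) * v y \<partial>M)" for x
  define u3 where "u3 x = (\<integral>y. (- (c^3 * y^3) * e' (c * x * y)) * v y \<partial>M)" for x
  \<comment> \<open>Each derivative in \<open>x\<close> brings out one more factor
    \<open>c * y\<close>, so this sum bounds the transform kernel and its first three derivatives on
    \<open>I\<close>.\<close>
  define B where "B = 1 + c + c\<^sup>2 + c ^ 3"
  have Bs: "1 \<le> B" "c \<le> B" "c\<^sup>2 \<le> B" "c ^ 3 \<le> B" using c_pos by (auto simp: B_def)
  have bd: "\<bar>c ^ n * y ^ n * a\<bar> \<le> B" if y: "y \<in> I" and a: "\<bar>a\<bar> \<le> 1" and n: "c ^ n \<le> B" for n y a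
  proof -
    have "\<bar>c ^ n * y ^ n * a\<bar> = c ^ n * (\<bar>y\<bar> ^ n * \<bar>a\<bar>)" using c_pos by (simp add: abs_mult power_abs)
    also have "\<dots> \<le> c ^ n * (1 * 1)" using y a c_pos by (intro mult_left_mono mult_mono power_le_one) (auto simp: abs_le_iff)
    finally show ?thesis using n by simp
  qed
  have d0: "(u has_real_derivative u1 x) (at x)" for x
    unfolding u_def u1_def
  proof (rule deriv_integral_M[where B=B])
    fix x y :: real
    show "((\<lambda>x. e (c * x * y)) has_real_derivative c * y * e' (c * x * y)) (at x)"
      by (rule cx)
    assume y: "y \<in> I"
    show "\<bar>e (c * x * y)\<bar> \<le> B" using B(1)[of "c * x * y"] Bs by linarith
    show "\<bar>c * y * e' (c * x * y)\<bar> \<le> B" using bd[OF y B(2), of 1] Bs by simp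
  qed (auto intro!: cc continuous_intros iv)
  have d1: "(u1 has_real_derivative u2 x) (at x)" for x
    unfolding u1_def u2_def
  proof (rule deriv_integral_M[where B=B])
    fix x y :: real
    show "((\<lambda>x. c * y * e' (c * x * y)) has_real_derivative - (c\<^sup>2 * y\<^sup>2) * e (c * x * y)) (at x)"
      by (rule DERIV_cong[OF DERIV_cmult[OF cx']]) (simp add: power2_eq_square mult_ac)
    assume y: "y \<in> I"
    show "\<bar>c * y * e' (c * x * y)\<bar> \<le> B" using bd[OF y B(2), of 1] Bs by simp
    show "\<bar>- (c\<^sup>2 * y\<^sup>2) * e (c * x * y)\<bar> \<le> B" using bd[OF y B(1), of 2] Bs by simp
  qed (auto intro!: cc continuous_intros iv)
  have d2: "(u2 has_real_derivative u3 x) (at x)" for x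
    unfolding u2_def u3_def
  proof (rule deriv_integral_M[where B=B])
    fix x y :: real
    show "((\<lambda>x. - (c\<^sup>2 * y\<^sup>2) * e (c * x * y)) has_real_derivative - (c ^ 3 * y ^ 3) * e' (c * x * y)) (at x)"
      by (rule DERIV_cong[OF DERIV_cmult[OF cx]]) (simp add: power2_eq_square power3_eq_cube mult_ac)
    assume y: "y \<in> I"
    show "\<bar>- (c\<^sup>2 * y\<^sup>2) * e (c * x * y)\<bar> \<le> B" using bd[OF y B(1), of 2] Bs by simp
    show "\<bar>- (c ^ 3 * y ^ 3) * e' (c * x * y)\<bar> \<le> B" using bd[OF y B(2), of 3] Bs by simp
  qed (auto intro!: cc continuous_intros iv)
  have C2u: "C2_data u u1 u2"
    unfolding C2_data_def using d0 d1 d2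
    by (auto intro: has_field_derivative_at_within intro!: deriv_imp_continuous_on)
  have "L_data u u1 u2 x = (\<integral>y. e (c * x * y) * L_data v v1 v2 y \<partial>M)" for x
  proof -
    \<comment> \<open>First and second derivatives of the kernel in \<open>y\<close>, as needed for
      Green's identity; the derivatives in \<open>x\<close> are those in \<open>u1\<close> and
      \<open>u2\<close>.\<close>
    define E1 where "E1 y = c * x * e' (c * x * y)" for y
    define E2 where "E2 y = - (c\<^sup>2 * x\<^sup>2) * e (c * x * y)" for y
    have "(E1 has_real_derivative E2 y) (at y)" for y
      unfolding E1_def E2_def
      by (rule DERIV_cong[OF DERIV_cmult[OF de']]) (simp add: power2_eq_square mult_ac)
    moreover have "continuous_on I E2" unfolding E2_def by (intro continuous_intros cc)
    moreover have "((\<lambda>y. e (c * x * y)) has_real_derivative E1 y) (at y)" for y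
      unfolding E1_def by (rule de)
    ultimately have C2e: "C2_data (\<lambda>y. e (c * x * y)) E1 E2"
      unfolding C2_data_def by (blast intro: has_field_derivative_at_within)
    have i: "integrable M (\<lambda>y. e (c * x * y) * v y)" "integrable M (\<lambda>y. (c * y * e' (c * x * y)) * v y)"
      "integrable M (\<lambda>y. (- (c\<^sup>2 * y\<^sup>2) * e (c * x * y)) * v y)"
      by (intro integrable_bounded_mult iv continuous_intros cc)+
    have "(\<integral>y. e (c * x * y) * L_data v v1 v2 y \<partial>M) = (\<integral>y. L_data (\<lambda>y. e (c * x * y)) E1 E2 y * v y \<partial>M)"
      by (rule Green_identity[OF C2e v, symmetric])
    also have "\<dots> = (\<integral>y. (1 - x\<^sup>2) * ((- (c\<^sup>2 * y\<^sup>2) * e (c * x * y)) * v y)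
        - (2 * \<alpha> + 2) * x * ((c * y * e' (c * x * y)) * v y) - c\<^sup>2 * x\<^sup>2 * (e (c * x * y) * v y) \<partial>M)"
      unfolding L_data_def E1_def E2_def by (rule Bochner_Integration.integral_cong) (auto simp: algebra_simps)
    also have "\<dots> = L_data u u1 u2 x"
      unfolding L_data_def u_def u1_def u2_def
      by (subst Bochner_Integration.integral_diff; (subst Bochner_Integration.integral_diff)?; (intro integrable_mult_right Bochner_Integration.integrable_diff i)?; simp only: integral_mult_right_zero)
    finally show ?thesis ..
  qed
  with C2u show ?thesis unfolding u_def by blast
qed

text \<open>The transform of \<open>\<psi> n\<close> satisfies the same eigenvalue equation as
  \<open>\<psi> n\<close>. If it is not zero it is an eigenfunction, and the simplicity built into
  \<open>is_GPSWF\<close> makes it a multiple.\<close>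

lemma trig_transform_eigen:
  fixes e e' :: "real \<Rightarrow> real"
  assumes e: "\<And>s. (e has_real_derivative e' s) (at s)" and e': "\<And>s. (e' has_real_derivative - e s) (at s)"
    and B: "\<And>s. \<bar>e s\<bar> \<le> 1" "\<And>s. \<bar>e' s\<bar> \<le> 1"
    and psi: "is_GPSWF c \<alpha> \<psi>"
  shows "\<exists>a. \<forall>x\<in>I. (\<integral>y. e (c * x * y) * \<psi> n y \<partial>M) = a * \<psi> n x"
proof -
  let ?u = "\<lambda>x. \<integral>y. e (c * x * y) * \<psi> n y \<partial>M"
  obtain \<kappa> where \<kappa>: "strict_mono \<kappa>" "\<And>n. minus_L_eigenfunction c \<alpha> (\<kappa> n) (\<psi> n)"
    "\<And>k \<phi>. minus_L_eigenfunction c \<alpha> k \<phi> \<Longrightarrow> \<exists>n a. k = \<kappa> n \<and> (\<forall>x\<in>I. \<phi> x = a * \<psi> n x)"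
    using psi unfolding is_GPSWF_def by blast
  have v: "C2_data (\<psi> n) (deriv_I (\<psi> n)) (deriv_I (deriv_I (\<psi> n)))"
    using \<kappa>(2)[of n] by (intro C2_on_I_imp_C2_data) (simp add: minus_L_eigenfunction_def)
  have Lv: "L_data (\<psi> n) (deriv_I (\<psi> n)) (deriv_I (deriv_I (\<psi> n))) y = - \<kappa> n * \<psi> n y" if "y \<in> I" for y
  proof -
    have "- L_op c \<alpha> (\<psi> n) y = \<kappa> n * \<psi> n y"
      using \<kappa>(2)[of n] that unfolding minus_L_eigenfunction_def by blast
    then show ?thesis using C2_data_imp_C2_on_I(2)[OF v that] by simp
  qed
  obtain u1 u2 where u: "C2_data ?u u1 u2"
    and Lu: "\<And>x. L_data ?u u1 u2 x = (\<integral>y. e (c * x * y) * L_data (\<psi> n) (deriv_I (\<psi> n)) (deriv_I (deriv_I (\<psi> n))) y \<partial>M)"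
    using trig_transform_L[OF e e' B v] by blast
  have Lu': "L_data ?u u1 u2 x = - \<kappa> n * ?u x" for x
  proof -
    have "L_data ?u u1 u2 x = (\<integral>y. - \<kappa> n * (e (c * x * y) * \<psi> n y) \<partial>M)"
      unfolding Lu by (rule Bochner_Integration.integral_cong) (auto simp: Lv)
    then show ?thesis by simp
  qed
  show ?thesis
  proof (cases "\<exists>x\<in>I. ?u x \<noteq> 0")
    case True
    have "minus_L_eigenfunction c \<alpha> (\<kappa> n) ?u"
      unfolding minus_L_eigenfunction_def
      using True C2_data_imp_C2_on_I[OF u] Lu' by simp
    then obtain m a where "\<kappa> n = \<kappa> m" "\<forall>x\<in>I. ?u x = a * \<psi> m x" using \<kappa>(3) by blast
    \<comment> \<open>The index delivered by the exhaustion clause is pinned down by strict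
      monotonicity of the eigenvalues.\<close>
    moreover from this have "m = n" using \<kappa>(1) by (metis strict_mono_eq)
    ultimately show ?thesis by blast
  next
    case False
    then show ?thesis by (intro exI[of _ 0]) auto
  qed
qed

end

section \<open>The finite Fourier transform and the operator Q\<close>

context prolate
begin

lemma id_measurable_M: "(\<lambda>x. x) \<in> borel_measurable M"
  by (rule measurable_M_borel) simp

lemma fst_measurable_M [measurable]: "fst \<in> borel_measurable (M \<Otimes>\<^sub>M M)"
  by (rule measurable_compose[OF measurable_fst id_measurable_M])

lemma snd_measurable_M [measurable]: "snd \<in> borel_measurable (M \<Otimes>\<^sub>M M)"
  by (rule measurable_compose[OF measurable_snd id_measurable_M])

lemma set_integral_M:
  fixes f :: "real \<Rightarrow> complex"
  assumes "f \<in> borel_measurable M"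
  shows "(LINT y:I|lborel. f y * of_real (\<omega> \<alpha> y)) = (\<integral>y. f y \<partial>M)"
  using integral_M[OF assms] by (simp add: scaleR_conv_of_real mult.commute)

lemma continuous_on_iexp [continuous_intros]:
  "continuous_on A f \<Longrightarrow> continuous_on A (\<lambda>x. exp (\<i> * complex_of_real (f x)))"
  by (intro continuous_intros)

lemma iexp_measurable_M: "(\<lambda>y. exp (\<i> * complex_of_real (a * y))) \<in> borel_measurable M"
  by (intro measurable_M_continuous continuous_intros)

lemma F_c_eq:
  assumes [measurable]: "G \<in> borel_measurable M"
  shows "F_c c \<alpha> G x = (\<integral>y. exp (\<i> * of_real (c * x * y)) * G y \<partial>M)"
proof -
  have "(\<lambda>y. exp (\<i> * of_real (c * x * y)) * G y) \<in> borel_measurable M"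
    using iexp_measurable_M[of "c * x"] by measurable
  from set_integral_M[OF this] show ?thesis by (simp add: F_c_def)
qed

text \<open>The imaginary part is the integral of an odd function against an even weight.\<close>

lemma kernel_eq: "kernel \<alpha> s = of_real (kc s)"
  and kernel_integral: "kernel \<alpha> s = (\<integral>y. exp (\<i> * of_real (s * y)) \<partial>M)"
proof -
  show eq: "kernel \<alpha> s = (\<integral>y. exp (\<i> * of_real (s * y)) \<partial>M)"
    unfolding kernel_def by (rule set_integral_M[OF iexp_measurable_M])
  have i: "integrable M (\<lambda>y. exp (\<i> * complex_of_real (s * y)))"
    by (intro integrable_M_continuous continuous_intros)
  have "Re (kernel \<alpha> s) = kc s"
    unfolding eq kc_def integral_Re[OF i, symmetric] by (simp add: Re_exp)
  moreover have "Im (kernel \<alpha> s) = 0"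
  proof -
    have "Im (kernel \<alpha> s) = (\<integral>y. sin (s * y) \<partial>M)"
      unfolding eq integral_Im[OF i, symmetric] by (simp add: Im_exp)
    moreover have "(\<integral>y. sin (s * (- y)) \<partial>M) = (\<integral>y. sin (s * y) \<partial>M)"
      by (rule integral_M_reflect; intro continuous_intros)
    ultimately show ?thesis by simp
  qed
  ultimately show "kernel \<alpha> s = of_real (kc s)" by (simp add: complex_eq_iff)
qed

lemma Kf_measurable: "Kf x \<in> borel_measurable M"
  by (rule measurable_M_continuous[OF Kf_continuous(1)])

lemma Q_c_eq:
  assumes [measurable]: "G \<in> borel_measurable M"
  shows "Q_c c \<alpha> G x = (\<integral>y. of_real (Kf x y) * G y \<partial>M)"
proof -
  note [measurable] = Kf_measurable[of x]
  have "(\<lambda>y. of_real (Kf x y) * G y) \<in> borel_measurable M" by measurable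
  from set_integral_M[OF this] show ?thesis
    by (simp add: Q_c_def Kf_def kernel_eq)
qed

lemma L2w_I_iff: "G \<in> L2w I (\<omega> \<alpha>) \<longleftrightarrow> G \<in> borel_measurable M \<and> integrable M (\<lambda>x. (cmod (G x))\<^sup>2)"
proof -
  have "set_integrable lborel I (\<lambda>x. (cmod (G x))\<^sup>2 * \<omega> \<alpha> x) \<longleftrightarrow> integrable M (\<lambda>x. (cmod (G x))\<^sup>2)"
    if [measurable]: "G \<in> borel_measurable M"
    by (subst integrable_M) (auto simp: mult.commute)
  then show ?thesis unfolding L2w_def mem_Collect_eq set_borel_measurable_iff_M by blast
qed

lemma L2_norm_sq_I:
  assumes [measurable]: "G \<in> borel_measurable M"
  shows "L2_norm_sq I (\<omega> \<alpha>) G = (\<integral>x. (cmod (G x))\<^sup>2 \<partial>M)"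
  unfolding L2_norm_sq_def by (subst integral_M) (auto simp: mult.commute)

lemma L2w_I_ReIm:
  assumes "G \<in> L2w I (\<omega> \<alpha>)"
  shows "(\<lambda>x. Re (G x)) \<in> HS" "(\<lambda>x. Im (G x)) \<in> HS" "integrable M G"
    "(\<integral>x. (cmod (G x))\<^sup>2 \<partial>M) = ip (\<lambda>x. Re (G x)) (\<lambda>x. Re (G x)) + ip (\<lambda>x. Im (G x)) (\<lambda>x. Im (G x))"
proof -
  have [measurable]: "G \<in> borel_measurable M" and G2: "integrable M (\<lambda>x. (cmod (G x))\<^sup>2)" using assms by (auto simp: L2w_I_iff)
  have "integrable M (\<lambda>x. (Re (G x))\<^sup>2)" "integrable M (\<lambda>x. (Im (G x))\<^sup>2)"
    by (rule Bochner_Integration.integrable_bound[OF G2]; simp add: cmod_Re_Im_square)+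
  then show R: "(\<lambda>x. Re (G x)) \<in> HS" and S: "(\<lambda>x. Im (G x)) \<in> HS" by (auto simp: HS_def)
  have "integrable M (\<lambda>x. of_real (Re (G x)) + \<i> * of_real (Im (G x)))"
    using HS_integrable[OF R] HS_integrable[OF S] by (intro Bochner_Integration.integrable_add integrable_mult_right integrable_of_real)
  then show "integrable M G" by (simp add: complex_eq[symmetric])
  show "(\<integral>x. (cmod (G x))\<^sup>2 \<partial>M) = ip (\<lambda>x. Re (G x)) (\<lambda>x. Re (G x)) + ip (\<lambda>x. Im (G x)) (\<lambda>x. Im (G x))"
    unfolding cmod_Re_Im_square unfolding ip_def power2_eq_square
    by (rule Bochner_Integration.integral_add[OF HS_integrable_mult[OF R R] HS_integrable_mult[OF S S]])
qed

lemma L2w_I_of_real: "v \<in> HS \<Longrightarrow> (\<lambda>x. of_real (v x)) \<in> L2w I (\<omega> \<alpha>)"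
  by (auto simp: L2w_I_iff HS_def)

lemma L2w_I_cnj: "G \<in> L2w I (\<omega> \<alpha>) \<Longrightarrow> (\<lambda>x. cnj (G x)) \<in> L2w I (\<omega> \<alpha>)"
  by (auto simp: L2w_I_iff)

lemma Q_c_ReIm:
  assumes G: "G \<in> L2w I (\<omega> \<alpha>)"
  shows "Q_c c \<alpha> G x = of_real (Qr (\<lambda>y. Re (G y)) x) + \<i> * of_real (Qr (\<lambda>y. Im (G y)) x)"
proof -
  have m: "G \<in> borel_measurable M" using G by (simp add: L2w_I_iff)
  note i = integrable_bounded_mult[OF Kf_continuous(1) HS_integrable[OF L2w_I_ReIm(1)[OF G]], of x]
    integrable_bounded_mult[OF Kf_continuous(1) HS_integrable[OF L2w_I_ReIm(2)[OF G]], of x]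
  have "Q_c c \<alpha> G x = (\<integral>y. of_real (Kf x y * Re (G y)) + \<i> * of_real (Kf x y * Im (G y)) \<partial>M)"
    unfolding Q_c_eq[OF m] by (rule Bochner_Integration.integral_cong) (auto simp: complex_eq_iff)
  also have "\<dots> = of_real (Qr (\<lambda>y. Re (G y)) x) + \<i> * of_real (Qr (\<lambda>y. Im (G y)) x)"
    unfolding Qr_def using i by (subst Bochner_Integration.integral_add) (auto simp del: of_real_mult)
  finally show ?thesis .
qed

lemma Q_c_of_real: "v \<in> HS \<Longrightarrow> Q_c c \<alpha> (\<lambda>y. of_real (v y)) x = of_real (Qr v x)"
  using Q_c_ReIm[OF L2w_I_of_real, of v x] by (simp add: Qr_def)

lemma norm_iexp_kernel [simp]: "cmod (exp (\<i> * of_real a)) = 1"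
  by (rule norm_exp_i_times)

lemma F_c_measurable:
  assumes [measurable]: "G \<in> borel_measurable M"
  shows "F_c c \<alpha> G \<in> borel_measurable M"
proof -
  have "(\<lambda>x. \<integral>y. exp (\<i> * of_real (c * x * y)) * G y \<partial>M) \<in> borel_measurable M"
  proof (rule M.borel_measurable_lebesgue_integral)
    have "(\<lambda>p. exp (\<i> * of_real (c * fst p * snd p)) * G (snd p)) \<in> borel_measurable (M \<Otimes>\<^sub>M M)" by measurable
    then show "(\<lambda>(x, y). exp (\<i> * of_real (c * x * y)) * G y) \<in> borel_measurable (M \<Otimes>\<^sub>M M)"
      by (simp add: case_prod_beta)
  qed
  then show ?thesis by (simp add: F_c_eq[OF assms, abs_def])
qed

lemma F_c_bounded:
  assumes "integrable M G"
  shows "cmod (F_c c \<alpha> G x) \<le> (\<integral>y. cmod (G y) \<partial>M)"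
proof -
  have "G \<in> borel_measurable M" using assms by auto
  from F_c_eq[OF this] show ?thesis
    by (simp only:) (rule order_trans[OF integral_norm_bound], simp add: norm_mult)
qed

text \<open>\<open>exp (i c (x - y) t)\<close> splits into a factor in \<open>x\<close> and a
  conjugate factor in \<open>y\<close>, so \<open>Q\<close> is \<open>c / (2 * pi)\<close> times the
  finite Fourier transform after its adjoint. The adjoint is expressed by conjugating before and
  after, since the kernel is symmetric.\<close>

lemma Q_c_factorization:
  assumes G: "integrable M G"
  shows "Q_c c \<alpha> G x = of_real (c / (2 * pi)) * F_c c \<alpha> (\<lambda>t. cnj (F_c c \<alpha> (\<lambda>y. cnj (G y)) t)) x"
proof -
  have m[measurable]: "G \<in> borel_measurable M" using G by auto
  have mc: "(\<lambda>y. cnj (G y)) \<in> borel_measurable M" by measurable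
  have "Q_c c \<alpha> G x = of_real (c / (2 * pi)) * (\<integral>y. G y * (\<integral>t. exp (\<i> * of_real (c * (x - y) * t)) * 1 \<partial>M) \<partial>M)"
    unfolding Q_c_eq[OF m] Kf_def of_real_mult kernel_eq[symmetric] kernel_integral integral_mult_right_zero[symmetric]
    by (rule Bochner_Integration.integral_cong) (auto simp: mult_ac)
  also have "(\<integral>y. G y * (\<integral>t. exp (\<i> * of_real (c * (x - y) * t)) * 1 \<partial>M) \<partial>M)
    = (\<integral>t. 1 * (\<integral>y. exp (\<i> * of_real (c * (x - y) * t)) * G y \<partial>M) \<partial>M)"
    by (rule Fubini_bounded_kernel[where B=1])
       (use G in \<open>auto intro!: M.sigma_finite_measure_axioms\<close>)
  also have "\<dots> = (\<integral>t. exp (\<i> * of_real (c * x * t)) * cnj (F_c c \<alpha> (\<lambda>y. cnj (G y)) t) \<partial>M)"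
  proof (rule Bochner_Integration.integral_cong[OF refl])
    fix t
    have "cnj (F_c c \<alpha> (\<lambda>y. cnj (G y)) t) = (\<integral>y. cnj (exp (\<i> * of_real (c * t * y)) * cnj (G y)) \<partial>M)"
      unfolding F_c_eq[OF mc] by (rule Bochner_Integration.integral_cnj[symmetric])
    then have "exp (\<i> * of_real (c * x * t)) * cnj (F_c c \<alpha> (\<lambda>y. cnj (G y)) t)
      = (\<integral>y. exp (\<i> * of_real (c * x * t)) * cnj (exp (\<i> * of_real (c * t * y)) * cnj (G y)) \<partial>M)"
      by simp
    also have "\<dots> = (\<integral>y. exp (\<i> * of_real (c * (x - y) * t)) * G y \<partial>M)"
    proof (rule Bochner_Integration.integral_cong[OF refl])
      fix y
      have "exp (\<i> * of_real (c * x * t)) * exp (- (\<i> * of_real (c * t * y))) = exp (\<i> * of_real (c * (x - y) * t))"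
        by (simp add: exp_add[symmetric] algebra_simps)
      then show "exp (\<i> * of_real (c * x * t)) * cnj (exp (\<i> * of_real (c * t * y)) * cnj (G y)) = exp (\<i> * of_real (c * (x - y) * t)) * G y"
        by (simp add: exp_cnj)
    qed
    finally show "1 * (\<integral>y. exp (\<i> * of_real (c * (x - y) * t)) * G y \<partial>M) = exp (\<i> * of_real (c * x * t)) * cnj (F_c c \<alpha> (\<lambda>y. cnj (G y)) t)"
      by simp
  qed
  also have "\<dots> = F_c c \<alpha> (\<lambda>t. cnj (F_c c \<alpha> (\<lambda>y. cnj (G y)) t)) x"
    by (rule F_c_eq[symmetric]) (use F_c_measurable[OF mc] in measurable)
  finally show ?thesis .
qed

text \<open>The quadratic form of \<open>Q\<close> as an energy of the finite Fourier transform: it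
  gives positivity of \<open>Q\<close> and is later the numerator of the energy ratio. Pairing
  \<open>G\<close> with the image of its conjugate lets the symmetry of the kernel move one
  transform across.\<close>

lemma F_c_energy:
  assumes G: "G \<in> L2w I (\<omega> \<alpha>)"
  shows "c / (2 * pi) * (\<integral>x. (cmod (F_c c \<alpha> G x))\<^sup>2 \<partial>M)
    = ip (Qr (\<lambda>y. Re (G y))) (\<lambda>y. Re (G y)) + ip (Qr (\<lambda>y. Im (G y))) (\<lambda>y. Im (G y))"
proof -
  have m[measurable]: "G \<in> borel_measurable M" using G by (simp add: L2w_I_iff)
  note iG = L2w_I_ReIm(3)[OF G]
  define H where "H t = cnj (F_c c \<alpha> G t)" for t
  have mF: "F_c c \<alpha> G \<in> borel_measurable M" by (rule F_c_measurable[OF m])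
  have mH: "H \<in> borel_measurable M" unfolding H_def using mF by measurable
  have iH: "integrable M H"
    by (rule integrable_M_bounded[OF mH, where B="\<integral>y. cmod (G y) \<partial>M"]) (auto simp: H_def intro!: F_c_bounded iG)
  let ?P = "\<lambda>y. Re (G y)" and ?R = "\<lambda>y. Im (G y)"
  have "(\<integral>y. G y * Q_c c \<alpha> (\<lambda>y. cnj (G y)) y \<partial>M) = of_real (c / (2 * pi)) * (\<integral>y. G y * (\<integral>t. exp (\<i> * of_real (c * y * t)) * H t \<partial>M) \<partial>M)"
  proof -
    have "Q_c c \<alpha> (\<lambda>y. cnj (G y)) y = of_real (c / (2 * pi)) * (\<integral>t. exp (\<i> * of_real (c * y * t)) * H t \<partial>M)" for y
      using Q_c_factorization[OF L2w_I_ReIm(3)[OF L2w_I_cnj[OF G]], of y] F_c_eq[OF mH, of y] by (simp add: H_def[abs_def])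
    then show ?thesis by (simp add: mult.left_commute[of "G _"])
  qed
  also have "(\<integral>y. G y * (\<integral>t. exp (\<i> * of_real (c * y * t)) * H t \<partial>M) \<partial>M)
    = (\<integral>t. H t * (\<integral>y. exp (\<i> * of_real (c * y * t)) * G y \<partial>M) \<partial>M)"
    by (rule Fubini_bounded_kernel[where B=1])
       (use iG iH in \<open>auto intro!: M.sigma_finite_measure_axioms\<close>)
  also have "\<dots> = (\<integral>t. of_real ((cmod (F_c c \<alpha> G t))\<^sup>2) \<partial>M)"
  proof (rule Bochner_Integration.integral_cong[OF refl])
    fix t
    have "(\<integral>y. exp (\<i> * of_real (c * y * t)) * G y \<partial>M) = F_c c \<alpha> G t"
      unfolding F_c_eq[OF m] by (simp add: mult_ac)
    then show "H t * (\<integral>y. exp (\<i> * of_real (c * y * t)) * G y \<partial>M) = of_real ((cmod (F_c c \<alpha> G t))\<^sup>2)"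
      unfolding H_def complex_norm_square by (simp add: mult.commute)
  qed
  also have "of_real (c / (2 * pi)) * \<dots> = complex_of_real (c / (2 * pi) * (\<integral>t. (cmod (F_c c \<alpha> G t))\<^sup>2 \<partial>M))"
    unfolding integral_complex_of_real of_real_mult ..
  finally have eq: "(\<integral>y. G y * Q_c c \<alpha> (\<lambda>y. cnj (G y)) y \<partial>M) = complex_of_real (c / (2 * pi) * (\<integral>t. (cmod (F_c c \<alpha> G t))\<^sup>2 \<partial>M))" .
  have QHS: "Qr v \<in> HS" if "v \<in> HS" for v
    by (rule HS_continuous[OF C2_data_continuous(1)[OF C2_data_Qr[OF HS_integrable[OF that]]]])
  note hP = L2w_I_ReIm(1)[OF G] and hR = L2w_I_ReIm(2)[OF G]
  have Qcnj: "Q_c c \<alpha> (\<lambda>y. cnj (G y)) y = of_real (Qr ?P y) - \<i> * of_real (Qr ?R y)" for y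
    using Q_c_ReIm[OF L2w_I_cnj[OF G], of y] by (simp add: Qr_def)
  have "integrable M (\<lambda>y. of_real (?P y * Qr ?P y + ?R y * Qr ?R y) + \<i> * of_real (?R y * Qr ?P y - ?P y * Qr ?R y))"
    by (intro Bochner_Integration.integrable_add integrable_mult_right integrable_of_real Bochner_Integration.integrable_diff HS_integrable_mult QHS hP hR)
  \<comment> \<open>The products mixing real and imaginary parts appear only in the imaginary part
    of the integrand, so taking real parts leaves the two real quadratic forms.\<close>
  moreover have "of_real (?P y * Qr ?P y + ?R y * Qr ?R y) + \<i> * of_real (?R y * Qr ?P y - ?P y * Qr ?R y) = G y * Q_c c \<alpha> (\<lambda>y. cnj (G y)) y" for y
    unfolding Qcnj by (simp add: complex_eq_iff)
  ultimately have iGQ: "integrable M (\<lambda>y. G y * Q_c c \<alpha> (\<lambda>y. cnj (G y)) y)" by simp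
  have "c / (2 * pi) * (\<integral>t. (cmod (F_c c \<alpha> G t))\<^sup>2 \<partial>M) = Re (\<integral>y. G y * Q_c c \<alpha> (\<lambda>y. cnj (G y)) y \<partial>M)"
    unfolding eq by simp
  also have "\<dots> = (\<integral>y. Re (G y * Q_c c \<alpha> (\<lambda>y. cnj (G y)) y) \<partial>M)" by (rule integral_Re[OF iGQ, symmetric])
  also have "\<dots> = (\<integral>y. Qr ?P y * ?P y + Qr ?R y * ?R y \<partial>M)"
    unfolding Qcnj by (rule Bochner_Integration.integral_cong) (auto simp: mult.commute)
  also have "\<dots> = ip (Qr ?P) ?P + ip (Qr ?R) ?R"
    unfolding ip_def by (intro Bochner_Integration.integral_add HS_integrable_mult QHS hP hR)
  finally show ?thesis .
qed

lemma Qr_HS: "v \<in> HS \<Longrightarrow> Qr v \<in> HS"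
  by (rule HS_continuous[OF C2_data_continuous(1)[OF C2_data_Qr[OF HS_integrable]]])

lemma Qr_symmetric:
  assumes u: "u \<in> HS" and v: "v \<in> HS"
  shows "ip (Qr u) v = ip u (Qr v)"
proof -
  have iu: "integrable M (\<lambda>x. complex_of_real (u x))" and iv: "integrable M (\<lambda>x. complex_of_real (v x))"
    using HS_integrable[OF u] HS_integrable[OF v] by auto
  have mk: "(\<lambda>(x, y). complex_of_real (Kf x y)) \<in> borel_measurable (M \<Otimes>\<^sub>M M)"
  proof -
    have "(\<lambda>p. complex_of_real (c / (2 * pi) * kc (c * (fst p - snd p)))) \<in> borel_measurable (M \<Otimes>\<^sub>M M)"
    proof -
      have [measurable]: "kc \<in> borel_measurable borel"
        by (intro borel_measurable_continuous_onI deriv_imp_continuous_on[OF kc_deriv])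
      show ?thesis by measurable
    qed
    then show ?thesis unfolding Kf_def case_prod_beta .
  qed
  \<comment> \<open>The exchange is done over the complex numbers, to which
    \<open>Fubini_bounded_kernel\<close> applies, and read back for real functions.\<close>
  have "(\<integral>x. of_real (v x) * (\<integral>y. complex_of_real (Kf x y) * of_real (u y) \<partial>M) \<partial>M)
    = (\<integral>y. of_real (u y) * (\<integral>x. complex_of_real (Kf x y) * of_real (v x) \<partial>M) \<partial>M)"
    by (rule Fubini_bounded_kernel[where B=BK])
       (use iu iv mk Kf_bounds(1) in \<open>auto intro!: M.sigma_finite_measure_axioms\<close>)
  moreover have "(\<integral>y. complex_of_real (Kf x y) * of_real (u y) \<partial>M) = of_real (Qr u x)" for x
    unfolding Qr_def integral_complex_of_real[symmetric] by simp
  moreover have "(\<integral>x. complex_of_real (Kf x y) * of_real (v x) \<partial>M) = of_real (Qr v y)" for y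
    unfolding Qr_def integral_complex_of_real[symmetric] by (simp add: Kf_commute[of _ y])
  ultimately have "complex_of_real (\<integral>x. v x * Qr u x \<partial>M) = of_real (\<integral>y. u y * Qr v y \<partial>M)"
    unfolding integral_complex_of_real[symmetric] by simp
  then show ?thesis unfolding ip_def by (simp add: mult.commute)
qed

text \<open>Turns almost everywhere equations between continuous functions into equations at every
  point of \<open>I\<close>, endpoints included.\<close>

lemma continuous_AE_zero:
  assumes c: "continuous_on I f" and z: "AE x in M. f x = (0::real)" and x: "x \<in> I"
  shows "f x = 0"
proof -
  have cb: "continuous_on I (\<lambda>x. \<bar>f x\<bar>)" using c by (intro continuous_intros)
  have si: "set_integrable lborel I (\<lambda>x. \<bar>f x\<bar>)"
    using borel_integrable_compact[OF _ cb] by (simp add: set_integrable_def)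
  have "(LINT x:I|lborel. \<bar>f x\<bar>) = 0"
    unfolding set_lebesgue_integral_def
    by (rule integral_eq_zero_AE) (use z[unfolded AE_M] in \<open>auto simp: indicator_def\<close>)
  with set_borel_integral_eq_integral[OF si] have "((\<lambda>x. \<bar>f x\<bar>) has_integral 0) I"
    by (simp add: has_integral_iff)
  then have "\<bar>f x\<bar> = 0"
    using has_integral_0_cbox_imp_0[of "-1" 1 "\<lambda>x. \<bar>f x\<bar>" x] cb x by auto
  then show ?thesis by simp
qed

end

section \<open>Compactness, injectivity and the top eigenvalue\<close>

context prolate
begin

lemma uniform_imp_L2_convergent:
  fixes f :: "nat \<Rightarrow> real \<Rightarrow> complex"
  assumes m: "\<And>n. f n \<in> borel_measurable M" "h \<in> borel_measurable M"
    and u: "\<And>e. e > 0 \<Longrightarrow> \<exists>N. \<forall>n x. n \<ge> N \<and> x \<in> I \<longrightarrow> norm (f n x - h x) < e"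
  shows "(\<lambda>n. \<integral>x. (cmod (f n x - h x))\<^sup>2 \<partial>M) \<longlonglongrightarrow> 0"
proof (rule LIMSEQ_I)
  fix e :: real assume e: "0 < e"
  note [measurable] = m
  let ?m = "measure M I"
  \<comment> \<open>Chosen so that a uniform error \<open>d\<close> has squared L2 size
    \<open>e / 2\<close>.\<close>
  define d where "d = sqrt (e / (2 * ?m))"
  have d: "d > 0" "d\<^sup>2 * ?m = e / 2" using e measure_M_pos by (auto simp: d_def)
  obtain N where N: "\<And>n x. n \<ge> N \<Longrightarrow> x \<in> I \<Longrightarrow> norm (f n x - h x) < d" using u[OF d(1)] by blast
  show "\<exists>no. \<forall>n\<ge>no. norm ((\<integral>x. (cmod (f n x - h x))\<^sup>2 \<partial>M) - 0) < e"
  proof (intro exI allI impI)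
    fix n assume n: "N \<le> n"
    have bd: "(cmod (f n x - h x))\<^sup>2 \<le> d\<^sup>2" if "x \<in> I" for x
      using N[OF n that] d(1) by (intro power_mono) auto
    have "(\<integral>x. (cmod (f n x - h x))\<^sup>2 \<partial>M) \<le> (\<integral>x. d\<^sup>2 \<partial>M)"
      by (rule integral_mono) (use bd in \<open>auto intro!: integrable_M_bounded[where B="d\<^sup>2"]\<close>)
    also have "\<dots> = e / 2" using d(2) by (simp add: mult.commute)
    finally show "norm ((\<integral>x. (cmod (f n x - h x))\<^sup>2 \<partial>M) - 0) < e" using e by simp
  qed
qed

lemma HS_L1_le_sqrt: "v \<in> HS \<Longrightarrow> ip v v \<le> C \<Longrightarrow> (\<integral>x. \<bar>v x\<bar> \<partial>M) \<le> sqrt (measure M I * C)"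
  by (rule real_le_rsqrt) (rule order_trans[OF HS_L1_le], auto intro: mult_left_mono)

lemma Q_c_continuous: "G \<in> L2w I (\<omega> \<alpha>) \<Longrightarrow> continuous_on I (Q_c c \<alpha> G)"
proof -
  assume G: "G \<in> L2w I (\<omega> \<alpha>)"
  have "continuous_on I (\<lambda>x. of_real (Qr (\<lambda>y. Re (G y)) x) + \<i> * of_real (Qr (\<lambda>y. Im (G y)) x))"
    by (intro continuous_intros C2_data_continuous(1)[OF C2_data_Qr[OF HS_integrable]] L2w_I_ReIm[OF G])
  then show ?thesis by (simp add: Q_c_ReIm[OF G])
qed

text \<open>An L2 bound is an L1 bound on a finite measure, so the images are uniformly bounded and
  uniformly Lipschitz. Convergence is uniform, which is more than compactness in L2 and lets limits
  be identified pointwise.\<close>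

lemma Q_c_subconvergent:
  assumes u: "\<And>n. u n \<in> L2w I (\<omega> \<alpha>)" and C: "\<And>n. (\<integral>x. (cmod (u n x))\<^sup>2 \<partial>M) \<le> C"
  shows "\<exists>r h. strict_mono (r :: nat \<Rightarrow> nat) \<and> continuous_on I h \<and>
    (\<forall>e>0. \<exists>N. \<forall>n x. n \<ge> N \<and> x \<in> I \<longrightarrow> norm (Q_c c \<alpha> (u (r n)) x - h x) < e)"
proof -
  define N where "N = sqrt (measure M I * C)"
  let ?P = "\<lambda>n y. Re (u n y)" and ?R = "\<lambda>n y. Im (u n y)"
  note hs = L2w_I_ReIm(1)[OF u] L2w_I_ReIm(2)[OF u]
  have PR: "(\<integral>x. \<bar>?P n x\<bar> \<partial>M) \<le> N" "(\<integral>x. \<bar>?R n x\<bar> \<partial>M) \<le> N" for n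
    unfolding N_def using L2w_I_ReIm(4)[OF u, of n] C[of n] HS.ip_nonneg[OF hs(1), of n] HS.ip_nonneg[OF hs(2), of n]
    by (auto intro!: HS_L1_le_sqrt hs)
  have b: "\<bar>Qr v x\<bar> \<le> BK * N" "\<bar>Qr v x - Qr v y\<bar> \<le> BK * N * \<bar>x - y\<bar>"
    if v: "v \<in> HS" and n: "(\<integral>x. \<bar>v x\<bar> \<partial>M) \<le> N" for v x y
  proof -
    have le: "BK * (\<integral>x. \<bar>v x\<bar> \<partial>M) \<le> BK * N" using n BK_nonneg by (rule mult_left_mono)
    show "\<bar>Qr v x\<bar> \<le> BK * N" using Qr_bounds(1)[OF HS_integrable[OF v], of x] le by linarith
    show "\<bar>Qr v x - Qr v y\<bar> \<le> BK * N * \<bar>x - y\<bar>"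
      by (rule order_trans[OF Qr_bounds(2)[OF HS_integrable[OF v]] mult_right_mono[OF le]]) simp
  qed
  have nrm: "cmod (of_real a + \<i> * of_real b) \<le> \<bar>a\<bar> + \<bar>b\<bar>" for a b
    using norm_triangle_ineq[of "complex_of_real a" "\<i> * of_real b"] by (simp add: norm_mult)
  obtain r h where "strict_mono (r :: nat \<Rightarrow> nat)" "continuous_on I h"
    "\<And>e. e > 0 \<Longrightarrow> \<exists>N. \<forall>n x. n \<ge> N \<and> x \<in> I \<longrightarrow> norm (Q_c c \<alpha> (u (r n)) x - h x) < e"
  \<comment> \<open>Real and imaginary part each contribute \<open>BK * N\<close>.\<close>
  proof (rule Lipschitz_sequence_subconvergent[of I "\<lambda>n. Q_c c \<alpha> (u n)" "2 * (BK * N)"])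
    show "norm (Q_c c \<alpha> (u n) x) \<le> 2 * (BK * N)" for n x
      unfolding Q_c_ReIm[OF u]
      by (rule order_trans[OF nrm]) (use b(1)[OF hs(1) PR(1), of n x] b(1)[OF hs(2) PR(2), of n x] in linarith)
    show "norm (Q_c c \<alpha> (u n) x - Q_c c \<alpha> (u n) y) \<le> 2 * (BK * N) * \<bar>x - y\<bar>" for n x y
    proof -
      have "Q_c c \<alpha> (u n) x - Q_c c \<alpha> (u n) y = of_real (Qr (?P n) x - Qr (?P n) y) + \<i> * of_real (Qr (?R n) x - Qr (?R n) y)"
        unfolding Q_c_ReIm[OF u] by (simp add: algebra_simps)
      then have "norm (Q_c c \<alpha> (u n) x - Q_c c \<alpha> (u n) y) \<le> \<bar>Qr (?P n) x - Qr (?P n) y\<bar> + \<bar>Qr (?R n) x - Qr (?R n) y\<bar>"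
        by (simp only: nrm)
      then show ?thesis using b(2)[OF hs(1) PR(1), of n x y] b(2)[OF hs(2) PR(2), of n x y] by linarith
    qed
  qed (use that in auto)
  then show ?thesis by (intro exI[of _ r] exI[of _ h] conjI allI impI)
qed

lemma L2w_I_continuous: "continuous_on I h \<Longrightarrow> h \<in> L2w I (\<omega> \<alpha>)"
  unfolding L2w_I_iff by (auto intro!: measurable_M_continuous integrable_M_continuous continuous_intros)

lemma Q_c_linear:
  assumes f: "f \<in> L2w I (\<omega> \<alpha>)" and g: "g \<in> L2w I (\<omega> \<alpha>)"
  shows "Q_c c \<alpha> (\<lambda>t. a * f t + b * g t) x = a * Q_c c \<alpha> f x + b * Q_c c \<alpha> g x"
proof -
  have m[measurable]: "f \<in> borel_measurable M" "g \<in> borel_measurable M" using f g by (auto simp: L2w_I_iff)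
  have i: "integrable M (\<lambda>y. of_real (Kf x y) * h y)" if h: "h \<in> L2w I (\<omega> \<alpha>)" for h :: "real \<Rightarrow> complex"
  proof (rule Bochner_Integration.integrable_bound[of _ "\<lambda>y. BK * cmod (h y)"])
    show "integrable M (\<lambda>y. BK * cmod (h y))" using L2w_I_ReIm(3)[OF h] by simp
    have [measurable]: "h \<in> borel_measurable M" "Kf x \<in> borel_measurable M" using h Kf_measurable by (auto simp: L2w_I_iff)
    show "(\<lambda>y. of_real (Kf x y) * h y) \<in> borel_measurable M" by measurable
    show "AE y in M. norm (of_real (Kf x y) * h y) \<le> norm (BK * cmod (h y))"
      using Kf_bounds(1)[of x] BK_nonneg by (auto simp: norm_mult abs_mult intro!: AE_I2 mult_right_mono)
  qed
  have "(\<lambda>t. a * f t + b * g t) \<in> borel_measurable M" by measurable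
  then have "Q_c c \<alpha> (\<lambda>t. a * f t + b * g t) x = (\<integral>y. a * (of_real (Kf x y) * f y) + b * (of_real (Kf x y) * g y) \<partial>M)"
    by (simp add: Q_c_eq algebra_simps)
  also have "\<dots> = a * Q_c c \<alpha> f x + b * Q_c c \<alpha> g x"
    unfolding Q_c_eq[OF m(1)] Q_c_eq[OF m(2)] using i[OF f] i[OF g] by simp
  finally show ?thesis .
qed

lemma compact_Q_c: "compact_L2_operator I (\<omega> \<alpha>) (Q_c c \<alpha>)"
  unfolding compact_L2_operator_def
proof (intro conjI ballI allI impI)
  fix f assume "f \<in> L2w I (\<omega> \<alpha>)"
  then show "Q_c c \<alpha> f \<in> L2w I (\<omega> \<alpha>)" by (rule L2w_I_continuous[OF Q_c_continuous])
next
  fix f g a b assume "f \<in> L2w I (\<omega> \<alpha>)" "g \<in> L2w I (\<omega> \<alpha>)"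
  then show "AE x in lborel. x \<in> I \<longrightarrow> Q_c c \<alpha> (\<lambda>t. a * f t + b * g t) x = a * Q_c c \<alpha> f x + b * Q_c c \<alpha> g x"
    by (simp add: Q_c_linear)
next
  fix u :: "nat \<Rightarrow> real \<Rightarrow> complex"
  assume "(\<forall>n. u n \<in> L2w I (\<omega> \<alpha>)) \<and> (\<exists>C. \<forall>n. L2_norm_sq I (\<omega> \<alpha>) (u n) \<le> C)"
  then obtain C where u: "\<And>n. u n \<in> L2w I (\<omega> \<alpha>)" and C: "\<And>n. L2_norm_sq I (\<omega> \<alpha>) (u n) \<le> C" by blast
  have C': "(\<integral>x. (cmod (u n x))\<^sup>2 \<partial>M) \<le> C" for n
    using C[of n] u[of n] by (simp add: L2_norm_sq_I L2w_I_iff)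
  obtain r h where r: "strict_mono (r :: nat \<Rightarrow> nat)" and h: "continuous_on I h"
    and conv: "\<forall>e>0. \<exists>N. \<forall>n x. n \<ge> N \<and> x \<in> I \<longrightarrow> norm (Q_c c \<alpha> (u (r n)) x - h x) < e"
    using Q_c_subconvergent[of u, OF u C'] by (elim exE conjE)
  have m[measurable]: "Q_c c \<alpha> (u (r n)) \<in> borel_measurable M" "h \<in> borel_measurable M" for n
    by (intro measurable_M_continuous Q_c_continuous u h)+
  have "(\<lambda>n. \<integral>x. (cmod (Q_c c \<alpha> (u (r n)) x - h x))\<^sup>2 \<partial>M) \<longlonglongrightarrow> 0"
    by (rule uniform_imp_L2_convergent[OF m conv[rule_format]])
  moreover have "L2_norm_sq I (\<omega> \<alpha>) (\<lambda>x. Q_c c \<alpha> (u (r n)) x - h x) = (\<integral>x. (cmod (Q_c c \<alpha> (u (r n)) x - h x))\<^sup>2 \<partial>M)" for n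
    by (rule L2_norm_sq_I) measurable
  ultimately show "\<exists>r h. strict_mono r \<and> h \<in> L2w I (\<omega> \<alpha>) \<and> (\<lambda>n. L2_norm_sq I (\<omega> \<alpha>) (\<lambda>x. Q_c c \<alpha> (u (r n)) x - h x)) \<longlonglongrightarrow> 0"
    using r L2w_I_continuous[OF h] by (intro exI[of _ r] exI[of _ h]) simp
qed

lemma Qr_subconvergent:
  assumes u: "\<And>n. u n \<in> HS" and C: "\<And>n. ip (u n) (u n) \<le> C"
  shows "\<exists>r h. strict_mono (r :: nat \<Rightarrow> nat) \<and> continuous_on I h \<and>
    (\<forall>e>0. \<exists>N. \<forall>n x. n \<ge> N \<and> x \<in> I \<longrightarrow> \<bar>Qr (u (r n)) x - h x\<bar> < e)"
proof -
  have uc: "(\<lambda>x. complex_of_real (u n x)) \<in> L2w I (\<omega> \<alpha>)" for n by (rule L2w_I_of_real[OF u])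
  have Cc: "(\<integral>x. (cmod (complex_of_real (u n x)))\<^sup>2 \<partial>M) \<le> C" for n
    using C[of n] by (simp add: ip_def power2_eq_square)
  obtain r h where r: "strict_mono (r :: nat \<Rightarrow> nat)" and h: "continuous_on I h"
    and conv: "\<forall>e>0. \<exists>N. \<forall>n x. n \<ge> N \<and> x \<in> I \<longrightarrow> norm (Q_c c \<alpha> (\<lambda>y. complex_of_real (u (r n) y)) x - h x) < e"
    using Q_c_subconvergent[of "\<lambda>n x. complex_of_real (u n x)", OF uc Cc] by (elim exE conjE)
  have "\<bar>Qr (u (r n)) x - Re (h x)\<bar> \<le> norm (Q_c c \<alpha> (\<lambda>y. complex_of_real (u (r n) y)) x - h x)" for n x
    using abs_Re_le_cmod[of "Q_c c \<alpha> (\<lambda>y. complex_of_real (u (r n) y)) x - h x"] by (simp add: Q_c_of_real[OF u])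
  note le = this
  have conv': "\<exists>N. \<forall>n x. n \<ge> N \<and> x \<in> I \<longrightarrow> \<bar>Qr (u (r n)) x - Re (h x)\<bar> < e" if e: "e > 0" for e
  proof -
    obtain N where N: "\<forall>n x. n \<ge> N \<and> x \<in> I \<longrightarrow> norm (Q_c c \<alpha> (\<lambda>y. complex_of_real (u (r n) y)) x - h x) < e"
      using conv e by blast
    show ?thesis
    proof (intro exI[of _ N] allI impI)
      fix n x assume "n \<ge> N \<and> x \<in> I"
      with N have "norm (Q_c c \<alpha> (\<lambda>y. complex_of_real (u (r n) y)) x - h x) < e" by simp
      then show "\<bar>Qr (u (r n)) x - Re (h x)\<bar> < e" using le[of n x] by linarith
    qed
  qed
  have "continuous_on I (\<lambda>x. Re (h x))" using h by (intro continuous_intros)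
  with r conv' show ?thesis by (intro exI[of _ r] exI[of _ "\<lambda>x. Re (h x)"] conjI allI impI)
qed

lemma uniform_imp_ip_convergent:
  assumes f: "\<And>n. f n \<in> HS" and h: "h \<in> HS"
    and u: "\<And>e. e > 0 \<Longrightarrow> \<exists>N. \<forall>n x. n \<ge> N \<and> x \<in> I \<longrightarrow> \<bar>f n x - h x\<bar> < e"
  shows "(\<lambda>n. ip (lincomb 1 (f n) (-1) h) (lincomb 1 (f n) (-1) h)) \<longlonglongrightarrow> 0"
proof -
  have m: "(\<lambda>x. complex_of_real (f n x)) \<in> borel_measurable M" "(\<lambda>x. complex_of_real (h x)) \<in> borel_measurable M" for n
  proof -
    have [measurable]: "f n \<in> borel_measurable M" "h \<in> borel_measurable M" using f[of n] h by (auto simp: HS_def)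
    show "(\<lambda>x. complex_of_real (f n x)) \<in> borel_measurable M" "(\<lambda>x. complex_of_real (h x)) \<in> borel_measurable M"
      by measurable
  qed
  have "(\<lambda>n. \<integral>x. (cmod (complex_of_real (f n x) - complex_of_real (h x)))\<^sup>2 \<partial>M) \<longlonglongrightarrow> 0"
  proof (rule uniform_imp_L2_convergent[OF m])
    show "\<exists>N. \<forall>n x. n \<ge> N \<and> x \<in> I \<longrightarrow> norm (complex_of_real (f n x) - complex_of_real (h x)) < e" if "e > 0" for e
      using u[OF that] unfolding of_real_diff[symmetric] norm_of_real .
  qed
  then show ?thesis unfolding of_real_diff[symmetric] norm_of_real ip_def by (simp add: power2_eq_square)
qed

lemma Qr_lincomb: "u \<in> HS \<Longrightarrow> v \<in> HS \<Longrightarrow> Qr (lincomb a u b v) = lincomb a (Qr u) b (Qr v)"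
proof
  fix x assume uv: "u \<in> HS" "v \<in> HS"
  note i = integrable_bounded_mult[OF Kf_continuous(1) HS_integrable, of _ x]
  have "Qr (lincomb a u b v) x = (\<integral>y. a * (Kf x y * u y) + b * (Kf x y * v y) \<partial>M)"
    unfolding Qr_def by (simp add: algebra_simps)
  also have "\<dots> = a * Qr u x + b * Qr v x" unfolding Qr_def using i[OF uv(1)] i[OF uv(2)] by simp
  finally show "Qr (lincomb a u b v) x = a * Qr u x + b * Qr v x" .
qed

lemma ip_le_sup:
  assumes u: "u \<in> HS" and B: "\<And>x. x \<in> I \<Longrightarrow> \<bar>u x\<bar> \<le> B"
  shows "ip u u \<le> B\<^sup>2 * measure M I"
proof -
  have "ip u u \<le> (\<integral>x. B\<^sup>2 \<partial>M)"
    unfolding ip_def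
  proof (rule integral_mono)
    fix x assume "x \<in> space M"
    then have "\<bar>u x\<bar>\<^sup>2 \<le> B\<^sup>2" using B by (intro power_mono) auto
    then show "u x * u x \<le> B\<^sup>2" by (simp add: power2_eq_square)
  qed (use HS_integrable_mult[OF u u] in auto)
  then show ?thesis by (simp add: mult.commute)
qed

section \<open>Injectivity of Q through vanishing moments\<close>

lemma FC_FS_derivs:
  assumes v: "integrable M v"
  shows "(FC v has_real_derivative (- c) * FS (\<lambda>y. y * v y) x) (at x)"
    and "(FS v has_real_derivative c * FC (\<lambda>y. y * v y) x) (at x)"
proof -
  have b: "\<bar>c * (y * sin a)\<bar> \<le> 1 + c" "\<bar>c * (y * cos a)\<bar> \<le> 1 + c" "\<bar>cos a\<bar> \<le> 1 + c" "\<bar>sin a\<bar> \<le> 1 + c" if y: "y \<in> I" for y a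
  proof -
    have "c * \<bar>y * sin a\<bar> \<le> c * 1" "c * \<bar>y * cos a\<bar> \<le> c * 1"
      using trig_moment_bounds[OF y] c_pos by (intro mult_left_mono; auto)+
    moreover have "\<bar>c * t\<bar> = c * \<bar>t\<bar>" for t using c_pos by (simp add: abs_mult)
    ultimately show "\<bar>c * (y * sin a)\<bar> \<le> 1 + c" "\<bar>c * (y * cos a)\<bar> \<le> 1 + c"
      by simp_all
    show "\<bar>cos a\<bar> \<le> 1 + c" "\<bar>sin a\<bar> \<le> 1 + c" using c_pos abs_cos_le_one[of a] abs_sin_le_one[of a] by linarith+
  qed
  have "(FC v has_real_derivative (\<integral>y. - (c * (y * sin (c * x * y))) * v y \<partial>M)) (at x)"
    unfolding FC_def
  proof (rule deriv_integral_M[where B="1 + c"])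
    fix x y :: real
    show "((\<lambda>x. cos (c * x * y)) has_real_derivative - (c * (y * sin (c * x * y)))) (at x)"
      by (auto intro!: derivative_eq_intros)
  qed (auto intro!: continuous_intros v b simp: b)
  moreover have "(\<integral>y. - (c * (y * sin (c * x * y))) * v y \<partial>M) = (\<integral>y. (- c) * (sin (c * x * y) * (y * v y)) \<partial>M)"
    by (rule Bochner_Integration.integral_cong) auto
  ultimately show "(FC v has_real_derivative (- c) * FS (\<lambda>y. y * v y) x) (at x)"
    unfolding FS_def integral_mult_right_zero by simp
  have "(FS v has_real_derivative (\<integral>y. (c * (y * cos (c * x * y))) * v y \<partial>M)) (at x)"
    unfolding FS_def
  proof (rule deriv_integral_M[where B="1 + c"])
    fix x y :: real
    show "((\<lambda>x. sin (c * x * y)) has_real_derivative (c * (y * cos (c * x * y)))) (at x)"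
      by (auto intro!: derivative_eq_intros)
  qed (auto intro!: continuous_intros v b simp: b)
  moreover have "(\<integral>y. (c * (y * cos (c * x * y))) * v y \<partial>M) = (\<integral>y. c * (cos (c * x * y) * (y * v y)) \<partial>M)"
    by (rule Bochner_Integration.integral_cong) auto
  ultimately show "(FS v has_real_derivative c * FC (\<lambda>y. y * v y) x) (at x)"
    unfolding FC_def integral_mult_right_zero by simp
qed

text \<open>Differentiating the cosine and sine transforms replaces \<open>v\<close> by
  \<open>y * v y\<close>, up to the nonzero factors \<open>c\<close> and \<open>- c\<close>. So
  vanishing on \<open>I\<close> is inherited by all \<open>y ^ k * v y\<close>, and the cosine
  transform at 0 is the moment.\<close>

lemma moments_zero:
  assumes v: "integrable M v" and z: "\<And>x. x \<in> I \<Longrightarrow> FC v x = 0" "\<And>x. x \<in> I \<Longrightarrow> FS v x = 0"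
  shows "(\<integral>y. y ^ k * v y \<partial>M) = 0"
proof -
  have "integrable M (\<lambda>y. y ^ k * v y) \<and> (\<forall>x\<in>I. FC (\<lambda>y. y ^ k * v y) x = 0) \<and> (\<forall>x\<in>I. FS (\<lambda>y. y ^ k * v y) x = 0)"
  proof (induction k)
    case 0
    then show ?case using v z by simp
  next
    case (Suc k)
    let ?w = "\<lambda>y. y ^ k * v y"
    have w: "integrable M ?w" "\<And>x. x \<in> I \<Longrightarrow> FC ?w x = 0" "\<And>x. x \<in> I \<Longrightarrow> FS ?w x = 0" using Suc by auto
    \<comment> \<open>Derivatives within \<open>I\<close> are unique also at the endpoints, so a
      function vanishing on \<open>I\<close> only has derivative 0 there even in the one-sided
      sense.\<close>
    have zero: "(f has_real_derivative 0) (at x within I)" if "\<And>x. x \<in> I \<Longrightarrow> f x = 0" "x \<in> I" for f :: "real \<Rightarrow> real" and x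
      by (rule has_field_derivative_transform_within[of "\<lambda>_. 0", OF _ zero_less_one that(2)]) (auto simp: that(1))
    have eq: "(\<lambda>y. y * ?w y) = (\<lambda>y. y ^ Suc k * v y)" by (simp add: mult.assoc)
    have "FS (\<lambda>y. y * ?w y) x = 0" "FC (\<lambda>y. y * ?w y) x = 0" if x: "x \<in> I" for x
    proof -
      have "(- c) * FS (\<lambda>y. y * ?w y) x = 0"
        using deriv_I_eq[OF x zero[OF w(2) x]] deriv_I_eq[OF x has_field_derivative_at_within[OF FC_FS_derivs(1)[OF w(1)]]] by simp
      then show "FS (\<lambda>y. y * ?w y) x = 0" using c_pos by simp
      have "c * FC (\<lambda>y. y * ?w y) x = 0"
        using deriv_I_eq[OF x zero[OF w(3) x]] deriv_I_eq[OF x has_field_derivative_at_within[OF FC_FS_derivs(2)[OF w(1)]]] by simp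
      then show "FC (\<lambda>y. y * ?w y) x = 0" using c_pos by simp
    qed
    moreover have "integrable M (\<lambda>y. y * ?w y)" by (rule integrable_bounded_mult[OF _ w(1)]) (intro continuous_intros)
    ultimately show ?case unfolding eq by blast
  qed
  then have "FC (\<lambda>y. y ^ k * v y) 0 = 0" by auto
  then show ?thesis by (simp add: FC_def)
qed

text \<open>Analytic continuation by hand: with vanishing moments the exponential may be replaced by
  its Taylor remainder, which on the bounded support is at most
  \<open>\<bar>\<xi>\<bar> ^ Suc n / fact (Suc n)\<close>. The conclusion holds for every
  \<open>\<xi>\<close>, not just for the frequencies tested by the finite transform.\<close>

lemma FT_weighted_zero:
  assumes v: "integrable M v" and z: "\<And>k. (\<integral>y. y ^ k * v y \<partial>M) = 0"
  shows "FT (\<lambda>x. of_real (indicator I x * (\<omega> \<alpha> x * v x))) \<xi> = 0"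
proof -
  have [measurable]: "v \<in> borel_measurable M" using v by auto
  let ?E = "\<lambda>y. exp (\<i> * complex_of_real (- \<xi> * y))"
  have mE: "?E \<in> borel_measurable M" by (rule iexp_measurable_M)
  have iEv: "integrable M (\<lambda>y. ?E y * of_real (v y))"
    by (rule Bochner_Integration.integrable_bound[OF v]) (use mE in \<open>auto simp: norm_mult simp del: of_real_mult of_real_minus\<close>)
  have FT: "FT (\<lambda>x. of_real (indicator I x * (\<omega> \<alpha> x * v x))) \<xi> = (\<integral>y. ?E y * of_real (v y) \<partial>M)"
  proof -
    have "(\<lambda>y. ?E y * of_real (v y)) \<in> borel_measurable M" using iEv by auto
    from integral_M[OF this] show ?thesis
      unfolding FT_def set_lebesgue_integral_def
      by (simp add: scaleR_conv_of_real mult_ac)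
  qed
  define A where "A = (\<integral>y. \<bar>v y\<bar> \<partial>M)"
  have bound: "cmod (FT (\<lambda>x. of_real (indicator I x * (\<omega> \<alpha> x * v x))) \<xi>) \<le> \<bar>\<xi>\<bar> ^ Suc n / fact (Suc n) * A" for n
  proof -
    let ?S = "\<lambda>y. \<Sum>k\<le>n. (\<i> * complex_of_real (- \<xi> * y)) ^ k / fact k"
    have iy: "integrable M (\<lambda>y. y ^ k * v y)" for k
      by (rule integrable_bounded_mult[OF _ v]) (intro continuous_intros)
    have Sv: "?S y * of_real (v y) = (\<Sum>k\<le>n. (\<i> * complex_of_real (- \<xi>)) ^ k / fact k * of_real (y ^ k * v y))" for y
    proof -
      have "(\<i> * complex_of_real (- \<xi> * y)) ^ k = (\<i> * complex_of_real (- \<xi>)) ^ k * of_real (y ^ k)" for k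
        by (simp only: of_real_mult mult.assoc[symmetric] power_mult_distrib of_real_power)
      then show ?thesis by (simp add: sum_distrib_right mult.assoc)
    qed
    have iS: "integrable M (\<lambda>y. ?S y * of_real (v y))"
      unfolding Sv by (intro Bochner_Integration.integrable_sum integrable_mult_right integrable_of_real iy)
    have "(\<integral>y. ?S y * of_real (v y) \<partial>M) = (\<Sum>k\<le>n. (\<i> * complex_of_real (- \<xi>)) ^ k / fact k * (\<integral>y. of_real (y ^ k * v y) \<partial>M))"
      unfolding Sv by (subst Bochner_Integration.integral_sum) (auto intro!: integrable_mult_right integrable_of_real iy simp del: of_real_mult of_real_power)
    also have "\<dots> = 0" unfolding integral_complex_of_real z by simp
    finally have "(\<integral>y. ?E y * of_real (v y) \<partial>M) = (\<integral>y. ?E y * of_real (v y) - ?S y * of_real (v y) \<partial>M)"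
      using iEv iS by simp
    also have "cmod \<dots> \<le> (\<integral>y. cmod (?E y * of_real (v y) - ?S y * of_real (v y)) \<partial>M)" by (rule integral_norm_bound)
    also have "\<dots> \<le> (\<integral>y. \<bar>\<xi>\<bar> ^ Suc n / fact (Suc n) * \<bar>v y\<bar> \<partial>M)"
    proof (rule integral_mono)
      fix y assume "y \<in> space M"
      then have y: "\<bar>y\<bar> \<le> 1" by (simp add: abs_le_iff)
      have "cmod (?E y - ?S y) \<le> \<bar>- \<xi> * y\<bar> ^ Suc n / fact (Suc n)" by (rule iexp_approx1)
      also have "\<bar>- \<xi> * y\<bar> ^ Suc n \<le> (\<bar>\<xi>\<bar> * 1) ^ Suc n"
        unfolding abs_mult using y by (intro power_mono mult_mono) auto
      finally have "cmod (?E y - ?S y) \<le> \<bar>\<xi>\<bar> ^ Suc n / fact (Suc n)" by (simp add: divide_right_mono)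
      then have "cmod (?E y - ?S y) * \<bar>v y\<bar> \<le> \<bar>\<xi>\<bar> ^ Suc n / fact (Suc n) * \<bar>v y\<bar>" by (rule mult_right_mono) simp
      moreover have "cmod (?E y * of_real (v y) - ?S y * of_real (v y)) = cmod (?E y - ?S y) * \<bar>v y\<bar>"
        unfolding left_diff_distrib[symmetric] norm_mult norm_of_real ..
      ultimately show "cmod (?E y * of_real (v y) - ?S y * of_real (v y)) \<le> \<bar>\<xi>\<bar> ^ Suc n / fact (Suc n) * \<bar>v y\<bar>" by simp
    next
      show "integrable M (\<lambda>y. cmod (?E y * of_real (v y) - ?S y * of_real (v y)))"
        by (intro integrable_norm Bochner_Integration.integrable_diff iEv iS)
    qed (use v in auto)
    finally show ?thesis unfolding FT A_def by simp
  qed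
  have "(\<lambda>n. inverse (fact n) *\<^sub>R \<bar>\<xi>\<bar> ^ n) \<longlonglongrightarrow> 0" by (rule summable_LIMSEQ_zero[OF summable_exp_generic])
  then have "(\<lambda>n. \<bar>\<xi>\<bar> ^ Suc n / fact (Suc n) * A) \<longlonglongrightarrow> 0 * A"
    by (intro tendsto_mult tendsto_const) (use LIMSEQ_Suc in \<open>force simp: divide_inverse mult.commute\<close>)
  then have "cmod (FT (\<lambda>x. of_real (indicator I x * (\<omega> \<alpha> x * v x))) \<xi>) \<le> 0 * A"
    by (rule LIMSEQ_le_const) (use bound in blast)
  then show ?thesis by simp
qed

lemma F_c_of_real:
  assumes v: "integrable M v"
  shows "F_c c \<alpha> (\<lambda>y. of_real (v y)) x = of_real (FC v x) + \<i> * of_real (FS v x)"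
proof -
  have m: "(\<lambda>y. complex_of_real (v y)) \<in> borel_measurable M" using v by auto
  have i: "integrable M (\<lambda>y. cos (c * x * y) * v y)" "integrable M (\<lambda>y. sin (c * x * y) * v y)"
    by (rule integrable_bounded_mult[OF _ v]; intro continuous_intros)+
  have "F_c c \<alpha> (\<lambda>y. of_real (v y)) x = (\<integral>y. of_real (cos (c * x * y) * v y) + \<i> * of_real (sin (c * x * y) * v y) \<partial>M)"
    unfolding F_c_eq[OF m]
    by (rule Bochner_Integration.integral_cong) (auto simp: complex_eq_iff Re_exp Im_exp)
  also have "\<dots> = of_real (FC v x) + \<i> * of_real (FS v x)"
    unfolding FC_def FS_def using i by (subst Bochner_Integration.integral_add) (auto simp del: of_real_mult)
  finally show ?thesis .
qed

lemma ip_self_zero: "v \<in> HS \<Longrightarrow> ip v v = 0 \<longleftrightarrow> (AE x in M. v x = 0)"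
  unfolding ip_def using HS_integrable_mult[of v v] by (subst integral_nonneg_eq_0_iff_AE) auto

text \<open>The hypothesis says that the finite Fourier transform of \<open>v\<close> has energy 0.
  By continuity it vanishes on \<open>I\<close>, so the moments vanish, and Plancherel applies to
  \<open>v\<close> times the weight. Phrasing it through the quadratic form gives strict positivity
  of \<open>Q\<close> as well as injectivity.\<close>

theorem Qr_injective:
  assumes v: "v \<in> HS" and z: "ip (Qr v) v = 0"
  shows "AE x in M. v x = 0"
proof -
  note iv = HS_integrable[OF v]
  have [measurable]: "v \<in> borel_measurable M" using v by (simp add: HS_def)
  have cF: "continuous_on I (FC v)" "continuous_on I (FS v)"
    by (rule deriv_imp_continuous_on[OF FC_FS_derivs(1)[OF iv]], rule deriv_imp_continuous_on[OF FC_FS_derivs(2)[OF iv]])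
  have "c / (2 * pi) * (\<integral>x. (cmod (F_c c \<alpha> (\<lambda>y. of_real (v y)) x))\<^sup>2 \<partial>M) = 0"
    using F_c_energy[OF L2w_I_of_real[OF v]] z by (simp add: ip_def)
  then have "(\<integral>x. (cmod (F_c c \<alpha> (\<lambda>y. of_real (v y)) x))\<^sup>2 \<partial>M) = 0" using c_pos by simp
  moreover have "(cmod (F_c c \<alpha> (\<lambda>y. of_real (v y)) x))\<^sup>2 = (FC v x)\<^sup>2 + (FS v x)\<^sup>2" for x
    unfolding F_c_of_real[OF iv] by (simp add: cmod_Re_Im_square)
  ultimately have 0: "(\<integral>x. (FC v x)\<^sup>2 + (FS v x)\<^sup>2 \<partial>M) = 0" by simp
  have "AE x in M. (FC v x)\<^sup>2 + (FS v x)\<^sup>2 = 0"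
    using 0 by (subst (asm) integral_nonneg_eq_0_iff_AE) (auto intro!: integrable_M_continuous continuous_intros cF)
  then have "(FC v x)\<^sup>2 + (FS v x)\<^sup>2 = 0" if "x \<in> I" for x
    by (rule continuous_AE_zero[rotated, OF _ that]) (intro continuous_intros cF)
  then have zero: "FC v x = 0" "FS v x = 0" if "x \<in> I" for x using that by (simp_all add: sum_power2_eq_zero_iff)
  \<comment> \<open>The weight is included so that the transform of \<open>h\<close> is an integral
    against \<open>M\<close>. Since the weight is at most 1, \<open>h\<close> is square
    integrable.\<close>
  define h where "h x = complex_of_real (indicator I x * (\<omega> \<alpha> x * v x))" for x
  have FTh: "FT h \<xi> = 0" for \<xi>
    unfolding h_def by (rule FT_weighted_zero[OF iv]) (rule moments_zero[OF iv zero])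
  have h1: "integrable lborel h"
    using iv integrable_M[of v] unfolding h_def set_integrable_def by (intro integrable_of_real) simp
  have [measurable]: "h \<in> borel_measurable borel" using h1 by auto
  have i2: "integrable lborel (\<lambda>x. indicator I x * (\<omega> \<alpha> x * (v x)\<^sup>2))"
    using v integrable_M[of "\<lambda>x. (v x)\<^sup>2"] unfolding HS_def set_integrable_def by simp
  have h2: "integrable lborel (\<lambda>x. (cmod (h x))\<^sup>2)"
  proof (rule Bochner_Integration.integrable_bound[OF i2])
    show "AE x in lborel. norm ((cmod (h x))\<^sup>2) \<le> norm (indicator I x * (\<omega> \<alpha> x * (v x)\<^sup>2))"
    proof (rule AE_I2)
      fix x
      show "norm ((cmod (h x))\<^sup>2) \<le> norm (indicator I x * (\<omega> \<alpha> x * (v x)\<^sup>2))"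
      proof (cases "x \<in> I")
        case True
        have "(\<omega> \<alpha> x)\<^sup>2 * (v x)\<^sup>2 \<le> \<omega> \<alpha> x * (v x)\<^sup>2"
          using omega_le_1[OF True] by (intro mult_right_mono) (auto simp: power2_eq_square mult_left_le)
        then show ?thesis using True by (simp add: h_def norm_mult power_mult_distrib)
      qed (simp add: h_def)
    qed
  qed measurable
  have "(\<integral>x. (cmod (h x))\<^sup>2 \<partial>lborel) = 0" using Plancherel_L1_L2(2)[OF h1 h2] by (simp add: FTh)
  then have "AE x in lborel. h x = 0" using h2 by (subst (asm) integral_nonneg_eq_0_iff_AE) auto
  moreover have "AE x in lborel. x \<noteq> (-1::real)" "AE x in lborel. x \<noteq> (1::real)" by (rule AE_lborel_singleton)+
  ultimately have "AE x in lborel. x \<in> I \<longrightarrow> v x = 0"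
  proof eventually_elim
    case (elim x)
    show ?case
    proof
      assume "x \<in> I"
      then have "\<omega> \<alpha> x > 0" using elim by (intro omega_pos) auto
      then show "v x = 0" using elim \<open>x \<in> I\<close> by (simp add: h_def)
    qed
  qed
  then show ?thesis unfolding AE_M .
qed

text \<open>The constant function 1 serves as test vector: its form is nonnegative by
  \<open>F_c_energy\<close> and nonzero by injectivity.\<close>

theorem Qr_top_eigenvector:
  obtains \<Lambda> h where "\<Lambda> > 0" "h \<in> HS" "ip h h > 0" "AE x in M. Qr h x = \<Lambda> * h x"
    "\<And>v. v \<in> HS \<Longrightarrow> ip (Qr v) v \<le> \<Lambda> * ip v v"
proof -
  let ?o = "\<lambda>_::real. 1::real"
  have o: "?o \<in> HS" by (rule HS_continuous) simp
  have "ip (Qr ?o) ?o \<ge> 0"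
  proof -
    have "0 \<le> c / (2 * pi) * (\<integral>x. (cmod (F_c c \<alpha> (\<lambda>y. of_real (?o y)) x))\<^sup>2 \<partial>M)"
      using c_pos by (intro mult_nonneg_nonneg) auto
    then show ?thesis using F_c_energy[OF L2w_I_of_real[OF o]] by (simp add: ip_def)
  qed
  moreover have "ip (Qr ?o) ?o \<noteq> 0"
  proof
    assume "ip (Qr ?o) ?o = 0"
    then have "ip ?o ?o = 0" using Qr_injective[OF o] ip_self_zero[OF o] by blast
    then show False using measure_M_pos by (simp add: ip_def)
  qed
  ultimately have pos: "ip (Qr ?o) ?o > 0" by linarith
  obtain \<Lambda> h where L: "\<Lambda> > 0" "h \<in> HS" "ip h h > 0"
    "ip (lincomb 1 (Qr h) (- \<Lambda>) h) (lincomb 1 (Qr h) (- \<Lambda>) h) = 0"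
    "\<And>v. v \<in> HS \<Longrightarrow> ip (Qr v) v \<le> \<Lambda> * ip v v"
  \<comment> \<open>The bound combines the uniform estimate of the image by the L1 norm,
    \<open>HS_L1_le\<close>, and the passage from a uniform bound to L2, each of the last two
    costing one factor of the total mass.\<close>
  proof (rule HS.compact_symmetric_eigenvector[of Qr "BK\<^sup>2 * (measure M I)\<^sup>2" ?o])
    show "ip (Qr f) (Qr f) \<le> BK\<^sup>2 * (measure M I)\<^sup>2 * ip f f" if f: "f \<in> HS" for f
    proof -
      have "ip (Qr f) (Qr f) \<le> (BK * (\<integral>y. \<bar>f y\<bar> \<partial>M))\<^sup>2 * measure M I"
        by (rule ip_le_sup[OF Qr_HS[OF f]]) (rule Qr_bounds(1)[OF HS_integrable[OF f]])
      also have "\<dots> = BK\<^sup>2 * measure M I * (\<integral>y. \<bar>f y\<bar> \<partial>M)\<^sup>2" by (simp add: power_mult_distrib)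
      also have "\<dots> \<le> BK\<^sup>2 * measure M I * (measure M I * ip f f)"
        by (rule mult_left_mono[OF HS_L1_le[OF f]]) simp
      finally show ?thesis by (simp add: power2_eq_square mult_ac)
    qed
    show "\<exists>r h. strict_mono (r :: nat \<Rightarrow> nat) \<and> h \<in> HS \<and>
         (\<lambda>n. ip (lincomb 1 (Qr (u (r n))) (-1) h) (lincomb 1 (Qr (u (r n))) (-1) h)) \<longlonglongrightarrow> 0"
      if u: "\<And>n. u n \<in> HS" "\<And>n. ip (u n) (u n) = 1" for u
    proof -
      have u1: "ip (u n) (u n) \<le> 1" for n using u(2) by simp
      obtain r h where r: "strict_mono (r :: nat \<Rightarrow> nat)" and h: "continuous_on I h"
        and conv: "\<forall>e>0. \<exists>N. \<forall>n x. n \<ge> N \<and> x \<in> I \<longrightarrow> \<bar>Qr (u (r n)) x - h x\<bar> < e"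
        using Qr_subconvergent[of u, OF u(1) u1] by (elim exE conjE)
      have "(\<lambda>n. ip (lincomb 1 (Qr (u (r n))) (-1) h) (lincomb 1 (Qr (u (r n))) (-1) h)) \<longlonglongrightarrow> 0"
        by (rule uniform_imp_ip_convergent[OF Qr_HS[OF u(1)] HS_continuous[OF h] conv[rule_format]])
      with r HS_continuous[OF h] show ?thesis by (intro exI[of _ r] exI[of _ h] conjI)
    qed
  next
    fix \<Lambda> h
    assume "\<Lambda> > 0" "h \<in> HS" "ip h h > 0"
      "ip (lincomb 1 (Qr h) (- \<Lambda>) h) (lincomb 1 (Qr h) (- \<Lambda>) h) = 0"
      "\<And>v. v \<in> HS \<Longrightarrow> ip (Qr v) v \<le> \<Lambda> * ip v v"
    then show ?thesis by (rule that)
  qed (rule o pos Qr_HS Qr_lincomb Qr_symmetric; assumption)+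
  have "AE x in M. 1 * Qr h x + - \<Lambda> * h x = 0"
    using L(4) ip_self_zero[OF HS_lincomb[OF Qr_HS[OF L(2)] L(2)], of 1 "- \<Lambda>"] by blast
  then have "AE x in M. Qr h x = \<Lambda> * h x" by eventually_elim simp
  from that[OF L(1-3) this L(5)] show ?thesis .
qed

end

section \<open>Eigenspaces and the functions psi\<close>

context prolate
begin

lemma F_c_cong: "(\<And>y. y \<in> I \<Longrightarrow> f y = g y) \<Longrightarrow> F_c c \<alpha> f x = F_c c \<alpha> g x"
  unfolding F_c_def by (intro set_lebesgue_integral_cong) auto

lemma Qr_cong: "(\<And>y. y \<in> I \<Longrightarrow> f y = g y) \<Longrightarrow> Qr f x = Qr g x"
  unfolding Qr_def by (intro Bochner_Integration.integral_cong) auto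

lemma Qr_cong_AE:
  assumes "f \<in> HS" "g \<in> HS" "AE y in M. f y = g y"
  shows "Qr f x = Qr g x"
proof -
  have [measurable]: "f \<in> borel_measurable M" "g \<in> borel_measurable M" "Kf x \<in> borel_measurable M"
    using assms Kf_measurable by (auto simp: HS_def)
  show ?thesis unfolding Qr_def by (intro integral_cong_AE) (use assms(3) in auto)
qed

lemma ip_cong_AE:
  assumes "f \<in> HS" "g \<in> HS" "h \<in> HS" "AE y in M. f y = g y"
  shows "ip f h = ip g h"
proof -
  have [measurable]: "f \<in> borel_measurable M" "g \<in> borel_measurable M" "h \<in> borel_measurable M"
    using assms by (auto simp: HS_def)
  show ?thesis unfolding ip_def by (intro integral_cong_AE) (use assms(4) in auto)
qed

section \<open>The functions psi as eigenfunctions of the integral operators\<close>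

context
  fixes \<psi> :: "nat \<Rightarrow> real \<Rightarrow> real"
  assumes psi: "is_GPSWF c \<alpha> \<psi>"
begin

lemma psi_C2: "C2_data (\<psi> n) (deriv_I (\<psi> n)) (deriv_I (deriv_I (\<psi> n)))"
  using psi by (intro C2_on_I_imp_C2_data) (auto simp: is_GPSWF_def minus_L_eigenfunction_def)

lemma psi_nonzero: "\<exists>x\<in>I. \<psi> n x \<noteq> 0"
  using psi by (auto simp: is_GPSWF_def minus_L_eigenfunction_def)

lemma psi_HS: "\<psi> n \<in> HS"
  by (rule HS_continuous[OF C2_data_continuous(1)[OF psi_C2]])

lemma psi_norm: "ip (\<psi> n) (\<psi> n) = 1"
proof -
  have "(\<lambda>x. (\<psi> n x)\<^sup>2) \<in> borel_measurable M" using psi_HS[of n] by (auto simp: HS_def)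
  moreover have "(LINT x:I|lborel. (\<psi> n x)\<^sup>2 * \<omega> \<alpha> x) = 1" using psi by (simp add: is_GPSWF_def)
  ultimately show ?thesis unfolding ip_def power2_eq_square[symmetric] by (subst integral_M) (auto simp: mult.commute)
qed

text \<open>Cosine and sine transforms are separately real multiples of \<open>\<psi> n\<close>;
  together they give the complex factor.\<close>

lemma F_c_psi:
  assumes x: "x \<in> I"
  shows "F_c c \<alpha> (\<lambda>y. of_real (\<psi> n y)) x = mu c \<alpha> \<psi> n * of_real (\<psi> n x)"
proof -
  let ?F = "F_c c \<alpha> (\<lambda>y. of_real (\<psi> n y))"
  have "\<exists>a. \<forall>x\<in>I. (\<integral>y. cos (c * x * y) * \<psi> n y \<partial>M) = a * \<psi> n x"
    by (rule trig_transform_eigen[of cos "\<lambda>s. - sin s", OF _ _ _ _ psi]) (auto intro!: derivative_eq_intros)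
  then obtain a where "\<forall>x\<in>I. FC (\<psi> n) x = a * \<psi> n x" unfolding FC_def ..
  then have a: "\<And>x. x \<in> I \<Longrightarrow> FC (\<psi> n) x = a * \<psi> n x" by blast
  have "\<exists>b. \<forall>x\<in>I. (\<integral>y. sin (c * x * y) * \<psi> n y \<partial>M) = b * \<psi> n x"
    by (rule trig_transform_eigen[of sin cos, OF _ _ _ _ psi]) (auto intro!: derivative_eq_intros)
  then obtain b where "\<forall>x\<in>I. FS (\<psi> n) x = b * \<psi> n x" unfolding FS_def ..
  then have b: "\<And>x. x \<in> I \<Longrightarrow> FS (\<psi> n) x = b * \<psi> n x" by blast
  have ex: "\<forall>x\<in>I. ?F x = (of_real a + \<i> * of_real b) * of_real (\<psi> n x)"
    unfolding F_c_of_real[OF HS_integrable[OF psi_HS]] by (simp add: a b algebra_simps)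
  obtain x0 where x0: "x0 \<in> I" "\<psi> n x0 \<noteq> 0" using psi_nonzero by blast
  \<comment> \<open>\<open>mu\<close> is a definite description, so the factor must be unique; a
    point where \<open>\<psi> n\<close> does not vanish determines it.\<close>
  have uniq: "m = of_real a + \<i> * of_real b" if "\<forall>x\<in>I. ?F x = m * of_real (\<psi> n x)" for m
  proof -
    have "m * of_real (\<psi> n x0) = (of_real a + \<i> * of_real b) * of_real (\<psi> n x0)"
      by (rule trans[OF that[rule_format, OF x0(1), symmetric] ex[rule_format, OF x0(1)]])
    then show ?thesis using x0(2) by simp
  qed
  have "mu c \<alpha> \<psi> n = of_real a + \<i> * of_real b"
    unfolding mu_def by (rule the_equality, rule ex, erule uniq)
  with ex x show ?thesis by simp
qed

text \<open>Because \<open>\<psi> n\<close> is real, the factorization applies the eigenvalue once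
  conjugated and once not, which produces the squared modulus in \<open>lambda\<close>.\<close>

lemma Q_c_psi:
  assumes x: "x \<in> I"
  shows "Q_c c \<alpha> (\<lambda>y. of_real (\<psi> n y)) x = of_real (lambda c \<alpha> \<psi> n) * of_real (\<psi> n x)"
proof -
  let ?m = "mu c \<alpha> \<psi> n" and ?p = "\<lambda>y. complex_of_real (\<psi> n y)"
  have ip: "integrable M ?p" using HS_integrable[OF psi_HS] by simp
  have mp: "?p \<in> borel_measurable M" using ip by auto
  have "Q_c c \<alpha> ?p x = of_real (c / (2 * pi)) * F_c c \<alpha> (\<lambda>t. cnj (F_c c \<alpha> ?p t)) x"
    using Q_c_factorization[OF ip] by simp
  also have "F_c c \<alpha> (\<lambda>t. cnj (F_c c \<alpha> ?p t)) x = F_c c \<alpha> (\<lambda>t. cnj ?m * ?p t) x"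
    by (rule F_c_cong) (simp add: F_c_psi)
  also have "\<dots> = cnj ?m * F_c c \<alpha> ?p x"
    by (simp add: F_c_def mult_ac flip: set_integral_mult_right)
  also have "\<dots> = cnj ?m * (?m * ?p x)" by (simp add: F_c_psi[OF x])
  also have "of_real (c / (2 * pi)) * \<dots> = of_real (c / (2 * pi)) * (?m * cnj ?m) * ?p x" by simp
  also have "\<dots> = of_real (lambda c \<alpha> \<psi> n) * ?p x"
    unfolding complex_norm_square[symmetric] lambda_def by simp
  finally show ?thesis .
qed

lemma Qr_psi:
  assumes x: "x \<in> I"
  shows "Qr (\<psi> n) x = lambda c \<alpha> \<psi> n * \<psi> n x"
proof -
  have "complex_of_real (Qr (\<psi> n) x) = of_real (lambda c \<alpha> \<psi> n * \<psi> n x)"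
    using Q_c_psi[OF x, of n] by (simp add: Q_c_of_real[OF psi_HS])
  then show ?thesis unfolding of_real_eq_iff .
qed

context
  fixes z :: real
  assumes z: "z \<noteq> 0"
begin

text \<open>The eigenvalue equation is required at every real \<open>x\<close>, also outside
  \<open>I\<close>: for \<open>z \<noteq> 0\<close> this selects the smooth representative
  \<open>Qr v / z\<close> of each eigenfunction. What is left after removing the
  \<open>\<psi>\<close>s with eigenvalue \<open>z\<close> must be shown to be null.\<close>

definition eigen_rest :: "(real \<Rightarrow> real) set" where
  "eigen_rest = {v \<in> HS. (\<forall>x. z * v x = Qr v x) \<and> (\<forall>n. lambda c \<alpha> \<psi> n = z \<longrightarrow> ip v (\<psi> n) = 0)}"

lemma eigen_rest_HS: "v \<in> eigen_rest \<Longrightarrow> v \<in> HS"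
  by (simp add: eigen_rest_def)

lemma eigen_rest_lincomb:
  assumes "u \<in> eigen_rest" "v \<in> eigen_rest"
  shows "lincomb a u b v \<in> eigen_rest"
proof -
  have h: "u \<in> HS" "v \<in> HS" using assms by (auto simp: eigen_rest_def)
  have "z * lincomb a u b v x = Qr (lincomb a u b v) x" for x
    using assms unfolding Qr_lincomb[OF h] by (simp add: eigen_rest_def algebra_simps)
  moreover have "ip (lincomb a u b v) (\<psi> n) = 0" if "lambda c \<alpha> \<psi> n = z" for n
    unfolding HS.ip_lincomb[OF h psi_HS] using assms that by (simp add: eigen_rest_def)
  ultimately show ?thesis using HS_lincomb[OF h] by (simp add: eigen_rest_def)
qed

lemma eigen_rest_space: "semi_inner_space eigen_rest ip"
  by unfold_locales
    (auto intro: eigen_rest_lincomb HS.ip_lincomb HS.ip_commute HS.ip_nonneg eigen_rest_HS)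

text \<open>An element equals \<open>Qr v / z\<close> and so inherits the derivatives of the kernel.
  On this space the differential operator is therefore \<open>Lr v / z\<close>.\<close>

lemma eigen_rest_C2:
  assumes v: "v \<in> eigen_rest"
  shows "C2_data v (\<lambda>x. Qr1 v x / z) (\<lambda>x. Qr2 v x / z)"
    and "L_data v (\<lambda>x. Qr1 v x / z) (\<lambda>x. Qr2 v x / z) x = Lr v x / z"
proof -
  have iv: "integrable M v" by (rule HS_integrable[OF eigen_rest_HS[OF v]])
  have "z * v x = Qr v x" for x using v by (simp add: eigen_rest_def)
  then have eq: "v = (\<lambda>x. Qr v x / z)" using z by (auto simp: fun_eq_iff field_simps)
  have C: "C2_data (\<lambda>x. Qr v x / z) (\<lambda>x. Qr1 v x / z) (\<lambda>x. Qr2 v x / z)"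
    using C2_data_Qr[OF iv] z unfolding C2_data_def by (auto intro!: DERIV_cdivide continuous_intros)
  show "C2_data v (\<lambda>x. Qr1 v x / z) (\<lambda>x. Qr2 v x / z)"
    by (subst eq) (rule C)
  have "L_data v (\<lambda>x. Qr1 v x / z) (\<lambda>x. Qr2 v x / z) x = L_data (Qr v) (Qr1 v) (Qr2 v) x / z"
    unfolding L_data_def by (subst (3) eq) (simp add: diff_divide_distrib)
  then show "L_data v (\<lambda>x. Qr1 v x / z) (\<lambda>x. Qr2 v x / z) x = Lr v x / z"
    by (simp only: L_data_Qr[OF iv])
qed

lemma psi_L_data:
  obtains \<kappa> where "\<And>x. x \<in> I \<Longrightarrow> L_data (\<psi> n) (deriv_I (\<psi> n)) (deriv_I (deriv_I (\<psi> n))) x = \<kappa> * \<psi> n x"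
proof -
  obtain k where "minus_L_eigenfunction c \<alpha> k (\<psi> n)" using psi unfolding is_GPSWF_def by blast
  then have "- L_op c \<alpha> (\<psi> n) x = k * \<psi> n x" if "x \<in> I" for x
    using that unfolding minus_L_eigenfunction_def by blast
  then have "L_data (\<psi> n) (deriv_I (\<psi> n)) (deriv_I (deriv_I (\<psi> n))) x = (- k) * \<psi> n x" if "x \<in> I" for x
    using that C2_data_imp_C2_on_I(2)[OF psi_C2[of n] that] by (metis minus_mult_left minus_equation_iff)
  then show ?thesis by (rule that)
qed

lemma Lr_over_z_continuous:
  assumes "v \<in> eigen_rest"
  shows "continuous_on I (\<lambda>x. Lr v x / z)"
  using C2_data_continuous(4)[OF eigen_rest_C2(1)[OF assms]] by (simp add: eigen_rest_C2(2)[OF assms, abs_def])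

text \<open>Commutation with \<open>Q\<close> preserves the eigenvalue equation. Orthogonality
  survives because Green's identity moves the operator to \<open>\<psi> n\<close>, which it only
  multiplies by a constant.\<close>

lemma Lr_over_z_mem:
  assumes v: "v \<in> eigen_rest"
  shows "(\<lambda>x. Lr v x / z) \<in> eigen_rest"
proof -
  note C = eigen_rest_C2(1)[OF v]
  have eq: "(\<lambda>x. Lr v x / z) = L_data v (\<lambda>x. Qr1 v x / z) (\<lambda>x. Qr2 v x / z)"
    by (rule ext) (rule eigen_rest_C2(2)[OF v, symmetric])
  have "z * (Lr v x / z) = Qr (\<lambda>x. Lr v x / z) x" for x
    unfolding eq Qr_L_data[OF C] using z by simp
  moreover have "ip (\<lambda>x. Lr v x / z) (\<psi> n) = 0" if n: "lambda c \<alpha> \<psi> n = z" for n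
  proof -
    obtain \<kappa> where \<kappa>: "\<And>x. x \<in> I \<Longrightarrow> L_data (\<psi> n) (deriv_I (\<psi> n)) (deriv_I (deriv_I (\<psi> n))) x = \<kappa> * \<psi> n x"
      using psi_L_data[of n] by blast
    have "ip (\<lambda>x. Lr v x / z) (\<psi> n) = (\<integral>x. v x * L_data (\<psi> n) (deriv_I (\<psi> n)) (deriv_I (deriv_I (\<psi> n))) x \<partial>M)"
      unfolding ip_def eq by (rule Green_identity[OF C psi_C2])
    also have "\<dots> = (\<integral>x. \<kappa> * (v x * \<psi> n x) \<partial>M)"
      by (rule Bochner_Integration.integral_cong) (auto simp: \<kappa>)
    also have "\<dots> = \<kappa> * ip v (\<psi> n)" by (simp add: ip_def)
    finally show ?thesis using v n by (simp add: eigen_rest_def)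
  qed
  moreover have "(\<lambda>x. Lr v x / z) \<in> HS" by (rule HS_continuous[OF Lr_over_z_continuous[OF v]])
  ultimately show ?thesis by (simp add: eigen_rest_def)
qed

lemma Lr_over_z_symmetric:
  assumes u: "u \<in> eigen_rest" and v: "v \<in> eigen_rest"
  shows "ip (\<lambda>x. Lr u x / z) v = ip u (\<lambda>x. Lr v x / z)"
  using Green_identity[OF eigen_rest_C2(1)[OF u] eigen_rest_C2(1)[OF v]]
  by (simp add: ip_def eigen_rest_C2(2)[OF u] eigen_rest_C2(2)[OF v])

lemma ellf_continuous: "continuous_on I (ellf x)"
  unfolding ellf_def by (intro continuous_intros Kf_continuous)

lemma Lr_lincomb:
  assumes "u \<in> HS" "v \<in> HS"
  shows "Lr (lincomb a u b v) x = a * Lr u x + b * Lr v x"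
proof -
  note i = integrable_bounded_mult[OF ellf_continuous HS_integrable, of _ x]
  have "Lr (lincomb a u b v) x = (\<integral>y. a * (ellf x y * u y) + b * (ellf x y * v y) \<partial>M)"
    unfolding Lr_def by (simp add: algebra_simps)
  also have "\<dots> = a * Lr u x + b * Lr v x" unfolding Lr_def using i[OF assms(1)] i[OF assms(2)] by simp
  finally show ?thesis .
qed

text \<open>The differential operator, shifted to be positive, restricts to a compact symmetric operator
  on the part of an eigenspace of \<open>Qr\<close> orthogonal to the \<open>\<psi>\<close>s; an eigenvector there
  would be one of the \<open>\<psi>\<close>s.\<close>

theorem eigen_rest_trivial:
  assumes v0: "v0 \<in> eigen_rest"
  shows "ip v0 v0 = 0"
proof (rule ccontr)
  interpret E: semi_inner_space eigen_rest ip by (rule eigen_rest_space)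
  assume "ip v0 v0 \<noteq> 0"
  with E.ip_nonneg[OF v0] have pos: "ip v0 v0 > 0" by simp
  let ?m = "measure M I"
  define S where "S v = (\<lambda>x. Lr v x / z)" for v
  \<comment> \<open>The uniform bound for \<open>Lr\<close> from \<open>Qr_bounds\<close>, divided
    by the size of \<open>z\<close>.\<close>
  define D where "D = (1 + (2 * \<alpha> + 2) + c\<^sup>2) * BK / \<bar>z\<bar>"
  have D: "D \<ge> 0" unfolding D_def using BK_nonneg alpha_nonneg by simp
  have S_mem: "S v \<in> eigen_rest" if "v \<in> eigen_rest" for v unfolding S_def by (rule Lr_over_z_mem[OF that])
  have S_le: "\<bar>S v x\<bar> \<le> D * (\<integral>y. \<bar>v y\<bar> \<partial>M)" if v: "v \<in> eigen_rest" and x: "x \<in> I" for v x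
  proof -
    have "\<bar>S v x\<bar> = \<bar>Lr v x\<bar> / \<bar>z\<bar>" by (simp add: S_def)
    also have "\<dots> \<le> (1 + (2 * \<alpha> + 2) + c\<^sup>2) * (BK * (\<integral>y. \<bar>v y\<bar> \<partial>M)) / \<bar>z\<bar>"
      by (rule divide_right_mono[OF Qr_bounds(3)[OF HS_integrable[OF eigen_rest_HS[OF v]] x]]) simp
    finally show ?thesis by (simp add: D_def mult_ac)
  qed
  have S_bdd: "ip (S v) (S v) \<le> (D * ?m)\<^sup>2 * ip v v" if v: "v \<in> eigen_rest" for v
  proof -
    have "ip (S v) (S v) \<le> (D * (\<integral>y. \<bar>v y\<bar> \<partial>M))\<^sup>2 * ?m"
      by (rule ip_le_sup[OF eigen_rest_HS[OF S_mem[OF v]] S_le[OF v]])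
    also have "\<dots> = D\<^sup>2 * ?m * (\<integral>y. \<bar>v y\<bar> \<partial>M)\<^sup>2" by (simp add: power_mult_distrib)
    also have "\<dots> \<le> D\<^sup>2 * ?m * (?m * ip v v)"
      by (rule mult_left_mono[OF HS_L1_le[OF eigen_rest_HS[OF v]]]) simp
    finally show ?thesis by (simp add: power2_eq_square mult_ac)
  qed
  \<comment> \<open>Half of \<open>(D * ?m)\<^sup>2 + 1\<close> dominates the form of
    \<open>S\<close>, by nonnegativity of the squared length of \<open>S v + v\<close>; the extra 1
    makes the form of the shifted operator at least \<open>ip v v\<close>.\<close>
  define \<mu> where "\<mu> = ((D * ?m)\<^sup>2 + 1) / 2 + 1"
  define T where "T v = lincomb 1 (S v) \<mu> v" for v
  have T_mem: "T v \<in> eigen_rest" if "v \<in> eigen_rest" for v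
    unfolding T_def by (rule eigen_rest_lincomb[OF S_mem[OF that] that])
  have T_pos: "ip (T v0) v0 > 0"
  proof -
    have "0 \<le> ip (S v0) (S v0) + 2 * ip (S v0) v0 + ip v0 v0"
      using E.ip_lincomb_self[OF S_mem[OF v0] v0, of 1 1] E.ip_nonneg[OF E.lincomb_mem[OF S_mem[OF v0] v0, of 1 1]] by simp
    then have "- 2 * ip (S v0) v0 \<le> (D * ?m)\<^sup>2 * ip v0 v0 + ip v0 v0" using S_bdd[OF v0] by linarith
    moreover have "ip (T v0) v0 = ip (S v0) v0 + \<mu> * ip v0 v0"
      unfolding T_def using E.ip_lincomb[OF S_mem[OF v0] v0 v0, of 1 \<mu>] by simp
    moreover have "2 * (\<mu> * ip v0 v0) = (D * ?m)\<^sup>2 * ip v0 v0 + ip v0 v0 + 2 * ip v0 v0"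
      unfolding \<mu>_def by (simp add: field_simps)
    ultimately show ?thesis using pos by linarith
  qed
  \<comment> \<open>The squared length of a sum is at most twice the sum of the squared
    lengths.\<close>
  define C where "C = 2 * (D * ?m)\<^sup>2 + 2 * \<mu>\<^sup>2"
  have T_bdd: "ip (T v) (T v) \<le> C * ip v v" if v: "v \<in> eigen_rest" for v
  proof -
    have e1: "ip (T v) (T v) = ip (S v) (S v) + 2 * \<mu> * ip (S v) v + \<mu>\<^sup>2 * ip v v"
      unfolding T_def using E.ip_lincomb_self[OF S_mem[OF v] v, of 1 \<mu>] by simp
    have "0 \<le> ip (S v) (S v) - 2 * \<mu> * ip (S v) v + \<mu>\<^sup>2 * ip v v"
      using E.ip_lincomb_self[OF S_mem[OF v] v, of 1 "- \<mu>"] E.ip_nonneg[OF E.lincomb_mem[OF S_mem[OF v] v, of 1 "- \<mu>"]] by simp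
    moreover have "C * ip v v = 2 * ((D * ?m)\<^sup>2 * ip v v) + 2 * (\<mu>\<^sup>2 * ip v v)" by (simp add: C_def algebra_simps)
    ultimately show ?thesis using e1 S_bdd[OF v] by linarith
  qed
  have T_lin: "T (lincomb a u b v) = lincomb a (T u) b (T v)" if "u \<in> eigen_rest" "v \<in> eigen_rest" for u v a b
    unfolding T_def S_def Lr_lincomb[OF eigen_rest_HS[OF that(1)] eigen_rest_HS[OF that(2)]]
    by (auto simp: fun_eq_iff add_divide_distrib algebra_simps)
  have T_sym: "ip (T u) v = ip u (T v)" if u: "u \<in> eigen_rest" and v: "v \<in> eigen_rest" for u v
  proof -
    have "ip (T u) v = ip (S u) v + \<mu> * ip u v"
      unfolding T_def using E.ip_lincomb[OF S_mem[OF u] u v, of 1 \<mu>] by simp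
    moreover have "ip u (T v) = ip (S v) u + \<mu> * ip v u"
      using E.ip_commute[OF u T_mem[OF v]] E.ip_lincomb[OF S_mem[OF v] v u, of 1 \<mu>] by (simp add: T_def)
    moreover have "ip (S u) v = ip u (S v)" unfolding S_def by (rule Lr_over_z_symmetric[OF u v])
    ultimately show ?thesis using E.ip_commute[OF S_mem[OF v] u] E.ip_commute[OF u v] by simp
  qed
  \<comment> \<open>The compactness comes from the space, not from \<open>T\<close>: a unit sequence
    in the eigenspace equals its own image under \<open>Q\<close> divided by \<open>z\<close>, so it
    already has a uniformly convergent subsequence, and \<open>T\<close> is bounded.\<close>
  have T_compact: "\<exists>r h. strict_mono (r :: nat \<Rightarrow> nat) \<and> h \<in> eigen_rest \<and>
         (\<lambda>n. ip (lincomb 1 (T (u (r n))) (-1) h) (lincomb 1 (T (u (r n))) (-1) h)) \<longlonglongrightarrow> 0"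
    if u: "\<And>n. u n \<in> eigen_rest" and u1: "\<And>n. ip (u n) (u n) = 1" for u
  proof -
    have uH: "u n \<in> HS" for n by (rule eigen_rest_HS[OF u])
    have zu: "z * u n x = Qr (u n) x" for n x using u[of n] by (simp add: eigen_rest_def)
    have u1': "ip (u n) (u n) \<le> 1" for n using u1 by simp
    obtain r h where r: "strict_mono (r :: nat \<Rightarrow> nat)" and h: "continuous_on I h"
      and conv: "\<forall>e>0. \<exists>N. \<forall>n x. n \<ge> N \<and> x \<in> I \<longrightarrow> \<bar>Qr (u (r n)) x - h x\<bar> < e"
      using Qr_subconvergent[of u, OF uH u1'] by (elim exE conjE)
    define h1 where "h1 x = h x / z" for x
    have ch1: "continuous_on I h1" unfolding h1_def using h z by (intro continuous_intros) auto
    have h1H: "h1 \<in> HS" by (rule HS_continuous[OF ch1])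
    have conv1: "\<exists>N. \<forall>n x. n \<ge> N \<and> x \<in> I \<longrightarrow> \<bar>u (r n) x - h1 x\<bar> < e" if e: "e > 0" for e
    proof -
      have ez: "e * \<bar>z\<bar> > 0" using e z by simp
      obtain N where N: "\<forall>n x. n \<ge> N \<and> x \<in> I \<longrightarrow> \<bar>Qr (u (r n)) x - h x\<bar> < e * \<bar>z\<bar>"
        using conv[rule_format, OF ez] by (elim exE)
      show ?thesis
      proof (intro exI[of _ N] allI impI)
        fix n x assume "n \<ge> N \<and> x \<in> I"
        with N have "\<bar>Qr (u (r n)) x - h x\<bar> < e * \<bar>z\<bar>" by simp
        moreover have "Qr (u (r n)) x - h x = (u (r n) x - h1 x) * z"
          unfolding zu[symmetric] h1_def using z by (simp add: algebra_simps)
        ultimately show "\<bar>u (r n) x - h1 x\<bar> < e" using z by (simp add: abs_mult)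
      qed
    qed
    \<comment> \<open>The uniform limit \<open>h1\<close> is controlled only on \<open>I\<close>.
      Its extension by the integral operator satisfies the eigenvalue equation everywhere and agrees
      with \<open>h1\<close> on \<open>I\<close>.\<close>
    define g where "g x = Qr h1 x / z" for x
    have lim_ip: "(\<lambda>n. ip (lincomb 1 (u (r n)) (-1) h1) (lincomb 1 (u (r n)) (-1) h1)) \<longlonglongrightarrow> 0"
      by (rule uniform_imp_ip_convergent[OF uH h1H conv1])
    have L1: "(\<integral>y. \<bar>u (r n) y - h1 y\<bar> \<partial>M) \<le> sqrt (?m * ip (lincomb 1 (u (r n)) (-1) h1) (lincomb 1 (u (r n)) (-1) h1))" for n
      using HS_L1_le_sqrt[OF HS_lincomb[OF uH h1H, of 1 "r n" "-1"] order_refl] by simp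
    have L1lim: "(\<lambda>n. sqrt (?m * ip (lincomb 1 (u (r n)) (-1) h1) (lincomb 1 (u (r n)) (-1) h1))) \<longlonglongrightarrow> 0"
      using tendsto_real_sqrt[OF tendsto_mult[OF tendsto_const lim_ip, of ?m]] by simp
    have gh1: "g x = h1 x" if x: "x \<in> I" for x
    proof -
      have "(\<lambda>n. Qr (u (r n)) x - Qr h1 x) \<longlonglongrightarrow> 0"
      proof (rule Lim_null_comparison)
        show "\<forall>\<^sub>F n in sequentially. norm (Qr (u (r n)) x - Qr h1 x)
          \<le> BK * sqrt (?m * ip (lincomb 1 (u (r n)) (-1) h1) (lincomb 1 (u (r n)) (-1) h1))"
        proof (rule always_eventually, rule allI)
          fix n
          have "Qr (u (r n)) x - Qr h1 x = Qr (lincomb 1 (u (r n)) (-1) h1) x"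
            unfolding Qr_lincomb[OF uH h1H] by simp
          also have "\<bar>\<dots>\<bar> \<le> BK * (\<integral>y. \<bar>u (r n) y - h1 y\<bar> \<partial>M)"
            using Qr_bounds(1)[OF HS_integrable[OF HS_lincomb[OF uH h1H, of 1 "r n" "-1"]], of x] by simp
          also have "\<dots> \<le> BK * sqrt (?m * ip (lincomb 1 (u (r n)) (-1) h1) (lincomb 1 (u (r n)) (-1) h1))"
            by (rule mult_left_mono[OF L1 BK_nonneg])
          finally show "norm (Qr (u (r n)) x - Qr h1 x) \<le> BK * sqrt (?m * ip (lincomb 1 (u (r n)) (-1) h1) (lincomb 1 (u (r n)) (-1) h1))"
            by simp
        qed
        show "(\<lambda>n. BK * sqrt (?m * ip (lincomb 1 (u (r n)) (-1) h1) (lincomb 1 (u (r n)) (-1) h1))) \<longlonglongrightarrow> 0"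
          using tendsto_mult[OF tendsto_const L1lim, of BK] by simp
      qed
      then have "(\<lambda>n. Qr (u (r n)) x) \<longlonglongrightarrow> Qr h1 x" by (simp add: LIM_zero_iff)
      moreover have "(\<lambda>n. Qr (u (r n)) x) \<longlonglongrightarrow> h x"
      proof (rule LIMSEQ_I)
        fix e :: real assume e: "0 < e"
        obtain N where "\<forall>n x. n \<ge> N \<and> x \<in> I \<longrightarrow> \<bar>Qr (u (r n)) x - h x\<bar> < e"
          using conv[rule_format, OF e] by (elim exE)
        then show "\<exists>no. \<forall>n\<ge>no. norm (Qr (u (r n)) x - h x) < e"
          using x by (intro exI[of _ N]) simp
      qed
      ultimately have "Qr h1 x = h x" by (rule LIMSEQ_unique)
      then show ?thesis by (simp add: g_def h1_def)
    qed
    have gH: "g \<in> HS"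
      by (rule HS_continuous, rule continuous_on_eq[OF ch1]) (simp add: gh1)
    have gz: "z * g x = Qr g x" for x
      using Qr_cong[of g h1 x] gh1 z by (simp add: g_def)
    have gconv: "\<exists>N. \<forall>n x. n \<ge> N \<and> x \<in> I \<longrightarrow> \<bar>u (r n) x - g x\<bar> < e" if e: "e > 0" for e
    proof -
      obtain N where N: "\<forall>n x. n \<ge> N \<and> x \<in> I \<longrightarrow> \<bar>u (r n) x - h1 x\<bar> < e"
        using conv1[OF e] by (elim exE)
      show ?thesis by (intro exI[of _ N] allI impI) (use N gh1 in simp)
    qed
    have limg: "(\<lambda>n. ip (lincomb 1 (u (r n)) (-1) g) (lincomb 1 (u (r n)) (-1) g)) \<longlonglongrightarrow> 0"
      by (rule uniform_imp_ip_convergent[OF uH gH gconv])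
    have "ip g (\<psi> n) = 0" if n: "lambda c \<alpha> \<psi> n = z" for n
    proof -
      have neg: "ip (lincomb 1 (u (r k)) (-1) g) (\<psi> n) = - ip g (\<psi> n)" for k
        using HS.ip_lincomb[OF uH gH psi_HS, of 1 "r k" "-1" n] u[of "r k"] n by (simp add: eigen_rest_def)
      \<comment> \<open>Cauchy-Schwarz against the unit vector \<open>\<psi> n\<close> passes
        orthogonality to the limit.\<close>
      have CS: "(ip w (\<psi> n))\<^sup>2 \<le> ip w w" if w: "w \<in> HS" for w
      proof -
        let ?s = "ip w (\<psi> n)"
        have "0 \<le> ip w w - 2 * ?s * ?s + ?s\<^sup>2 * ip (\<psi> n) (\<psi> n)"
          using HS.ip_lincomb_self[OF w psi_HS, of 1 "- ?s" n] HS.ip_nonneg[OF HS.lincomb_mem[OF w psi_HS, of 1 "- ?s" n]] by simp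
        then show ?thesis by (simp add: psi_norm power2_eq_square)
      qed
      have "(ip g (\<psi> n))\<^sup>2 \<le> ip (lincomb 1 (u (r k)) (-1) g) (lincomb 1 (u (r k)) (-1) g)" for k
        using CS[OF HS_lincomb[OF uH gH, of 1 "r k" "-1"]] unfolding neg power2_minus .
      then have "(ip g (\<psi> n))\<^sup>2 \<le> 0" by (intro LIMSEQ_le_const[OF limg] exI allI impI)
      then show ?thesis by simp
    qed
    then have gE: "g \<in> eigen_rest" using gH gz by (simp add: eigen_rest_def)
    have Teq: "lincomb 1 (T (u (r n))) (-1) (T g) = T (lincomb 1 (u (r n)) (-1) g)" for n
      by (rule T_lin[OF u gE, symmetric])
    have "(\<lambda>n. ip (lincomb 1 (T (u (r n))) (-1) (T g)) (lincomb 1 (T (u (r n))) (-1) (T g))) \<longlonglongrightarrow> 0"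
    proof (rule Lim_null_comparison)
      show "\<forall>\<^sub>F n in sequentially. norm (ip (lincomb 1 (T (u (r n))) (-1) (T g)) (lincomb 1 (T (u (r n))) (-1) (T g)))
        \<le> C * ip (lincomb 1 (u (r n)) (-1) g) (lincomb 1 (u (r n)) (-1) g)"
      proof (rule always_eventually, rule allI)
        fix n
        have m: "lincomb 1 (u (r n)) (-1) g \<in> eigen_rest" by (rule eigen_rest_lincomb[OF u gE])
        show "norm (ip (lincomb 1 (T (u (r n))) (-1) (T g)) (lincomb 1 (T (u (r n))) (-1) (T g)))
          \<le> C * ip (lincomb 1 (u (r n)) (-1) g) (lincomb 1 (u (r n)) (-1) g)"
          unfolding Teq real_norm_def abs_of_nonneg[OF E.ip_nonneg[OF T_mem[OF m]]] by (rule T_bdd[OF m])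
      qed
      show "(\<lambda>n. C * ip (lincomb 1 (u (r n)) (-1) g) (lincomb 1 (u (r n)) (-1) g)) \<longlonglongrightarrow> 0"
        using tendsto_mult[OF tendsto_const limg, of C] by simp
    qed
    with r T_mem[OF gE] show ?thesis by (intro exI[of _ r] exI[of _ "T g"] conjI)
  qed
  obtain \<Lambda> h where h: "h \<in> eigen_rest" "ip h h > 0"
    "ip (lincomb 1 (T h) (- \<Lambda>) h) (lincomb 1 (T h) (- \<Lambda>) h) = 0"
  proof (rule E.compact_symmetric_eigenvector[of T C v0])
    fix \<Lambda> h assume "h \<in> eigen_rest" "ip h h > 0" "ip (lincomb 1 (T h) (- \<Lambda>) h) (lincomb 1 (T h) (- \<Lambda>) h) = 0"
    then show ?thesis by (rule that)
  next
    fix u :: "nat \<Rightarrow> real \<Rightarrow> real" assume "\<And>n. u n \<in> eigen_rest" "\<And>n. ip (u n) (u n) = 1"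
    then show "\<exists>r h. strict_mono (r :: nat \<Rightarrow> nat) \<and> h \<in> eigen_rest \<and>
         (\<lambda>n. ip (lincomb 1 (T (u (r n))) (-1) h) (lincomb 1 (T (u (r n))) (-1) h)) \<longlonglongrightarrow> 0"
      by (rule T_compact)
  qed (rule T_mem T_lin T_sym T_bdd v0 T_pos; assumption)+
  have hH: "h \<in> HS" by (rule eigen_rest_HS[OF h(1)])
  note Ch = eigen_rest_C2(1)[OF h(1)]
  have "AE x in M. 1 * T h x + - \<Lambda> * h x = 0"
    using h(3) ip_self_zero[OF HS_lincomb[OF eigen_rest_HS[OF T_mem[OF h(1)]] hH], of 1 "- \<Lambda>"] by blast
  then have AE: "AE x in M. Lr h x / z - (\<Lambda> - \<mu>) * h x = 0"
    by eventually_elim (simp add: T_def S_def algebra_simps)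
  \<comment> \<open>Both sides are continuous, so the eigenvalue equation of \<open>T\<close>, first
    known almost everywhere, holds on all of \<open>I\<close>, as the classical eigenvalue problem
    demands.\<close>
  have eig: "Lr h x / z - (\<Lambda> - \<mu>) * h x = 0" if "x \<in> I" for x
    by (rule continuous_AE_zero[OF _ AE that])
       (intro continuous_intros Lr_over_z_continuous[OF h(1)] C2_data_continuous(1)[OF Ch])
  have nz: "\<exists>x\<in>I. h x \<noteq> 0"
  proof (rule ccontr)
    assume "\<not> (\<exists>x\<in>I. h x \<noteq> 0)"
    then have "AE x in M. h x = 0" by (intro AE_I2) auto
    then have "ip h h = 0" using ip_self_zero[OF hH] by blast
    then show False using h(2) by simp
  qed
  have "minus_L_eigenfunction c \<alpha> (\<mu> - \<Lambda>) h"
    unfolding minus_L_eigenfunction_def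
  proof (intro conjI ballI nz)
    show "C2_on_I h" by (rule C2_data_imp_C2_on_I(1)[OF Ch])
    fix x assume x: "x \<in> I"
    show "- L_op c \<alpha> h x = (\<mu> - \<Lambda>) * h x"
      using C2_data_imp_C2_on_I(2)[OF Ch x] eigen_rest_C2(2)[OF h(1), of x] eig[OF x] by (simp add: algebra_simps)
  qed
  then obtain m a where ma: "\<And>x. x \<in> I \<Longrightarrow> h x = a * \<psi> m x"
    using psi unfolding is_GPSWF_def by blast
  obtain x where x: "x \<in> I" "h x \<noteq> 0" using nz by blast
  \<comment> \<open>The function found is a multiple of some \<open>\<psi> m\<close>, and evaluating
    \<open>Qr\<close> at a point where it does not vanish shows that \<open>\<psi> m\<close> belongs
    to the eigenvalue \<open>z\<close>. It is then orthogonal to itself, a contradiction.\<close>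
  have "z * h x = Qr (\<lambda>y. a * \<psi> m y) x"
    using h(1) Qr_cong[of h "\<lambda>y. a * \<psi> m y" x] ma by (simp add: eigen_rest_def)
  also have "\<dots> = a * Qr (\<psi> m) x" by (simp add: Qr_def mult.left_commute[of _ a])
  also have "\<dots> = lambda c \<alpha> \<psi> m * h x" by (simp add: Qr_psi[OF x(1)] ma[OF x(1)])
  finally have "lambda c \<alpha> \<psi> m = z" using x(2) by simp
  then have "ip h (\<psi> m) = 0" using h(1) by (simp add: eigen_rest_def)
  moreover have "ip h (\<psi> m) = a * ip (\<psi> m) (\<psi> m)"
    unfolding ip_def integral_mult_right_zero[symmetric]
    by (rule Bochner_Integration.integral_cong) (auto simp: ma)
  ultimately have "a = 0" using psi_norm[of m] by simp
  then show False using x ma by simp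
qed

text \<open>Subtracting the component along the \<open>\<psi>\<close> with eigenvalue
  \<open>z\<close>, if there is one, lands in \<open>eigen_rest\<close>, which is null. Distinctness
  of the eigenvalues ensures that only one such component has to be removed.\<close>

theorem Qr_eigenfunction_classification:
  assumes inj: "\<And>m n. lambda c \<alpha> \<psi> m = lambda c \<alpha> \<psi> n \<Longrightarrow> m = n"
    and v: "v \<in> HS" and eig: "AE x in M. Qr v x = z * v x"
  shows "(AE x in M. v x = 0) \<or> (\<exists>n a. lambda c \<alpha> \<psi> n = z \<and> (AE x in M. v x = a * \<psi> n x))"
proof -
  \<comment> \<open>The representative for which the eigenvalue equation holds at every point, as
    membership in \<open>eigen_rest\<close> requires.\<close>
  define ext where "ext u = (\<lambda>x. Qr u x / z)" for u
  have ext_HS: "ext u \<in> HS" if "u \<in> HS" for u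
  proof -
    have "lincomb (1 / z) (Qr u) 0 (Qr u) \<in> HS" by (rule HS_lincomb[OF Qr_HS[OF that] Qr_HS[OF that]])
    then show ?thesis by (simp add: ext_def)
  qed
  have ext_eig: "z * ext u x = Qr (ext u) x" if u: "u \<in> HS" and "AE x in M. Qr u x = z * u x" for u x
  proof -
    have "AE x in M. ext u x = u x" using that(2) by eventually_elim (simp add: ext_def z)
    from Qr_cong_AE[OF ext_HS[OF u] u this] show ?thesis by (simp add: ext_def z)
  qed
  have ext_AE: "AE x in M. ext v x = v x" using eig by eventually_elim (simp add: ext_def z)
  show ?thesis
  proof (cases "\<exists>n. lambda c \<alpha> \<psi> n = z")
    case False
    then have "ext v \<in> eigen_rest" using ext_HS[OF v] ext_eig[OF v eig] by (simp add: eigen_rest_def)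
    from eigen_rest_trivial[OF this] have "AE x in M. ext v x = 0" using ip_self_zero[OF ext_HS[OF v]] by blast
    with ext_AE have "AE x in M. v x = 0" by eventually_elim simp
    then show ?thesis ..
  next
    case True
    then obtain n where n: "lambda c \<alpha> \<psi> n = z" by blast
    have psi_eig: "AE x in M. Qr (\<psi> n) x = z * \<psi> n x" by (rule AE_I2) (simp add: Qr_psi n)
    have psi_AE: "AE x in M. ext (\<psi> n) x = \<psi> n x" using psi_eig by eventually_elim (simp add: ext_def z)
    define a where "a = ip (ext v) (\<psi> n)"
    \<comment> \<open>Not only \<open>v\<close> but also \<open>\<psi> n\<close> is replaced by its
      extension, because outside \<open>I\<close> the values of \<open>\<psi> n\<close> are
      arbitrary.\<close>
    define w where "w = lincomb 1 (ext v) (- a) (ext (\<psi> n))"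
    have wH: "w \<in> HS" unfolding w_def by (rule HS_lincomb[OF ext_HS[OF v] ext_HS[OF psi_HS]])
    have "z * w x = Qr w x" for x
      unfolding w_def Qr_lincomb[OF ext_HS[OF v] ext_HS[OF psi_HS]]
      using ext_eig[OF v eig, of x] ext_eig[OF psi_HS psi_eig, of x] by (simp add: algebra_simps)
    moreover have "ip w (\<psi> k) = 0" if k: "lambda c \<alpha> \<psi> k = z" for k
    proof -
      have "k = n" using inj k n by simp
      have "ip w (\<psi> n) = ip (ext v) (\<psi> n) - a * ip (ext (\<psi> n)) (\<psi> n)"
        unfolding w_def using HS.ip_lincomb[OF ext_HS[OF v] ext_HS[OF psi_HS] psi_HS, of 1 "- a" n n] by simp
      also have "ip (ext (\<psi> n)) (\<psi> n) = 1"
        using ip_cong_AE[OF ext_HS[OF psi_HS] psi_HS psi_HS psi_AE] psi_norm by simp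
      finally show ?thesis using \<open>k = n\<close> by (simp add: a_def)
    qed
    ultimately have "w \<in> eigen_rest" using wH by (simp add: eigen_rest_def)
    from eigen_rest_trivial[OF this] have "AE x in M. w x = 0" using ip_self_zero[OF wH] by blast
    with ext_AE psi_AE have "AE x in M. v x = a * \<psi> n x" by eventually_elim (simp add: w_def)
    then show ?thesis using n by blast
  qed
qed

end

end

end

section \<open>The band and the energy ratio\<close>

lemma AE_lborel_scale:
  fixes P :: "real \<Rightarrow> bool"
  assumes "c \<noteq> 0" "AE x in lborel. P x"
  shows "AE x in lborel. P (c * x)"
proof -
  obtain N where N: "{x \<in> space lborel. \<not> P x} \<subseteq> N" "emeasure lborel N = 0" "N \<in> sets lborel"
    using AE_E[OF assms(2)] by blast
  have [measurable]: "N \<in> sets borel" using N(3) by simp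
  have "AE x in lborel. x \<notin> N" by (rule AE_I[of _ _ N]) (use N in auto)
  from AE_borel_affine[OF assms(1) _ this, of 0] have "AE x in lborel. c * x \<notin> N" by simp
  then show ?thesis by eventually_elim (use N(1) in auto)
qed

lemma is_L2_fourier_cong_AE:
  assumes F: "is_L2_fourier f F" and G: "G \<in> borel_measurable borel" and eq: "AE x in lborel. F x = G x"
  shows "is_L2_fourier f G"
proof -
  have [measurable]: "F \<in> borel_measurable borel" "G \<in> borel_measurable borel"
    using F G by (auto simp: is_L2_fourier_def L2_line_iff)
  have "integrable lborel (\<lambda>x. (cmod (F x))\<^sup>2)" using F by (simp add: is_L2_fourier_def L2_line_iff)
  then have "integrable lborel (\<lambda>x. (cmod (G x))\<^sup>2)"
    by (subst integrable_cong_AE[where g="\<lambda>x. (cmod (F x))\<^sup>2"]) (use eq in auto)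
  moreover have "(\<integral>\<^sup>+ \<xi>. ennreal ((cmod (G \<xi> - h \<xi>))\<^sup>2) \<partial>lborel) = (\<integral>\<^sup>+ \<xi>. ennreal ((cmod (F \<xi> - h \<xi>))\<^sup>2) \<partial>lborel)" for h
    by (rule nn_integral_cong_AE) (use eq in auto)
  ultimately show ?thesis using F G by (simp add: is_L2_fourier_def L2_line_iff)
qed

text \<open>The complement of the essential support is a possibly uncountable union of open sets on
  which \<open>F\<close> vanishes almost everywhere; Lindelof reduces it to a countable one.\<close>

lemma ess_support_AE_zero:
  assumes "ess_support F \<subseteq> S"
  shows "AE x in lborel. x \<notin> S \<longrightarrow> F x = 0"
proof -
  define \<F> where "\<F> = {U. open U \<and> (AE y in lborel. y \<in> U \<longrightarrow> F y = 0)}"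
  obtain \<F>' where \<F>': "\<F>' \<subseteq> \<F>" "countable \<F>'" "\<Union>\<F>' = \<Union>\<F>"
    by (rule Lindelof[of \<F>]) (auto simp: \<F>_def)
  have "AE y in lborel. \<forall>U\<in>\<F>'. y \<in> U \<longrightarrow> F y = 0"
    by (rule AE_ball_countable'[OF _ \<F>'(2)]) (use \<F>'(1) in \<open>auto simp: \<F>_def\<close>)
  then show ?thesis
  proof eventually_elim
    case (elim y)
    show ?case
    proof
      assume "y \<notin> S"
      then have "y \<notin> ess_support F" using assms by blast
      then have "y \<in> \<Union>\<F>" by (auto simp: ess_support_def \<F>_def)
      then show "F y = 0" using elim \<F>'(3) by blast
    qed
  qed
qed

section \<open>Change of variables between the band and the unit interval\<close>

context prolate
begin

abbreviation W :: "real \<Rightarrow> real" where "W \<equiv> band_weight c \<alpha>"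

lemma band_scale: "c * x \<in> band c \<longleftrightarrow> x \<in> {-1<..<1}"
  using c_pos mult_less_cancel_left_pos[of c x 1] mult_less_cancel_left_pos[of c "-1" x] by auto

text \<open>The band is open and \<open>I\<close> is closed; the discrepancy consists of the two
  endpoints, which are null. The same remark underlies the transfer of integrals and
  measurability.\<close>

lemma AE_band_iff: "(AE x in lborel. x \<in> band c \<longrightarrow> P x) \<longleftrightarrow> (AE x in lborel. x \<in> I \<longrightarrow> P (c * x))"
proof
  assume "AE x in lborel. x \<in> band c \<longrightarrow> P x"
  from AE_lborel_scale[OF _ this, of c] have "AE x in lborel. c * x \<in> band c \<longrightarrow> P (c * x)" using c_pos by simp
  moreover have "AE x in lborel. x \<noteq> (-1::real)" "AE x in lborel. x \<noteq> (1::real)" by (rule AE_lborel_singleton)+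
  ultimately show "AE x in lborel. x \<in> I \<longrightarrow> P (c * x)"
    unfolding band_scale by eventually_elim auto
next
  assume "AE x in lborel. x \<in> I \<longrightarrow> P (c * x)"
  from AE_lborel_scale[OF _ this, of "1 / c"] have "AE x in lborel. 1 / c * x \<in> I \<longrightarrow> P x" using c_pos by simp
  then show "AE x in lborel. x \<in> band c \<longrightarrow> P x"
    by eventually_elim (use c_pos in \<open>auto simp: field_simps\<close>)
qed

lemma indicator_band_scale: "indicator (band c) (c * x) = (indicator {-1<..<1} x :: real)"
  by (simp only: indicator_def band_scale)

lemma set_integral_band:
  fixes f :: "real \<Rightarrow> 'a::{banach, second_countable_topology}"
  shows "(LINT x:band c|lborel. f x) = c *\<^sub>R (LINT x:I|lborel. f (c * x))"
proof -
  have "(LINT x:band c|lborel. f x) = c *\<^sub>R (LINT x:{-1<..<1}|lborel. f (c * x))"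
    unfolding set_lebesgue_integral_def
    using lborel_integral_real_affine[of c "\<lambda>x. indicator (band c) x *\<^sub>R f x" 0] c_pos
    by (simp only: indicator_band_scale add_0 abs_of_pos)
  also have "(LINT x:{-1<..<1}|lborel. f (c * x)) = (LINT x:I|lborel. f (c * x))"
    by (rule set_integral_discrete_difference[where X="{-1, 1}"]) auto
  finally show ?thesis .
qed

lemma set_integrable_band:
  fixes f :: "real \<Rightarrow> 'a::{banach, second_countable_topology}"
  shows "set_integrable lborel (band c) f \<longleftrightarrow> set_integrable lborel I (\<lambda>x. f (c * x))"
proof -
  have "set_integrable lborel (band c) f \<longleftrightarrow> integrable lborel (\<lambda>x. indicator {-1<..<1} x *\<^sub>R f (c * x))"
    unfolding set_integrable_def
    using lborel_integrable_real_affine_iff[of c "\<lambda>x. indicator (band c) x *\<^sub>R f x" 0] c_pos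
    by (simp only: indicator_band_scale add_0)
  also have "\<dots> \<longleftrightarrow> set_integrable lborel I (\<lambda>x. f (c * x))"
    unfolding set_integrable_def
    by (rule integrable_discrete_difference[where X="{-1, 1}"]) (auto simp: indicator_def)
  finally show ?thesis .
qed

lemma set_borel_measurable_band:
  fixes f :: "real \<Rightarrow> complex"
  shows "set_borel_measurable lborel (band c) f \<longleftrightarrow> set_borel_measurable lborel I (\<lambda>x. f (c * x))"
proof -
  have "set_borel_measurable lborel (band c) f \<longleftrightarrow> (\<lambda>x. indicator {-1<..<1} x *\<^sub>R f (c * x)) \<in> borel_measurable borel"
  proof
    assume "set_borel_measurable lborel (band c) f"
    then have [measurable]: "(\<lambda>x. indicator (band c) x *\<^sub>R f x) \<in> borel_measurable borel"
      by (simp add: set_borel_measurable_def)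
    have "(\<lambda>x. (\<lambda>x. indicator (band c) x *\<^sub>R f x) (c * x)) \<in> borel_measurable borel" by measurable
    then show "(\<lambda>x. indicator {-1<..<1} x *\<^sub>R f (c * x)) \<in> borel_measurable borel" by (simp only: indicator_band_scale)
  next
    assume [measurable]: "(\<lambda>x. indicator {-1<..<1} x *\<^sub>R f (c * x)) \<in> borel_measurable borel"
    have "(\<lambda>x. (\<lambda>x. indicator {-1<..<1} x *\<^sub>R f (c * x)) (x / c)) \<in> borel_measurable borel" by measurable
    also have "(\<lambda>x. (\<lambda>x. indicator {-1<..<1} x *\<^sub>R f (c * x)) (x / c)) = (\<lambda>x. indicator (band c) x *\<^sub>R f x)"
      using c_pos by (auto simp: fun_eq_iff indicator_def field_simps)
    finally show "set_borel_measurable lborel (band c) f" by (simp add: set_borel_measurable_def)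
  qed
  also have "\<dots> \<longleftrightarrow> (\<lambda>x. indicator I x *\<^sub>R f (c * x)) \<in> borel_measurable borel"
  proof -
    have d: "indicator {-1<..<1} x *\<^sub>R f (c * x) = indicator I x *\<^sub>R f (c * x)" if "x \<notin> {-1, 1}" for x :: real
    proof -
      have "x \<in> {-1<..<1} \<longleftrightarrow> x \<in> I" using that by auto
      then show ?thesis by (simp add: indicator_def)
    qed
    show ?thesis
    proof
      assume A: "(\<lambda>x. indicator {-1<..<1} x *\<^sub>R f (c * x)) \<in> borel_measurable borel"
      show "(\<lambda>x. indicator I x *\<^sub>R f (c * x)) \<in> borel_measurable borel"
        by (rule measurable_discrete_difference[where X="{-1, 1}", OF A _ _ _ d]) auto
    next
      assume A: "(\<lambda>x. indicator I x *\<^sub>R f (c * x)) \<in> borel_measurable borel"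
      show "(\<lambda>x. indicator {-1<..<1} x *\<^sub>R f (c * x)) \<in> borel_measurable borel"
        by (rule measurable_discrete_difference[where X="{-1, 1}", OF A _ _ _ d[symmetric]]) auto
    qed
  qed
  finally show ?thesis by (simp add: set_borel_measurable_def)
qed

lemma L2w_band_iff: "g \<in> L2w (band c) W \<longleftrightarrow> (\<lambda>x. g (c * x)) \<in> L2w I (\<omega> \<alpha>)"
  unfolding L2w_def mem_Collect_eq set_borel_measurable_band set_integrable_band using c_pos by simp

lemma L2_norm_sq_band: "L2_norm_sq (band c) W g = c * L2_norm_sq I (\<omega> \<alpha>) (\<lambda>x. g (c * x))"
  unfolding L2_norm_sq_def set_integral_band using c_pos by simp

text \<open>The Jacobian \<open>c\<close> turns the prefactor \<open>1 / (2 * pi)\<close> into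
  \<open>c / (2 * pi)\<close>, and evenness of the kernel reconciles \<open>y - x\<close> with
  \<open>x - y\<close>. Everything about \<open>two_pi_Q\<close> is obtained from \<open>Q_c\<close>
  through this identity.\<close>

lemma two_pi_Q_scale: "two_pi_Q c \<alpha> g (c * x) = Q_c c \<alpha> (\<lambda>t. g (c * t)) x"
proof -
  have k: "kernel \<alpha> (c * t - c * x) = kernel \<alpha> (c * (x - t))" for t
    using kc_parity(1)[of "c * (x - t)"] by (simp add: kernel_eq algebra_simps)
  have "two_pi_Q c \<alpha> g (c * x) = of_real (c / (2 * pi)) * (LINT t:I|lborel. kernel \<alpha> (c * (x - t)) * g (c * t) * of_real (\<omega> \<alpha> t))"
    unfolding two_pi_Q_def set_integral_band k using c_pos by (simp add: scaleR_conv_of_real)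
  also have "\<dots> = Q_c c \<alpha> (\<lambda>t. g (c * t)) x"
    unfolding Q_c_def set_integral_mult_right[symmetric] by (simp add: mult.assoc)
  finally show ?thesis .
qed

lemma two_pi_Q_eq: "two_pi_Q c \<alpha> g x = Q_c c \<alpha> (\<lambda>t. g (c * t)) (x / c)"
  using two_pi_Q_scale[of g "x / c"] c_pos by simp

lemma L2_eigenfunction_band_iff:
  "L2_eigenfunction (band c) W (two_pi_Q c \<alpha>) z g \<longleftrightarrow> L2_eigenfunction I (\<omega> \<alpha>) (Q_c c \<alpha>) z (\<lambda>x. g (c * x))"
  unfolding L2_eigenfunction_def L2w_band_iff AE_band_iff two_pi_Q_scale ..

lemma compact_two_pi_Q: "compact_L2_operator (band c) W (two_pi_Q c \<alpha>)"
  unfolding compact_L2_operator_def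
proof (intro conjI ballI allI impI)
  fix f assume "f \<in> L2w (band c) W"
  then show "two_pi_Q c \<alpha> f \<in> L2w (band c) W"
    using compact_Q_c unfolding L2w_band_iff two_pi_Q_scale compact_L2_operator_def by blast
next
  fix f g a b assume "f \<in> L2w (band c) W" "g \<in> L2w (band c) W"
  then show "AE x in lborel. x \<in> band c \<longrightarrow> two_pi_Q c \<alpha> (\<lambda>t. a * f t + b * g t) x = a * two_pi_Q c \<alpha> f x + b * two_pi_Q c \<alpha> g x"
    unfolding two_pi_Q_eq L2w_band_iff by (simp add: Q_c_linear)
next
  fix u :: "nat \<Rightarrow> real \<Rightarrow> complex"
  assume "(\<forall>n. u n \<in> L2w (band c) W) \<and> (\<exists>C. \<forall>n. L2_norm_sq (band c) W (u n) \<le> C)"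
  then obtain C where u: "\<And>n. (\<lambda>x. u n (c * x)) \<in> L2w I (\<omega> \<alpha>)" and C: "\<And>n. c * L2_norm_sq I (\<omega> \<alpha>) (\<lambda>x. u n (c * x)) \<le> C"
    unfolding L2w_band_iff L2_norm_sq_band by blast
  have "L2_norm_sq I (\<omega> \<alpha>) (\<lambda>x. u n (c * x)) \<le> C / c" for n
    using C[of n] c_pos by (simp add: field_simps)
  then have "(\<forall>n. (\<lambda>n x. u n (c * x)) n \<in> L2w I (\<omega> \<alpha>)) \<and> (\<exists>C. \<forall>n. L2_norm_sq I (\<omega> \<alpha>) ((\<lambda>n x. u n (c * x)) n) \<le> C)"
    using u by blast
  then obtain r h where r: "strict_mono (r :: nat \<Rightarrow> nat)" and h: "h \<in> L2w I (\<omega> \<alpha>)"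
    and lim: "(\<lambda>n. L2_norm_sq I (\<omega> \<alpha>) (\<lambda>x. Q_c c \<alpha> (\<lambda>t. u (r n) (c * t)) x - h x)) \<longlonglongrightarrow> 0"
    using conjunct2[OF conjunct2[OF compact_Q_c[unfolded compact_L2_operator_def]], THEN spec[of _ "\<lambda>n x. u n (c * x)"]]
    by (elim impE exE conjE) blast+
  have e: "(\<lambda>x. h (c * x / c)) = h" using c_pos by simp
  have "(\<lambda>n. L2_norm_sq (band c) W (\<lambda>x. two_pi_Q c \<alpha> (u (r n)) x - h (x / c))) \<longlonglongrightarrow> 0"
    unfolding L2_norm_sq_band two_pi_Q_scale using tendsto_mult[OF tendsto_const lim, of c] c_pos by simp
  moreover have "(\<lambda>x. h (x / c)) \<in> L2w (band c) W" unfolding L2w_band_iff e by (rule h)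
  ultimately show "\<exists>r h. strict_mono r \<and> h \<in> L2w (band c) W \<and> (\<lambda>n. L2_norm_sq (band c) W (\<lambda>x. two_pi_Q c \<alpha> (u (r n)) x - h x)) \<longlonglongrightarrow> 0"
    using r by (intro exI[of _ r] exI[of _ "\<lambda>x. h (x / c)"] conjI)
qed

text \<open>The Hermitian form of \<open>Q\<close> at a complex function, split into real forms;
  mixed terms cancel by symmetry of the real kernel.\<close>

definition Q_energy :: "(real \<Rightarrow> complex) \<Rightarrow> real" where
  "Q_energy G = ip (Qr (\<lambda>y. Re (G y))) (\<lambda>y. Re (G y)) + ip (Qr (\<lambda>y. Im (G y))) (\<lambda>y. Im (G y))"

text \<open>Reduces complex eigenfunctions to real ones. Once the eigenvalue is known to be real,
  real and imaginary part satisfy the eigenvalue equation separately, though either may be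
  null.\<close>

lemma Q_c_eigenfunction_ReIm:
  assumes "L2_eigenfunction I (\<omega> \<alpha>) (Q_c c \<alpha>) z G"
  shows "G \<in> L2w I (\<omega> \<alpha>)" and "0 < (\<integral>x. (cmod (G x))\<^sup>2 \<partial>M)" and "z \<in> \<real>"
    and "Q_energy G = Re z * (\<integral>x. (cmod (G x))\<^sup>2 \<partial>M)"
    and "AE x in M. Qr (\<lambda>y. Re (G y)) x = Re z * Re (G x)" and "AE x in M. Qr (\<lambda>y. Im (G y)) x = Re z * Im (G x)"
proof -
  let ?P = "\<lambda>y. Re (G y)" and ?R = "\<lambda>y. Im (G y)"
  show G: "G \<in> L2w I (\<omega> \<alpha>)" using assms by (simp add: L2_eigenfunction_def)
  have nz: "\<not> (AE x in M. G x = 0)" and eig: "AE x in M. Q_c c \<alpha> G x = z * G x"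
    using assms unfolding L2_eigenfunction_def AE_M by auto
  note P = L2w_I_ReIm(1)[OF G] and R = L2w_I_ReIm(2)[OF G]
  have i2: "integrable M (\<lambda>x. (cmod (G x))\<^sup>2)" using G by (simp add: L2w_I_iff)
  have "(\<integral>x. (cmod (G x))\<^sup>2 \<partial>M) \<noteq> 0"
    using nz by (subst integral_nonneg_eq_0_iff_AE[OF i2]) auto
  then show pos: "0 < (\<integral>x. (cmod (G x))\<^sup>2 \<partial>M)"
    using Bochner_Integration.integral_nonneg[of M "\<lambda>x. (cmod (G x))\<^sup>2"] by (simp add: less_le)
  have re: "AE x in M. Qr ?P x = Re z * ?P x - Im z * ?R x" and im: "AE x in M. Qr ?R x = Im z * ?P x + Re z * ?R x"
    using eig unfolding Q_c_ReIm[OF G] by (auto elim!: eventually_mono simp: complex_eq_iff algebra_simps)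
  have lc: "lincomb (Re z) ?P (- Im z) ?R \<in> HS" "lincomb (Im z) ?P (Re z) ?R \<in> HS" by (rule HS_lincomb[OF P R])+
  have PP: "ip (Qr ?P) u = Re z * ip ?P u - Im z * ip ?R u" if u: "u \<in> HS" for u
    using ip_cong_AE[OF Qr_HS[OF P] lc(1) u] re HS.ip_lincomb[OF P R u, of "Re z" "- Im z"] by simp
  have RR: "ip (Qr ?R) u = Im z * ip ?P u + Re z * ip ?R u" if u: "u \<in> HS" for u
    using ip_cong_AE[OF Qr_HS[OF R] lc(2) u] im HS.ip_lincomb[OF P R u, of "Im z" "Re z"] by simp
  note nrm = L2w_I_ReIm(4)[OF G]
  \<comment> \<open>Symmetry of the mixed terms forces \<open>Im z\<close> times the squared norm of
    \<open>G\<close> to vanish; this is where the eigenvalue becomes real.\<close>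
  have "ip (Qr ?P) ?R = ip (Qr ?R) ?P"
    using Qr_symmetric[OF P R] HS.ip_commute[OF P Qr_HS[OF R]] by simp
  then have "Im z * (ip ?P ?P + ip ?R ?R) = 0"
    unfolding PP[OF R] RR[OF P] using HS.ip_commute[OF P R] by (simp add: algebra_simps)
  then have Im0: "Im z = 0" using pos nrm by simp
  then show "z \<in> \<real>" by (simp add: complex_is_Real_iff)
  show "Q_energy G = Re z * (\<integral>x. (cmod (G x))\<^sup>2 \<partial>M)"
    unfolding Q_energy_def PP[OF P] RR[OF R] nrm using Im0 by (simp add: algebra_simps)
  show "AE x in M. Qr ?P x = Re z * ?P x" "AE x in M. Qr ?R x = Re z * ?R x"
    using re im Im0 by simp_all
qed

lemma largest_eigenvalue_Q_c:
  obtains \<Lambda> where "\<Lambda> > 0" "\<exists>G. L2_eigenfunction I (\<omega> \<alpha>) (Q_c c \<alpha>) (of_real \<Lambda>) G"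
    "\<And>z G. L2_eigenfunction I (\<omega> \<alpha>) (Q_c c \<alpha>) z G \<Longrightarrow> z \<in> \<real> \<and> Re z \<le> \<Lambda>"
    "\<And>G. G \<in> L2w I (\<omega> \<alpha>) \<Longrightarrow> Q_energy G \<le> \<Lambda> * (\<integral>x. (cmod (G x))\<^sup>2 \<partial>M)"
proof -
  obtain \<Lambda> h where L: "\<Lambda> > 0" "h \<in> HS" "ip h h > 0" "AE x in M. Qr h x = \<Lambda> * h x"
    and le: "\<And>v. v \<in> HS \<Longrightarrow> ip (Qr v) v \<le> \<Lambda> * ip v v"
    using Qr_top_eigenvector by blast
  have E: "Q_energy G \<le> \<Lambda> * (\<integral>x. (cmod (G x))\<^sup>2 \<partial>M)" if G: "G \<in> L2w I (\<omega> \<alpha>)" for G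
    unfolding Q_energy_def L2w_I_ReIm(4)[OF G]
    using le[OF L2w_I_ReIm(1)[OF G]] le[OF L2w_I_ReIm(2)[OF G]] by (simp add: algebra_simps)
  have "\<not> (AE x in M. h x = 0)" using L(3) ip_self_zero[OF L(2)] by auto
  then have "L2_eigenfunction I (\<omega> \<alpha>) (Q_c c \<alpha>) (of_real \<Lambda>) (\<lambda>x. of_real (h x))"
    unfolding L2_eigenfunction_def AE_M[symmetric] Q_c_of_real[OF L(2)]
    using L2w_I_of_real[OF L(2)] L(4) by (auto simp flip: of_real_mult)
  moreover have "z \<in> \<real> \<and> Re z \<le> \<Lambda>" if z: "L2_eigenfunction I (\<omega> \<alpha>) (Q_c c \<alpha>) z G" for z G
    using Q_c_eigenfunction_ReIm[OF z] E by (metis mult_le_cancel_right_pos)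
  ultimately show ?thesis using that[OF L(1)] E by blast
qed

section \<open>The Paley-Wiener space and its densities on the band\<close>

definition band_spectrum :: "(real \<Rightarrow> complex) \<Rightarrow> real \<Rightarrow> complex" where
  "band_spectrum g x = indicator (band c) x *\<^sub>R (g x * of_real (W x))"

lemma W_le_1: "x \<in> band c \<Longrightarrow> W x \<le> 1"
  using c_pos by (intro omega_le_1) (auto simp: field_simps)

lemma W_mult: "x \<in> band c \<Longrightarrow> W x * band_weight c (- \<alpha>) x = 1"
  using c_pos by (intro omega_mult_neg) (auto simp: field_simps)

text \<open>The weight is at most 1, so its square may be replaced by the weight itself; boundedness
  of the band then gives integrability. These are the hypotheses of the inversion theorem.\<close>

lemma band_spectrum_integrable:
  assumes g: "g \<in> L2w (band c) W"
  shows "integrable lborel (band_spectrum g)" "integrable lborel (\<lambda>x. (cmod (band_spectrum g x))\<^sup>2)"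
proof -
  have [measurable]: "(\<lambda>x. indicator (band c) x *\<^sub>R g x) \<in> borel_measurable borel"
    and i: "integrable lborel (\<lambda>x. indicator (band c) x *\<^sub>R ((cmod (g x))\<^sup>2 * W x))"
    using g by (auto simp: L2w_def set_borel_measurable_def set_integrable_def)
  have "(\<lambda>x. (indicator (band c) x *\<^sub>R g x) * of_real (W x)) \<in> borel_measurable borel" by measurable
  then have [measurable]: "band_spectrum g \<in> borel_measurable borel"
    by (simp add: band_spectrum_def[abs_def])
  show i2: "integrable lborel (\<lambda>x. (cmod (band_spectrum g x))\<^sup>2)"
  proof (rule Bochner_Integration.integrable_bound[OF i])
    show "AE x in lborel. norm ((cmod (band_spectrum g x))\<^sup>2) \<le> norm (indicator (band c) x *\<^sub>R ((cmod (g x))\<^sup>2 * W x))"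
    proof (rule AE_I2)
      fix x
      show "norm ((cmod (band_spectrum g x))\<^sup>2) \<le> norm (indicator (band c) x *\<^sub>R ((cmod (g x))\<^sup>2 * W x))"
      proof (cases "x \<in> band c")
        case True
        have "(W x)\<^sup>2 \<le> W x" using W_le_1[OF True] by (simp add: power2_eq_square mult_left_le)
        then have "(cmod (g x))\<^sup>2 * (W x)\<^sup>2 \<le> (cmod (g x))\<^sup>2 * W x" by (rule mult_left_mono) simp
        then show ?thesis using True by (simp add: band_spectrum_def norm_mult power_mult_distrib)
      qed (simp add: band_spectrum_def)
    qed
  qed measurable
  have ii: "integrable lborel (\<lambda>x. indicator (band c) x + (cmod (band_spectrum g x))\<^sup>2)"
    using i2 c_pos by (intro Bochner_Integration.integrable_add) (auto simp: integrable_indicator_iff)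
  show "integrable lborel (band_spectrum g)"
  proof (rule Bochner_Integration.integrable_bound[OF ii])
    show "AE x in lborel. norm (band_spectrum g x) \<le> norm (indicator (band c) x + (cmod (band_spectrum g x))\<^sup>2)"
    proof (rule AE_I2)
      fix x
      have "2 * 1 * cmod (band_spectrum g x) \<le> 1\<^sup>2 + (cmod (band_spectrum g x))\<^sup>2" by (rule sum_squares_bound)
      moreover have "0 \<le> cmod (band_spectrum g x)" by simp
      ultimately have "cmod (band_spectrum g x) \<le> 1 + (cmod (band_spectrum g x))\<^sup>2" by (simp only: one_power2)
      then show "norm (band_spectrum g x) \<le> norm (indicator (band c) x + (cmod (band_spectrum g x))\<^sup>2)"
        by (cases "x \<in> band c") (simp_all add: band_spectrum_def)
    qed
  qed measurable
qed

text \<open>The link between the two problems: recovering a band-limited function from its density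
  is, after rescaling, the finite Fourier transform.\<close>

lemma inverse_FT_band_spectrum:
  "inverse_FT (band_spectrum g) x = of_real (c / (2 * pi)) * F_c c \<alpha> (\<lambda>t. g (c * t)) x"
proof -
  have "inverse_FT (band_spectrum g) x = of_real (1 / (2 * pi)) * (LINT \<xi>:band c|lborel. exp (\<i> * of_real (x * \<xi>)) * (g \<xi> * of_real (W \<xi>)))"
    unfolding inverse_FT_def band_spectrum_def set_lebesgue_integral_def by simp
  also have "\<dots> = of_real (c / (2 * pi)) * F_c c \<alpha> (\<lambda>t. g (c * t)) x"
    unfolding set_integral_band F_c_def using c_pos by (simp add: scaleR_conv_of_real mult_ac)
  finally show ?thesis .
qed

text \<open>The weight with exponent \<open>- \<alpha>\<close> cancels one of the two weight factors
  in the squared modulus of \<open>g\<close> times the weight. Hence the norm imposed on the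
  transform is the natural norm of the density.\<close>

lemma L2_norm_sq_band_spectrum:
  assumes F: "F \<in> L2_line" and g: "g \<in> L2w (band c) W"
    and eq: "AE x in lborel. x \<in> band c \<longrightarrow> F x = g x * of_real (W x)"
  shows "F \<in> L2w (band c) (band_weight c (- \<alpha>))"
    and "L2_norm_sq (band c) (band_weight c (- \<alpha>)) F = L2_norm_sq (band c) W g"
proof -
  have [measurable]: "(\<lambda>x. indicator (band c) x *\<^sub>R g x) \<in> borel_measurable borel" "F \<in> borel_measurable borel"
    and i: "integrable lborel (\<lambda>x. indicator (band c) x *\<^sub>R ((cmod (g x))\<^sup>2 * W x))"
    using F g by (auto simp: L2w_def set_borel_measurable_def set_integrable_def L2_line_iff)
  have m: "(\<lambda>x. indicator (band c) x *\<^sub>R ((cmod (F x))\<^sup>2 * band_weight c (- \<alpha>) x)) \<in> borel_measurable lborel" by measurable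
  have ae: "AE x in lborel. indicator (band c) x *\<^sub>R ((cmod (F x))\<^sup>2 * band_weight c (- \<alpha>) x) = indicator (band c) x *\<^sub>R ((cmod (g x))\<^sup>2 * W x)"
    using eq
  proof eventually_elim
    case (elim x)
    show ?case
    proof (cases "x \<in> band c")
      case True
      have "(cmod (F x))\<^sup>2 * band_weight c (- \<alpha>) x = (cmod (g x))\<^sup>2 * W x * (W x * band_weight c (- \<alpha>) x)"
        using elim True by (simp add: norm_mult power_mult_distrib power2_eq_square mult_ac)
      then show ?thesis unfolding W_mult[OF True] by simp
    qed simp
  qed
  have "integrable lborel (\<lambda>x. indicator (band c) x *\<^sub>R ((cmod (F x))\<^sup>2 * band_weight c (- \<alpha>) x))"
    using i integrable_cong_AE[OF m _ ae] by auto
  then show "F \<in> L2w (band c) (band_weight c (- \<alpha>))"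
    by (simp add: L2w_def set_borel_measurable_def set_integrable_def)
  show "L2_norm_sq (band c) (band_weight c (- \<alpha>)) F = L2_norm_sq (band c) W g"
    unfolding L2_norm_sq_def set_lebesgue_integral_def
    by (rule integral_cong_AE[OF m _ ae]) (use i in auto)
qed

lemma paley_wiener_density:
  assumes f: "f \<in> paley_wiener c \<alpha>"
  shows "\<exists>g \<in> L2w (band c) W. AE x in lborel. x \<in> band c \<longrightarrow> L2_fourier f x = g x * of_real (W x)"
proof
  let ?F = "L2_fourier f" and ?w = "band_weight c (- \<alpha>)"
  define g where "g x = ?F x * of_real (?w x)" for x
  have eq: "?F x = g x * of_real (W x)" if "x \<in> band c" for x
  proof -
    have "complex_of_real (?w x) * of_real (W x) = 1"
      unfolding of_real_mult[symmetric] mult.commute[of "?w x"] W_mult[OF that] by simp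
    then show ?thesis by (simp add: g_def mult.assoc)
  qed
  then show "AE x in lborel. x \<in> band c \<longrightarrow> ?F x = g x * of_real (W x)" by simp
  have [measurable]: "(\<lambda>x. indicator (band c) x *\<^sub>R ?F x) \<in> borel_measurable borel"
    and i: "integrable lborel (\<lambda>x. indicator (band c) x *\<^sub>R ((cmod (?F x))\<^sup>2 * ?w x))"
    using f by (auto simp: paley_wiener_def L2w_def set_borel_measurable_def set_integrable_def)
  have "(\<lambda>x. (indicator (band c) x *\<^sub>R ?F x) * of_real (?w x)) \<in> borel_measurable borel" by measurable
  then have "set_borel_measurable lborel (band c) g" by (simp add: set_borel_measurable_def g_def)
  moreover have e2: "indicator (band c) x *\<^sub>R ((cmod (g x))\<^sup>2 * W x) = indicator (band c) x *\<^sub>R ((cmod (?F x))\<^sup>2 * ?w x)" for x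
  proof (cases "x \<in> band c")
    case True
    have "(cmod (g x))\<^sup>2 * W x = (cmod (?F x))\<^sup>2 * ?w x * (W x * ?w x)"
      by (simp add: g_def norm_mult power_mult_distrib power2_eq_square mult_ac)
    then show ?thesis unfolding W_mult[OF True] by simp
  qed simp
  have "set_integrable lborel (band c) (\<lambda>x. (cmod (g x))\<^sup>2 * W x)" unfolding set_integrable_def e2 by (rule i)
  ultimately show "g \<in> L2w (band c) W" by (simp add: L2w_def)
qed

text \<open>The support condition extends the formula for the transform from the band to the line,
  and injectivity of the transform in the mean then identifies \<open>f\<close> with the explicit
  inverse transform.\<close>

lemma paley_wiener_fourier:
  assumes f: "f \<in> paley_wiener c \<alpha>" and g: "g \<in> L2w (band c) W"
    and eq: "AE x in lborel. x \<in> band c \<longrightarrow> L2_fourier f x = g x * of_real (W x)"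
  shows "is_L2_fourier f (L2_fourier f)" and "AE x in lborel. L2_fourier f x = band_spectrum g x"
    and "AE x in lborel. f x = inverse_FT (band_spectrum g) x"
proof -
  have fL: "f \<in> L2_line" and supp: "ess_support (L2_fourier f) \<subseteq> {-c..c}" using f by (auto simp: paley_wiener_def)
  show F: "is_L2_fourier f (L2_fourier f)" by (rule L2_fourier_is_fourier[OF fL])
  have "AE x in lborel. x \<noteq> - c" "AE x in lborel. x \<noteq> c" by (rule AE_lborel_singleton)+
  with ess_support_AE_zero[OF supp] eq show ae: "AE x in lborel. L2_fourier f x = band_spectrum g x"
    by eventually_elim (auto simp: band_spectrum_def indicator_def)
  note b = band_spectrum_integrable[OF g]
  have "is_L2_fourier f (band_spectrum g)" by (rule is_L2_fourier_cong_AE[OF F _ ae]) (use b(1) in auto)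
  then show "AE x in lborel. f x = inverse_FT (band_spectrum g) x"
    by (rule is_L2_fourier_inj[OF fL is_L2_fourier_inverse_FT(1)[OF b] _ is_L2_fourier_inverse_FT(2)[OF b]])
qed

text \<open>On \<open>I\<close> the function is \<open>c / (2 * pi)\<close> times a finite Fourier
  transform, so by \<open>F_c_energy\<close> its energy is \<open>c / (2 * pi)\<close> times the
  form of \<open>Q\<close>. The denominator carries the Jacobian \<open>c\<close>, and the factor
  \<open>2 * pi\<close> in the ratio makes all constants cancel.\<close>

lemma energy_ratio_eq:
  assumes f: "f \<in> paley_wiener c \<alpha>" and g: "g \<in> L2w (band c) W"
    and eq: "AE x in lborel. x \<in> band c \<longrightarrow> L2_fourier f x = g x * of_real (W x)"
  shows "energy_ratio c \<alpha> f = Q_energy (\<lambda>x. g (c * x)) / (\<integral>x. (cmod (g (c * x)))\<^sup>2 \<partial>M)"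
proof -
  let ?G = "\<lambda>x. g (c * x)"
  have G: "?G \<in> L2w I (\<omega> \<alpha>)" using g by (simp add: L2w_band_iff)
  then have mG: "?G \<in> borel_measurable M" by (simp add: L2w_I_iff)
  note F = paley_wiener_fourier[OF f g eq]
  have FL: "L2_fourier f \<in> L2_line" using F(1) by (simp add: is_L2_fourier_def)
  have "f \<in> borel_measurable borel" using f by (simp add: paley_wiener_def L2_line_iff)
  then have mf[measurable]: "f \<in> borel_measurable M" by (rule measurable_M_borel)
  note mF[measurable] = F_c_measurable[OF mG]
  have den: "L2_norm_sq (band c) (band_weight c (- \<alpha>)) (L2_fourier f) = c * (\<integral>x. (cmod (?G x))\<^sup>2 \<partial>M)"
    unfolding L2_norm_sq_band_spectrum(2)[OF FL g eq] L2_norm_sq_band L2_norm_sq_I[OF mG] ..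
  have "AE x in lborel. x \<in> I \<longrightarrow> f x = of_real (c / (2 * pi)) * F_c c \<alpha> ?G x"
    using F(3) by eventually_elim (simp add: inverse_FT_band_spectrum)
  then have ae: "AE x in M. f x = of_real (c / (2 * pi)) * F_c c \<alpha> ?G x" unfolding AE_M .
  have "L2_norm_sq I (\<omega> \<alpha>) f = (\<integral>x. (cmod (of_real (c / (2 * pi)) * F_c c \<alpha> ?G x))\<^sup>2 \<partial>M)"
    unfolding L2_norm_sq_I[OF mf] by (rule integral_cong_AE) (use ae in auto)
  also have "\<dots> = (c / (2 * pi))\<^sup>2 * (\<integral>x. (cmod (F_c c \<alpha> ?G x))\<^sup>2 \<partial>M)"
    unfolding norm_mult power_mult_distrib norm_of_real power2_abs by simp
  also have "\<dots> = c / (2 * pi) * Q_energy ?G"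
    unfolding Q_energy_def F_c_energy[OF G, symmetric] by (simp only: power2_eq_square mult.assoc)
  finally have num: "L2_norm_sq I (\<omega> \<alpha>) f = c / (2 * pi) * Q_energy ?G" .
  show ?thesis unfolding energy_ratio_def num den using c_pos by simp
qed

text \<open>The inverse transform of the density is the candidate; uniqueness in the mean identifies
  the chosen \<open>L2_fourier\<close> with the density almost everywhere, which suffices for the
  support condition.\<close>

lemma paley_wiener_exists:
  assumes g: "g \<in> L2w (band c) W"
  shows "\<exists>f \<in> paley_wiener c \<alpha>. AE x in lborel. x \<in> band c \<longrightarrow> L2_fourier f x = g x * of_real (W x)"
proof
  let ?f = "inverse_FT (band_spectrum g)"
  note b = band_spectrum_integrable[OF g]
  note inv = is_L2_fourier_inverse_FT[OF b]
  have F: "is_L2_fourier ?f (L2_fourier ?f)" by (rule L2_fourier_is_fourier[OF inv(1)])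
  have mf: "?f \<in> borel_measurable borel" using inv(1) by (simp add: L2_line_iff)
  have ae: "AE x in lborel. L2_fourier ?f x = band_spectrum g x" by (rule is_L2_fourier_unique[OF mf F inv(2)])
  then show eq: "AE x in lborel. x \<in> band c \<longrightarrow> L2_fourier ?f x = g x * of_real (W x)"
    by eventually_elim (simp add: band_spectrum_def)
  have "ess_support (L2_fourier ?f) \<subseteq> {-c..c}"
  proof
    fix x assume x: "x \<in> ess_support (L2_fourier ?f)"
    show "x \<in> {-c..c}"
    proof (rule ccontr)
      assume "x \<notin> {-c..c}"
      moreover have "AE y in lborel. y \<in> - {-c..c} \<longrightarrow> L2_fourier ?f y = 0"
        using ae by eventually_elim (auto simp: band_spectrum_def)
      moreover have "open (- {-c..c})" by (simp add: open_Compl)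
      ultimately show False using x unfolding ess_support_def by blast
    qed
  qed
  moreover have "L2_fourier ?f \<in> L2w (band c) (band_weight c (- \<alpha>))"
    using F by (intro L2_norm_sq_band_spectrum(1)[OF _ g eq]) (simp add: is_L2_fourier_def)
  ultimately show "?f \<in> paley_wiener c \<alpha>" using inv(1) by (simp add: paley_wiener_def)
qed

text \<open>The weight has no zeros in the open band, so a density that is not null gives a
  transform that is not null, and a null function would have null transform by uniqueness.\<close>

lemma paley_wiener_nonzero:
  assumes f: "f \<in> paley_wiener c \<alpha>" and g: "\<not> (AE x in lborel. x \<in> band c \<longrightarrow> g x = 0)"
    and eq: "AE x in lborel. x \<in> band c \<longrightarrow> L2_fourier f x = g x * of_real (W x)"
  shows "nonzero_paley_wiener c \<alpha> f"
proof -
  have fL: "f \<in> L2_line" using f by (simp add: paley_wiener_def)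
  have "\<not> (AE x in lborel. f x = 0)"
  proof
    assume "AE x in lborel. f x = 0"
    then have "AE x in lborel. L2_fourier f x = 0"
      using is_L2_fourier_unique[OF _ L2_fourier_is_fourier[OF fL] is_L2_fourier_zero] fL by (simp add: L2_line_iff)
    with eq have "AE x in lborel. x \<in> band c \<longrightarrow> g x = 0"
    proof eventually_elim
      case (elim x)
      have "W x \<noteq> 0" if "x \<in> band c" using W_mult[OF that] by auto
      then show ?case using elim by auto
    qed
    with g show False by contradiction
  qed
  with f show ?thesis by (simp add: nonzero_paley_wiener_def)
qed

end

text \<open>The top eigenvalue is produced without reference to the \<open>\<psi>\<close>s and is
  identified with the eigenvalue of index 0 only at the end. The strict decrease of the eigenvalues
  belongs to the conventions on the \<open>\<psi>\<close>s and enters as a premise of the last two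
  assertions.\<close>

theorem mainTheorem2:
  fixes c \<alpha> :: real
  assumes "c > 0" and "\<alpha> \<ge> 0"
  shows
    "(\<forall>f \<in> paley_wiener c \<alpha>. \<exists>g \<in> L2w (band c) (band_weight c \<alpha>).
        AE x in lborel. x \<in> band c \<longrightarrow> L2_fourier f x = g x * of_real (band_weight c \<alpha> x))
   \<and> compact_L2_operator (band c) (band_weight c \<alpha>) (two_pi_Q c \<alpha>)
   \<and> (\<exists>\<Lambda>. largest_L2_eigenvalue (band c) (band_weight c \<alpha>) (two_pi_Q c \<alpha>) \<Lambda> \<and>
        (\<forall>g. L2_eigenfunction (band c) (band_weight c \<alpha>) (two_pi_Q c \<alpha>) (of_real \<Lambda>) g \<longrightarrow>
           (\<exists>f \<in> paley_wiener c \<alpha>.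
              AE x in lborel. x \<in> band c \<longrightarrow> L2_fourier f x = g x * of_real (band_weight c \<alpha> x)) \<and>
           (\<forall>f \<in> paley_wiener c \<alpha>.
              (AE x in lborel. x \<in> band c \<longrightarrow> L2_fourier f x = g x * of_real (band_weight c \<alpha> x)) \<longrightarrow>
              is_arg_max (energy_ratio c \<alpha>) (nonzero_paley_wiener c \<alpha>) f)))
   \<and> (\<forall>g z. L2_eigenfunction (band c) (band_weight c \<alpha>) (two_pi_Q c \<alpha>) z g \<longleftrightarrow>
        L2_eigenfunction I (\<omega> \<alpha>) (Q_c c \<alpha>) z (\<lambda>x. g (c * x)))
   \<and> (\<forall>\<psi>. is_GPSWF c \<alpha> \<psi> \<longrightarrow>
        (\<forall>n. \<forall>x\<in>I. F_c c \<alpha> (\<lambda>y. of_real (\<psi> n y)) x = mu c \<alpha> \<psi> n * of_real (\<psi> n x)) \<and>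
        (\<forall>n. \<forall>x\<in>I. Q_c c \<alpha> (\<lambda>y. of_real (\<psi> n y)) x
               = of_real (lambda c \<alpha> \<psi> n) * of_real (\<psi> n x)) \<and>
        ((\<forall>m n. m < n \<longrightarrow> lambda c \<alpha> \<psi> n < lambda c \<alpha> \<psi> m) \<longrightarrow>
           (\<forall>G \<in> L2w I (\<omega> \<alpha>). \<forall>z. L2_eigenfunction I (\<omega> \<alpha>) (Q_c c \<alpha>) z G \<longleftrightarrow>
              (\<exists>n a. z = of_real (lambda c \<alpha> \<psi> n) \<and> a \<noteq> 0 \<and>
                 (AE x in lborel. x \<in> I \<longrightarrow> G x = a * of_real (\<psi> n x)))) \<and>
           (\<exists>f. is_arg_max (energy_ratio c \<alpha>) (nonzero_paley_wiener c \<alpha>) f \<and>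
                energy_ratio c \<alpha> f = lambda c \<alpha> \<psi> 0)))"
proof -
  interpret prolate c \<alpha> using assms by unfold_locales
  obtain \<Lambda> where \<Lambda>: "\<Lambda> > 0" "\<exists>G. L2_eigenfunction I (\<omega> \<alpha>) (Q_c c \<alpha>) (of_real \<Lambda>) G"
    and top: "\<And>z G. L2_eigenfunction I (\<omega> \<alpha>) (Q_c c \<alpha>) z G \<Longrightarrow> z \<in> \<real> \<and> Re z \<le> \<Lambda>"
    and rayleigh: "\<And>G. G \<in> L2w I (\<omega> \<alpha>) \<Longrightarrow> Q_energy G \<le> \<Lambda> * (\<integral>x. (cmod (G x))\<^sup>2 \<partial>M)"
    using largest_eigenvalue_Q_c by blast
  obtain G0 where G0: "L2_eigenfunction I (\<omega> \<alpha>) (Q_c c \<alpha>) (of_real \<Lambda>) G0" using \<Lambda>(2) ..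
  \<comment> \<open>The top eigenfunction transported back from \<open>I\<close> to the
    band.\<close>
  define g0 where "g0 x = G0 (x / c)" for x
  have "(\<lambda>x. g0 (c * x)) = G0" using c_pos by (auto simp: g0_def)
  then have g0: "L2_eigenfunction (band c) W (two_pi_Q c \<alpha>) (of_real \<Lambda>) g0"
    unfolding L2_eigenfunction_band_iff using G0 by simp
  have largest: "largest_L2_eigenvalue (band c) W (two_pi_Q c \<alpha>) \<Lambda>"
    unfolding largest_L2_eigenvalue_def
  proof (intro conjI allI impI exI[of _ g0] g0)
    fix z g assume "L2_eigenfunction (band c) W (two_pi_Q c \<alpha>) z g"
    from top[OF this[unfolded L2_eigenfunction_band_iff]] show "z \<in> \<real>" "Re z \<le> \<Lambda>" by auto
  qed
  have ratio_le: "energy_ratio c \<alpha> f \<le> \<Lambda>" if f: "f \<in> paley_wiener c \<alpha>" for f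
  proof -
    obtain g where g: "g \<in> L2w (band c) W" "AE x in lborel. x \<in> band c \<longrightarrow> L2_fourier f x = g x * of_real (W x)"
      using paley_wiener_density[OF f] by blast
    have "Q_energy (\<lambda>x. g (c * x)) \<le> \<Lambda> * (\<integral>x. (cmod (g (c * x)))\<^sup>2 \<partial>M)"
      using rayleigh g(1) by (simp add: L2w_band_iff)
    moreover have "0 \<le> (\<integral>x. (cmod (g (c * x)))\<^sup>2 \<partial>M)" by simp
    \<comment> \<open>A null density gives \<open>0 / 0 = 0\<close>, which is below
      \<open>\<Lambda>\<close> because \<open>\<Lambda>\<close> is positive; so the bound holds on
      the whole space.\<close>
    ultimately show ?thesis unfolding energy_ratio_eq[OF f g] using \<Lambda>(1)
      by (cases "(\<integral>x. (cmod (g (c * x)))\<^sup>2 \<partial>M) = 0") (auto simp: divide_le_eq less_le)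
  qed
  have attained: "is_arg_max (energy_ratio c \<alpha>) (nonzero_paley_wiener c \<alpha>) f \<and> energy_ratio c \<alpha> f = \<Lambda>"
    if g: "L2_eigenfunction (band c) W (two_pi_Q c \<alpha>) (of_real \<Lambda>) g" and f: "f \<in> paley_wiener c \<alpha>"
      and eq: "AE x in lborel. x \<in> band c \<longrightarrow> L2_fourier f x = g x * of_real (W x)" for f g
  proof -
    have gL: "g \<in> L2w (band c) W" and gnz: "\<not> (AE x in lborel. x \<in> band c \<longrightarrow> g x = 0)"
      using g by (auto simp: L2_eigenfunction_def)
    note E = Q_c_eigenfunction_ReIm[OF g[unfolded L2_eigenfunction_band_iff]]
    have r: "energy_ratio c \<alpha> f = \<Lambda>"
      unfolding energy_ratio_eq[OF f gL eq] E(4) using E(2) by simp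
    have "\<not> energy_ratio c \<alpha> f < energy_ratio c \<alpha> f'" if "nonzero_paley_wiener c \<alpha> f'" for f'
      using ratio_le[of f'] that r by (auto simp: nonzero_paley_wiener_def)
    then show ?thesis
      using r paley_wiener_nonzero[OF f gnz eq] by (auto simp: is_arg_max_def)
  qed
  have gpswf: "(\<forall>n. \<forall>x\<in>I. F_c c \<alpha> (\<lambda>y. of_real (\<psi> n y)) x = mu c \<alpha> \<psi> n * of_real (\<psi> n x)) \<and>
        (\<forall>n. \<forall>x\<in>I. Q_c c \<alpha> (\<lambda>y. of_real (\<psi> n y)) x
               = of_real (lambda c \<alpha> \<psi> n) * of_real (\<psi> n x)) \<and>
        ((\<forall>m n. m < n \<longrightarrow> lambda c \<alpha> \<psi> n < lambda c \<alpha> \<psi> m) \<longrightarrow>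
           (\<forall>G \<in> L2w I (\<omega> \<alpha>). \<forall>z. L2_eigenfunction I (\<omega> \<alpha>) (Q_c c \<alpha>) z G \<longleftrightarrow>
              (\<exists>n a. z = of_real (lambda c \<alpha> \<psi> n) \<and> a \<noteq> 0 \<and>
                 (AE x in lborel. x \<in> I \<longrightarrow> G x = a * of_real (\<psi> n x)))) \<and>
           (\<exists>f. is_arg_max (energy_ratio c \<alpha>) (nonzero_paley_wiener c \<alpha>) f \<and>
                energy_ratio c \<alpha> f = lambda c \<alpha> \<psi> 0))"
    if psi: "is_GPSWF c \<alpha> \<psi>" for \<psi>
  proof (intro conjI impI)
    show "\<forall>n. \<forall>x\<in>I. F_c c \<alpha> (\<lambda>y. of_real (\<psi> n y)) x = mu c \<alpha> \<psi> n * of_real (\<psi> n x)"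
      using F_c_psi[OF psi] by blast
    show "\<forall>n. \<forall>x\<in>I. Q_c c \<alpha> (\<lambda>y. of_real (\<psi> n y)) x = of_real (lambda c \<alpha> \<psi> n) * of_real (\<psi> n x)"
      using Q_c_psi[OF psi] by blast
    assume dec: "\<forall>m n. m < n \<longrightarrow> lambda c \<alpha> \<psi> n < lambda c \<alpha> \<psi> m"
    \<comment> \<open>Strict decrease is used here for distinctness of the eigenvalues, and at the
      end to single out the index 0.\<close>
    have inj: "m = n" if "lambda c \<alpha> \<psi> m = lambda c \<alpha> \<psi> n" for m n
      using dec that by (metis less_irrefl linorder_neqE_nat)
    have psi_nz: "\<not> (AE x in M. \<psi> n x = 0)" for n
      using psi_norm[OF psi, of n] ip_self_zero[OF psi_HS[OF psi, of n]] by auto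
    have char: "L2_eigenfunction I (\<omega> \<alpha>) (Q_c c \<alpha>) z G \<longleftrightarrow>
        (\<exists>n a. z = of_real (lambda c \<alpha> \<psi> n) \<and> a \<noteq> 0 \<and> (AE x in lborel. x \<in> I \<longrightarrow> G x = a * of_real (\<psi> n x)))"
      if G: "G \<in> L2w I (\<omega> \<alpha>)" for G z
    proof
      assume eig: "L2_eigenfunction I (\<omega> \<alpha>) (Q_c c \<alpha>) z G"
      note E = Q_c_eigenfunction_ReIm[OF eig]
      note P = L2w_I_ReIm(1)[OF G] and R = L2w_I_ReIm(2)[OF G]
      have nz: "\<not> (AE x in M. G x = 0)" using eig by (simp add: L2_eigenfunction_def AE_M)
      have zr: "z = of_real (Re z)" using E(3) by (simp add: of_real_Re)
      \<comment> \<open>The classification divides by the eigenvalue, so 0 is excluded first: both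
        quadratic forms would vanish, and injectivity of \<open>Q\<close> would make
        \<open>G\<close> null.\<close>
      have "Re z \<noteq> 0"
      proof
        assume "Re z = 0"
        then have "AE x in M. Qr (\<lambda>y. Re (G y)) x = 0" "AE x in M. Qr (\<lambda>y. Im (G y)) x = 0"
          using E(5,6) by simp_all
        then have "ip (Qr (\<lambda>y. Re (G y))) (\<lambda>y. Re (G y)) = 0" "ip (Qr (\<lambda>y. Im (G y))) (\<lambda>y. Im (G y)) = 0"
          unfolding ip_def by (auto intro!: integral_eq_zero_AE)
        then have "AE x in M. Re (G x) = 0" "AE x in M. Im (G x) = 0" using Qr_injective P R by auto
        then have "AE x in M. G x = 0" by eventually_elim (simp add: complex_eq_iff)
        with nz show False ..
      qed
      note z0 = this
      have cl: "(AE x in M. v x = 0) \<or> (\<exists>n a. lambda c \<alpha> \<psi> n = Re z \<and> (AE x in M. v x = a * \<psi> n x))"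
        if "v \<in> HS" "AE x in M. Qr v x = Re z * v x" for v
        by (rule Qr_eigenfunction_classification[OF psi z0 _ that]) (rule inj)
      \<comment> \<open>Real and imaginary parts are classified separately. When neither is null
        their indices agree by distinctness; when one is null its coefficient is 0. The two
        coefficients combine to one complex factor.\<close>
      have "\<exists>n a b. lambda c \<alpha> \<psi> n = Re z \<and> (AE x in M. Re (G x) = a * \<psi> n x) \<and> (AE x in M. Im (G x) = b * \<psi> n x)"
        using cl[OF P E(5)] cl[OF R E(6)]
      proof (elim disjE exE conjE)
        assume "AE x in M. Re (G x) = 0" "AE x in M. Im (G x) = 0"
        then have "AE x in M. G x = 0" by eventually_elim (simp add: complex_eq_iff)
        with nz show ?thesis by contradiction
      next
        fix n b assume "AE x in M. Re (G x) = 0" "lambda c \<alpha> \<psi> n = Re z" "AE x in M. Im (G x) = b * \<psi> n x"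
        then show ?thesis by (intro exI[of _ n] exI[of _ 0] exI[of _ b]) simp
      next
        fix n a assume "AE x in M. Im (G x) = 0" "lambda c \<alpha> \<psi> n = Re z" "AE x in M. Re (G x) = a * \<psi> n x"
        then show ?thesis by (intro exI[of _ n] exI[of _ a] exI[of _ 0]) simp
      next
        fix n a m b assume "lambda c \<alpha> \<psi> n = Re z" "AE x in M. Re (G x) = a * \<psi> n x"
          "lambda c \<alpha> \<psi> m = Re z" "AE x in M. Im (G x) = b * \<psi> m x"
        moreover from this have "m = n" by (intro inj) simp
        ultimately show ?thesis by (intro exI[of _ n] exI[of _ a] exI[of _ b]) simp
      qed
      then obtain n a b where n: "lambda c \<alpha> \<psi> n = Re z" and ab: "AE x in M. Re (G x) = a * \<psi> n x" "AE x in M. Im (G x) = b * \<psi> n x"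
        by blast
      have ae: "AE x in M. G x = Complex a b * of_real (\<psi> n x)"
        using ab by eventually_elim (simp add: complex_eq_iff)
      have "Complex a b \<noteq> 0"
      proof
        assume "Complex a b = 0"
        with ae have "AE x in M. G x = 0" by simp
        with nz show False ..
      qed
      with n zr ae show "\<exists>n a. z = of_real (lambda c \<alpha> \<psi> n) \<and> a \<noteq> 0 \<and> (AE x in lborel. x \<in> I \<longrightarrow> G x = a * of_real (\<psi> n x))"
        unfolding AE_M by (intro exI[of _ n] exI[of _ "Complex a b"]) simp
    next
      assume "\<exists>n a. z = of_real (lambda c \<alpha> \<psi> n) \<and> a \<noteq> 0 \<and> (AE x in lborel. x \<in> I \<longrightarrow> G x = a * of_real (\<psi> n x))"
      then obtain n a where z: "z = of_real (lambda c \<alpha> \<psi> n)" and a: "a \<noteq> 0" and ae: "AE x in M. G x = a * of_real (\<psi> n x)"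
        unfolding AE_M by blast
      have psiL: "(\<lambda>x. complex_of_real (\<psi> n x)) \<in> L2w I (\<omega> \<alpha>)" by (rule L2w_I_of_real[OF psi_HS[OF psi]])
      \<comment> \<open>\<open>G\<close> is a multiple of \<open>\<psi> n\<close> only almost
        everywhere, which the integral does not notice. The second summand with coefficient 0 puts
        the multiple into the shape required by \<open>Q_c_linear\<close>.\<close>
      have QG: "Q_c c \<alpha> G x = Q_c c \<alpha> (\<lambda>t. a * of_real (\<psi> n t) + 0 * of_real (\<psi> n t)) x" for x
      proof -
        have [measurable]: "G \<in> borel_measurable M" "(\<lambda>x. complex_of_real (\<psi> n x)) \<in> borel_measurable M" "Kf x \<in> borel_measurable M"
          using G psiL Kf_measurable by (auto simp: L2w_I_iff)
        have m: "(\<lambda>t. a * complex_of_real (\<psi> n t) + 0 * of_real (\<psi> n t)) \<in> borel_measurable M" by measurable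
        show ?thesis
          unfolding Q_c_eq[OF \<open>G \<in> borel_measurable M\<close>] Q_c_eq[OF m]
          by (rule integral_cong_AE) (use ae in \<open>auto elim!: eventually_mono\<close>)
      qed
      have "AE x in M. Q_c c \<alpha> G x = z * G x"
      proof -
        have "AE x in M. x \<in> I" by (rule AE_I2) simp
        with ae show ?thesis
          by eventually_elim (simp add: QG Q_c_linear[OF psiL psiL, of a 0, simplified] Q_c_psi[OF psi] z)
      qed
      moreover have "\<not> (AE x in M. G x = 0)"
      proof
        assume "AE x in M. G x = 0"
        with ae have "AE x in M. \<psi> n x = 0" by eventually_elim (use a in simp)
        with psi_nz show False by blast
      qed
      ultimately show "L2_eigenfunction I (\<omega> \<alpha>) (Q_c c \<alpha>) z G"
        unfolding L2_eigenfunction_def using G by (simp add: AE_M)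
    qed
    then show "\<forall>G \<in> L2w I (\<omega> \<alpha>). \<forall>z. L2_eigenfunction I (\<omega> \<alpha>) (Q_c c \<alpha>) z G \<longleftrightarrow>
        (\<exists>n a. z = of_real (lambda c \<alpha> \<psi> n) \<and> a \<noteq> 0 \<and> (AE x in lborel. x \<in> I \<longrightarrow> G x = a * of_real (\<psi> n x)))"
      by blast
    \<comment> \<open>\<open>\<psi> 0\<close> shows that its eigenvalue is at most the top one;
      conversely the top eigenfunction belongs to some index \<open>n\<close>, and decrease bounds
      that eigenvalue by the one of index 0.\<close>
    have "\<Lambda> = lambda c \<alpha> \<psi> 0"
    proof (rule antisym)
      have "L2_eigenfunction I (\<omega> \<alpha>) (Q_c c \<alpha>) (of_real (lambda c \<alpha> \<psi> 0)) (\<lambda>x. of_real (\<psi> 0 x))"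
        unfolding char[OF L2w_I_of_real[OF psi_HS[OF psi]]] by (intro exI[of _ 0] exI[of _ 1]) simp
      from top[OF this] show "lambda c \<alpha> \<psi> 0 \<le> \<Lambda>" by simp
      have "G0 \<in> L2w I (\<omega> \<alpha>)" using G0 by (simp add: L2_eigenfunction_def)
      from char[OF this] G0 obtain n where "complex_of_real \<Lambda> = of_real (lambda c \<alpha> \<psi> n)" by blast
      then have "\<Lambda> = lambda c \<alpha> \<psi> n" by (simp only: of_real_eq_iff)
      then show "\<Lambda> \<le> lambda c \<alpha> \<psi> 0" using dec by (cases n) (auto intro: less_imp_le)
    qed
    moreover obtain f0 where "f0 \<in> paley_wiener c \<alpha>" "AE x in lborel. x \<in> band c \<longrightarrow> L2_fourier f0 x = g0 x * of_real (W x)"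
      using paley_wiener_exists[of g0] g0 unfolding L2_eigenfunction_def by blast
    ultimately show "\<exists>f. is_arg_max (energy_ratio c \<alpha>) (nonzero_paley_wiener c \<alpha>) f \<and> energy_ratio c \<alpha> f = lambda c \<alpha> \<psi> 0"
      using attained[OF g0] by auto
  qed
  show ?thesis
  proof (intro conjI)
    show "\<forall>f \<in> paley_wiener c \<alpha>. \<exists>g \<in> L2w (band c) W.
        AE x in lborel. x \<in> band c \<longrightarrow> L2_fourier f x = g x * of_real (W x)"
      using paley_wiener_density by blast
    show "compact_L2_operator (band c) W (two_pi_Q c \<alpha>)" by (rule compact_two_pi_Q)
    show "\<forall>g z. L2_eigenfunction (band c) W (two_pi_Q c \<alpha>) z g \<longleftrightarrow>
        L2_eigenfunction I (\<omega> \<alpha>) (Q_c c \<alpha>) z (\<lambda>x. g (c * x))"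
      using L2_eigenfunction_band_iff by blast
    show "\<exists>\<Lambda>. largest_L2_eigenvalue (band c) W (two_pi_Q c \<alpha>) \<Lambda> \<and>
        (\<forall>g. L2_eigenfunction (band c) W (two_pi_Q c \<alpha>) (of_real \<Lambda>) g \<longrightarrow>
           (\<exists>f \<in> paley_wiener c \<alpha>.
              AE x in lborel. x \<in> band c \<longrightarrow> L2_fourier f x = g x * of_real (W x)) \<and>
           (\<forall>f \<in> paley_wiener c \<alpha>.
              (AE x in lborel. x \<in> band c \<longrightarrow> L2_fourier f x = g x * of_real (W x)) \<longrightarrow>
              is_arg_max (energy_ratio c \<alpha>) (nonzero_paley_wiener c \<alpha>) f))"
    proof (intro exI[of _ \<Lambda>] conjI allI impI ballI largest)
      fix g assume g: "L2_eigenfunction (band c) W (two_pi_Q c \<alpha>) (of_real \<Lambda>) g"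
      then show "\<exists>f \<in> paley_wiener c \<alpha>. AE x in lborel. x \<in> band c \<longrightarrow> L2_fourier f x = g x * of_real (W x)"
        by (intro paley_wiener_exists) (simp add: L2_eigenfunction_def)
      fix f assume "f \<in> paley_wiener c \<alpha>" "AE x in lborel. x \<in> band c \<longrightarrow> L2_fourier f x = g x * of_real (W x)"
      then show "is_arg_max (energy_ratio c \<alpha>) (nonzero_paley_wiener c \<alpha>) f"
        using attained[OF g] by blast
    qed
  qed (use gpswf in blast)
qed

end
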